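(* Let $d\in\mathbb{N}^*$ and let $\Omega$ and $\mathcal{W}$ be compact subsets of $\mathbb{R}^d$. For $r>0$ let $P_{LPS}^{(r)}=P_{r\Omega}P_{\mathcal{W}}P_{r\Omega}\colon L^2(\mathbb{R}^d)\to L^2(\mathbb{R}^d)$, where $P_{r\Omega}f=\mathbb{1}_{r\Omega}f$ and $P_{\mathcal{W}}f=\mathcal{F}^{-1}\mathbb{1}_{\mathcal{W}}\mathcal{F}f$. Then for every $\varepsilon\in(0,1]$, \[ \lim_{r\to\infty}\frac{H\!\left(\varepsilon;P_{LPS}^{(r)}\right)}{r^d}=\frac{2\,\mathcal{H}^d(\Omega)\,\mathcal{H}^d(\mathcal{W})}{(2\pi)^d}\log\!\left(\varepsilon^{-1}\right). \]
   Context: $\mathcal{F}$ denotes the Fourier transform on $L^2(\mathbb{R}^d)$, $\mathbb{1}_X$ the indicator function of $X$, $r\Omega=\{rx:x\in\Omega\}$, and $\mathcal{H}^d$ the $d$-dimensional Hausdorff measure. $\log$ is base $2$. For a compact set $K$ in a metric space $(X,d)$, $N(\varepsilon;K,d)$ is the minimal cardinality of a set $\{x_1,\dots,x_N\}\subseteq X$ such that every $x\in K$ has $d(x,x_i)\le\varepsilon$ for some $i$, and $H(\varepsilon;K,d)=\log N(\varepsilon;K,d)$. For a compact linear operator $T$ on $L^2(\mathbb{R}^d)$ with closed unit ball $\mathcal{B}$, the entropy is $H(\varepsilon;T)=H(\varepsilon;\overline{T(\mathcal{B})},\|\cdot\|_{L^2})$. *)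

theory Defs
  imports "HOL-Analysis.Analysis"
begin

text \<open>Functions on R^d are represented by complex-valued functions on a Euclidean space;
  L^2 is the set of Lebesgue-measurable square-integrable functions, with the L^2 (semi)metric.\<close>

definition L2 :: "('a::euclidean_space \<Rightarrow> complex) set" where
  "L2 = {f. f \<in> borel_measurable lebesgue \<and> integrable lebesgue (\<lambda>x. (cmod (f x))\<^sup>2)}"

definition L2_norm :: "('a::euclidean_space \<Rightarrow> complex) \<Rightarrow> real" where
  "L2_norm f = sqrt (\<integral>x. (cmod (f x))\<^sup>2 \<partial>lebesgue)"

definition L2_dist :: "('a::euclidean_space \<Rightarrow> complex) \<Rightarrow> ('a \<Rightarrow> complex) \<Rightarrow> real" where
  "L2_dist f g = L2_norm (\<lambda>x. f x - g x)"

text \<open>Closed unit ball of L^2.\<close>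
definition L2_unit_ball :: "('a::euclidean_space \<Rightarrow> complex) set" where
  "L2_unit_ball = {f \<in> L2. L2_norm f \<le> 1}"

text \<open>Closure of a set of L^2 functions with respect to the L^2 metric.\<close>
definition L2_closure :: "('a::euclidean_space \<Rightarrow> complex) set \<Rightarrow> ('a \<Rightarrow> complex) set" where
  "L2_closure K = {g \<in> L2. \<forall>\<delta>>0. \<exists>f\<in>K. L2_dist f g < \<delta>}"

text \<open>Covering number N(eps; K, d) with centres in X, and metric entropy (log base 2).\<close>
definition covering_number :: "real \<Rightarrow> 'b set \<Rightarrow> 'b set \<Rightarrow> ('b \<Rightarrow> 'b \<Rightarrow> real) \<Rightarrow> nat" where
  "covering_number eps K X d =
     (LEAST n. \<exists>S. finite S \<and> card S = n \<and> S \<subseteq> X \<and> (\<forall>x\<in>K. \<exists>s\<in>S. d x s \<le> eps))"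

definition metric_entropy :: "real \<Rightarrow> 'b set \<Rightarrow> 'b set \<Rightarrow> ('b \<Rightarrow> 'b \<Rightarrow> real) \<Rightarrow> real" where
  "metric_entropy eps K X d = log 2 (real (covering_number eps K X d))"

text \<open>Entropy of a linear operator T on L^2: H(eps; closure (T(B)), L^2).\<close>
definition operator_entropy ::
  "real \<Rightarrow> (('a::euclidean_space \<Rightarrow> complex) \<Rightarrow> ('a \<Rightarrow> complex)) \<Rightarrow> real" where
  "operator_entropy eps T = metric_entropy eps (L2_closure (T ` L2_unit_ball)) L2 L2_dist"

text \<open>Time limiting P_A f = 1_A f.\<close>
definition time_limit :: "'a::euclidean_space set \<Rightarrow> ('a \<Rightarrow> complex) \<Rightarrow> ('a \<Rightarrow> complex)" where
  "time_limit A f = (\<lambda>x. indicator A x * f x)"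

text \<open>Fourier transform F f(xi) = int f(x) e^{-i x.xi} dx and inverse
  F^{-1} g(x) = (2 pi)^{-d} int g(xi) e^{i x.xi} dxi, given by Lebesgue integrals.
  They are only applied to functions in L^1 \<inter> L^2 (compactly supported L^2 functions,
  resp. bounded functions supported in the compact set W), where they agree with the
  L^2 Fourier transform.\<close>
definition fourier :: "('a::euclidean_space \<Rightarrow> complex) \<Rightarrow> ('a \<Rightarrow> complex)" where
  "fourier f = (\<lambda>\<xi>. \<integral>x. f x * exp (- \<i> * complex_of_real (x \<bullet> \<xi>)) \<partial>lebesgue)"

definition inv_fourier :: "('a::euclidean_space \<Rightarrow> complex) \<Rightarrow> ('a \<Rightarrow> complex)" where
  "inv_fourier g = (\<lambda>x. complex_of_real ((2 * pi) powi (- int DIM('a))) *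
      (\<integral>\<xi>. g \<xi> * exp (\<i> * complex_of_real (x \<bullet> \<xi>)) \<partial>lebesgue))"

text \<open>Band limiting P_W f = F^{-1} 1_W F f.\<close>
definition band_limit :: "'a::euclidean_space set \<Rightarrow> ('a \<Rightarrow> complex) \<Rightarrow> ('a \<Rightarrow> complex)" where
  "band_limit W f = inv_fourier (\<lambda>\<xi>. indicator W \<xi> * fourier f \<xi>)"

text \<open>P_LPS^(r) = P_{r Omega} P_W P_{r Omega}.\<close>
definition P_LPS :: "real \<Rightarrow> 'a::euclidean_space set \<Rightarrow> 'a set \<Rightarrow> ('a \<Rightarrow> complex) \<Rightarrow> ('a \<Rightarrow> complex)" where
  "P_LPS r \<Omega> W = time_limit ((*\<^sub>R) r ` \<Omega>) \<circ> band_limit W \<circ> time_limit ((*\<^sub>R) r ` \<Omega>)"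

end

theory Submission
  imports Defs "HOL-Probability.Characteristic_Functions"
begin

text \<open>
  Write A = r\<Omega> and let K be the inverse Fourier transform of the indicator of W. The operator
  P_A P_W P_A is the integral operator on A with kernel K(x - y). Sampling the kernel on a fine
  partition of A approximates it by an operator of finite rank, which is diagonalised as a real
  symmetric matrix on the real Hilbert space of complex functions (hence every eigenvalue counts
  twice). Its eigenvalues lie in [0, 1 + \<kappa>] by a Gaussian version of Plancherel's inequality, their
  sum is 2\<tau> r^d with \<tau> = |\<Omega>| |W| / (2\<pi>)^d, and the sum of their squares is at least
  (2\<tau> - o(1)) r^d, because the integral of |K|^2 over the whole space is |W| / (2\<pi>)^d. So all but
  o(r^d) eigenvalues are close to 0 or to 1, and about 2\<tau> r^d of them are close to 1.
  Up to small errors, the image of the unit ball is thus squeezed between two real Euclidean balls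
  of radius close to 1 and dimension 2\<tau> r^d + o(r^d). Covering the unit ball of dimension n by balls of radius \<epsilon> takes at
  least (1/\<epsilon>)^n balls by comparison of volumes, and at most (1/\<epsilon> + o(1))^n by a greedy choice of
  centres in a ball of radius \<surd>(1 - \<epsilon>^2), up to slightly enlarged radii.
\<close>

section \<open>Covering numbers of Euclidean balls\<close>

text \<open>The simple volumetric cover of a ball of dimension n, with (1 + 2/\<epsilon>)^n centres,
  has the wrong constant in the exponent; since the limit asks for the exact constant, the covering
  part has to be sharp up to factors (1 + \<eta>)^n and polynomials in n. The remaining additive
  loss is independent of the dimension and vanishes after division by r^d. Gaussian weights make
  every exchange of integrals absolutely convergent: for the energy, the width of the weight is
  fixed before r grows, and removing the weight only increases the energy; for the eigenvalues, the
  indicator of W is dominated by a multiple of a Gaussian, whence 1 + \<kappa> in place of 1. A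
  lower bound of the energy is all that is asked for: it bounds the sum of the nonnegative terms
  \<mu> (1 + \<kappa> - \<mu>) from above, and every eigenvalue away from 0 and 1 makes such a term
  large. The size of the sampled matrix enters no estimate, only its trace and energy do, so the
  mesh may be as fine as each r demands.\<close>

abbreviation coord_space :: "'i set \<Rightarrow> ('i \<Rightarrow> real) measure" where
  "coord_space J \<equiv> PiM J (\<lambda>_. lborel)"

definition coord_ball :: "'i set \<Rightarrow> real \<Rightarrow> ('i \<Rightarrow> real) set" where
  "coord_ball J r = {x \<in> space (coord_space J). L2_set x J \<le> r}"

interpretation lborel_product: product_sigma_finite "\<lambda>_::'i. lborel :: real measure"
  by standard

lemma L2_set_le_iff: "0 \<le> r \<Longrightarrow> L2_set f J \<le> r \<longleftrightarrow> (\<Sum>i\<in>J. (f i)\<^sup>2) \<le> r\<^sup>2"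
  unfolding L2_set_def by (metis real_le_lsqrt real_sqrt_le_iff real_sqrt_abs abs_of_nonneg sqrt_le_D)

lemma L2_set_square: "(L2_set f J)\<^sup>2 = (\<Sum>i\<in>J. (f i)\<^sup>2)"
  unfolding L2_set_def by (simp add: sum_nonneg)

lemma L2_set_minus_commute: "L2_set (\<lambda>i. f i - g i) J = L2_set (\<lambda>i. g i - f i) J"
  unfolding L2_set_def by (simp add: power2_commute)

lemma L2_set_triangle_diff:
  "L2_set (\<lambda>i. f i - h i) J \<le> L2_set (\<lambda>i. f i - g i) J + L2_set (\<lambda>i. g i - h i) J"
  using L2_set_triangle_ineq[of "\<lambda>i. f i - g i" "\<lambda>i. g i - h i" J] by simp

lemma coord_ball_sets[measurable]: "finite J \<Longrightarrow> coord_ball J r \<in> sets (coord_space J)"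
  unfolding coord_ball_def L2_set_def by measurable

lemma coord_affine_measurable[measurable]:
  "(\<lambda>x. restrict (\<lambda>i. a i + c * x i) J) \<in> coord_space J \<rightarrow>\<^sub>M coord_space J"
  by measurable

section \<open>Affine changes of variables and volumes of balls in coordinate space\<close>

lemma emeasure_lborel_affine_preimage:
  fixes t c :: real
  assumes "c > 0" and [measurable]: "A \<in> sets borel"
  shows "emeasure lborel A = ennreal c * emeasure lborel {y. t + c * y \<in> A}"
proof -
  have "emeasure lborel A = emeasure (density (distr lborel borel (\<lambda>x. t + c * x)) (\<lambda>_. ennreal \<bar>c\<bar>)) A"
    using lborel_real_affine[of c t] assms(1) by simp
  also have "\<dots> = ennreal c * emeasure (distr lborel borel (\<lambda>x. t + c * x)) A"
    using assms(1) by (simp add: emeasure_density nn_integral_cmult)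
  also have "emeasure (distr lborel borel (\<lambda>x. t + c * x)) A = emeasure lborel {y. t + c * y \<in> A}"
    by (simp add: emeasure_distr vimage_def)
  finally show ?thesis .
qed

text \<open>The push-forward under the affine map, multiplied by c^card J, agrees with the product
  measure on every box, coordinate by coordinate, and boxes determine the product measure. The case
  c = 1 gives translation invariance, the case a = 0 the scaling of balls.\<close>

lemma emeasure_coord_affine:
  assumes [simp]: "finite J" and c: "c > 0" and A[measurable]: "A \<in> sets (coord_space J)"
  shows "ennreal (c ^ card J) *
      emeasure (coord_space J) {x \<in> space (coord_space J). restrict (\<lambda>i. a i + c * x i) J \<in> A}
    = emeasure (coord_space J) A"
proof -
  let ?T = "\<lambda>x. restrict (\<lambda>i. a i + c * x i) J"
  let ?P = "scale_measure (ennreal (c ^ card J)) (distr (coord_space J) (coord_space J) ?T)"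
  have "?P = coord_space J"
  proof (rule lborel_product.PiM_eqI)
    show "sets ?P = sets (coord_space J)" by simp
    fix B :: "'a \<Rightarrow> real set" assume B: "\<And>i. i \<in> J \<Longrightarrow> B i \<in> sets lborel"
    have B': "PiE J B \<in> sets (coord_space J)"
      using B by (intro sets_PiM_I_finite) auto
    have pre: "?T -` PiE J B \<inter> space (coord_space J) = PiE J (\<lambda>i. {y. a i + c * y \<in> B i})"
      by (auto simp: space_PiM PiE_iff)
    have meas: "{y. a i + c * y \<in> B i} \<in> sets lborel" if "i \<in> J" for i
    proof -
      have [measurable]: "B i \<in> sets borel" using B[OF that] by simp
      have "{y \<in> space borel. a i + c * y \<in> B i} \<in> sets borel" by measurable
      then show ?thesis by simp
    qed
    have "emeasure ?P (PiE J B) = ennreal (c ^ card J) * (\<Prod>i\<in>J. emeasure lborel {y. a i + c * y \<in> B i})"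
      using B' meas by (simp add: emeasure_distr pre lborel_product.emeasure_PiM)
    also have "\<dots> = (\<Prod>i\<in>J. ennreal c * emeasure lborel {y. a i + c * y \<in> B i})"
      using c by (simp add: prod.distrib ennreal_power)
    also have "\<dots> = (\<Prod>i\<in>J. emeasure lborel (B i))"
      using B c by (intro prod.cong refl emeasure_lborel_affine_preimage[symmetric]) auto
    finally show "emeasure ?P (PiE J B) = (\<Prod>i\<in>J. emeasure lborel (B i))" .
  qed simp
  then have "emeasure (coord_space J) A = emeasure ?P A" by simp
  also have "\<dots> = ennreal (c ^ card J) * emeasure (coord_space J) (?T -` A \<inter> space (coord_space J))"
    by (simp add: emeasure_distr)
  also have "?T -` A \<inter> space (coord_space J) = {x \<in> space (coord_space J). ?T x \<in> A}" by auto
  finally show ?thesis by simp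
qed

lemma emeasure_coord_translate:
  assumes "finite J" "A \<in> sets (coord_space J)"
  shows "emeasure (coord_space J) {x \<in> space (coord_space J). restrict (\<lambda>i. x i - a i) J \<in> A}
    = emeasure (coord_space J) A"
  using emeasure_coord_affine[OF assms(1) zero_less_one assms(2), of "\<lambda>i. - a i"] by simp

lemma emeasure_coord_ball_scale:
  assumes "finite J" "r > 0"
  shows "emeasure (coord_space J) (coord_ball J r) = ennreal (r ^ card J) * emeasure (coord_space J) (coord_ball J 1)"
proof -
  have "{x \<in> space (coord_space J). restrict (\<lambda>i. 0 + r * x i) J \<in> coord_ball J r} = coord_ball J 1"
  proof -
    have "L2_set (restrict (\<lambda>i. r * x i) J) J = r * L2_set x J" for x
      using assms by (subst L2_set_right_distrib) (auto intro!: L2_set_cong)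
    then show ?thesis using assms by (auto simp: coord_ball_def space_PiM)
  qed
  then show ?thesis
    using emeasure_coord_affine[OF assms, of "coord_ball J r" "\<lambda>_. 0"] assms by simp
qed

text \<open>The ball lies in the cube with coordinates in [-1, 1]. Since the sum norm dominates the
  Euclidean norm, it contains the cube with coordinates in [0, 1/(n+1)].\<close>

lemma emeasure_coord_ball_1:
  assumes [simp]: "finite J"
  shows "emeasure (coord_space J) (coord_ball J 1) < \<infinity>" "0 < emeasure (coord_space J) (coord_ball J 1)"
proof -
  let ?n = "real (card J)"
  have "coord_ball J 1 \<subseteq> PiE J (\<lambda>_. {-1..1})"
  proof
    fix x assume x: "x \<in> coord_ball J 1"
    have "\<bar>x i\<bar> \<le> 1" if "i \<in> J" for i
      using order_trans[OF member_le_L2_set[of J i "\<lambda>i. \<bar>x i\<bar>"], of 1] that x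
      by (simp add: coord_ball_def L2_set_def)
    then show "x \<in> PiE J (\<lambda>_. {-1..1})"
      using x by (auto simp: coord_ball_def space_PiM PiE_iff abs_le_iff minus_le_iff)
  qed
  then have "emeasure (coord_space J) (coord_ball J 1) \<le> emeasure (coord_space J) (PiE J (\<lambda>_. {-1..1}))"
    by (intro emeasure_mono sets_PiM_I_finite) auto
  also have "\<dots> < \<infinity>"
    by (simp add: lborel_product.emeasure_PiM ennreal_power flip: ennreal_numeral)
  finally show "emeasure (coord_space J) (coord_ball J 1) < \<infinity>" .
  have "PiE J (\<lambda>_. {0..1/(?n+1)}) \<subseteq> coord_ball J 1"
  proof
    fix x assume x: "x \<in> PiE J (\<lambda>_. {0..1/(?n+1)})"
    have "L2_set x J \<le> (\<Sum>i\<in>J. \<bar>x i\<bar>)" by (rule L2_set_le_sum_abs)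
    also have "\<dots> \<le> (\<Sum>i\<in>J. 1/(?n+1))" using x by (intro sum_mono) (auto simp: PiE_iff)
    also have "\<dots> \<le> 1" by (simp add: field_simps)
    finally show "x \<in> coord_ball J 1" using x by (auto simp: coord_ball_def space_PiM PiE_iff)
  qed
  then have "emeasure (coord_space J) (PiE J (\<lambda>_. {0..1/(?n+1)})) \<le> emeasure (coord_space J) (coord_ball J 1)"
    by (intro emeasure_mono) auto
  moreover have "emeasure (coord_space J) (PiE J (\<lambda>_. {0..1/(?n+1)})) > 0"
    by (simp add: lborel_product.emeasure_PiM ennreal_power)
  ultimately show "0 < emeasure (coord_space J) (coord_ball J 1)" by simp
qed

text \<open>Enters only as a positive factor that cancels when two balls over the same index set are
  compared.\<close>

definition ball_volume :: "'i set \<Rightarrow> real" where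
  "ball_volume J = measure (coord_space J) (coord_ball J 1)"

lemma ball_volume_pos: "finite J \<Longrightarrow> ball_volume J > 0"
  unfolding ball_volume_def measure_def using emeasure_coord_ball_1[of J]
  by (simp add: enn2real_positive_iff)

lemma emeasure_coord_ball:
  assumes "finite J" "r > 0"
  shows "emeasure (coord_space J) (coord_ball J r) = ennreal (r ^ card J * ball_volume J)"
  using emeasure_coord_ball_scale[OF assms] emeasure_coord_ball_1[OF assms(1)] assms ball_volume_pos[of J]
  by (simp add: ball_volume_def emeasure_eq_ennreal_measure ennreal_mult less_top[symmetric])

text \<open>All translated balls \<open>?B z\<close> have the same volume, and
  \<open>ball_volume J\<close> cancels; what is left is the ratio of the radii to the power
  \<open>card J\<close>.\<close>

lemma covering_card_lower:
  fixes J :: "'i set"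
  assumes J: "finite J" and Z: "finite Z" and "\<alpha> > 0" "\<rho> > 0"
    and cov: "\<And>y. L2_set y J \<le> \<alpha> \<Longrightarrow> \<exists>z\<in>Z. L2_set (\<lambda>i. y i - z i) J \<le> \<rho>"
  shows "(\<alpha> / \<rho>) ^ card J \<le> real (card Z)"
proof -
  let ?M = "coord_space J"
  let ?B = "\<lambda>z. {x \<in> space ?M. restrict (\<lambda>i. x i - z i) J \<in> coord_ball J \<rho>}"
  have meas: "?B z \<in> sets ?M" for z
    using measurable_sets[OF coord_affine_measurable[of "\<lambda>i. - z i" 1 J] coord_ball_sets[OF J, of \<rho>]]
    by (simp add: vimage_def Int_def conj_commute)
  have "coord_ball J \<alpha> \<subseteq> (\<Union>z\<in>Z. ?B z)"
  proof
    fix y assume y: "y \<in> coord_ball J \<alpha>"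
    then obtain z where "z \<in> Z" "L2_set (\<lambda>i. y i - z i) J \<le> \<rho>"
      using cov by (auto simp: coord_ball_def)
    then show "y \<in> (\<Union>z\<in>Z. ?B z)"
      using y by (auto simp: coord_ball_def space_PiM cong: L2_set_cong_simp)
  qed
  then have "emeasure ?M (coord_ball J \<alpha>) \<le> emeasure ?M (\<Union>z\<in>Z. ?B z)"
    using meas Z by (intro emeasure_mono sets.finite_UN) auto
  also have "\<dots> \<le> (\<Sum>z\<in>Z. emeasure ?M (?B z))"
    using meas Z by (intro emeasure_subadditive_finite) auto
  also have "\<dots> = (\<Sum>z\<in>Z. emeasure ?M (coord_ball J \<rho>))"
    using J by (simp add: emeasure_coord_translate)
  finally have "ennreal (\<alpha> ^ card J * ball_volume J) \<le> ennreal (real (card Z) * (\<rho> ^ card J * ball_volume J))"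
    using assms ball_volume_pos[OF J]
    by (simp add: emeasure_coord_ball ennreal_mult ennreal_of_nat_eq_real_of_nat)
  then have "\<alpha> ^ card J * ball_volume J \<le> real (card Z) * (\<rho> ^ card J * ball_volume J)"
    using assms ball_volume_pos[OF J] by (subst (asm) ennreal_le_iff) auto
  then have "\<alpha> ^ card J \<le> real (card Z) * \<rho> ^ card J"
    using ball_volume_pos[OF J] by simp
  then show ?thesis using assms by (simp add: power_divide divide_le_eq)
qed

section \<open>Greedy choice of centres and the sharp upper covering bound\<close>

text \<open>Say that y hits x if y lies in \<open>U x\<close>. Averaged over B, a point hits at
  least the proportion p of those x not yet hit, so some point does. Adding this point to Z
  multiplies the number of unhit x by at most 1 - p.\<close>

lemma greedy_cover:
  fixes X :: "'x set" and U :: "'x \<Rightarrow> 'b set"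
  assumes X: "finite X" and B[measurable]: "B \<in> sets M" and Bf: "emeasure M B < \<infinity>" and Bp: "measure M B > 0"
    and U[measurable]: "\<And>x. x \<in> X \<Longrightarrow> U x \<in> sets M" and UB: "\<And>x. x \<in> X \<Longrightarrow> U x \<subseteq> B"
    and p: "p \<le> 1" and Up: "\<And>x. x \<in> X \<Longrightarrow> p * measure M B \<le> measure M (U x)"
  shows "\<exists>Z. finite Z \<and> card Z \<le> k \<and> real (card {x\<in>X. \<forall>z\<in>Z. z \<notin> U x}) \<le> (1 - p) ^ k * real (card X)"
proof (induction k)
  case 0
  show ?case by (rule exI[of _ "{}"]) simp
next
  case (Suc k)
  then obtain Z where Z: "finite Z" "card Z \<le> k"
    and le: "real (card {x\<in>X. \<forall>z\<in>Z. z \<notin> U x}) \<le> (1 - p) ^ k * real (card X)" by auto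
  define X' where "X' = {x\<in>X. \<forall>z\<in>Z. z \<notin> U x}"
  have X': "finite X'" "X' \<subseteq> X" using X by (auto simp: X'_def)
  define N where "N = (\<lambda>y. card {x\<in>X'. y \<in> U x})"
  have "B \<noteq> {}" using Bp by auto
  have NX: "N y \<le> card X'" for y unfolding N_def using X' by (intro card_mono) auto
  \<comment> \<open>N takes finitely many values, so its maximum over B is attained even though B is
    infinite in general.\<close>
  have "N ` B \<subseteq> {..card X'}" using NX by blast
  then have fin: "finite (N ` B)" by (rule finite_subset) simp
  obtain y where y: "y \<in> B" and ymax: "\<And>y'. y' \<in> B \<Longrightarrow> N y' \<le> N y"
  proof -
    have "Max (N ` B) \<in> N ` B" using fin \<open>B \<noteq> {}\<close> by (intro Max_in) auto
    then obtain y where "y \<in> B" "N y = Max (N ` B)" by auto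
    then show ?thesis using fin by (intro that[of y]) (simp_all add: Max_ge)
  qed
  have Uf: "emeasure M (U x) < \<infinity>" if "x \<in> X'" for x
  proof -
    have "emeasure M (U x) \<le> emeasure M B" using UB[of x] that X' by (intro emeasure_mono) auto
    then show ?thesis using Bf by (rule le_less_trans)
  qed
  \<comment> \<open>Double counting: the integral of the number of hits is the sum of the measures
    of the \<open>U x\<close>, and the integrand vanishes off B and is at most \<open>N y\<close> on
    it.\<close>
  have "real (card X') * (p * measure M B) = (\<Sum>x\<in>X'. p * measure M B)" by simp
  also have "\<dots> \<le> (\<Sum>x\<in>X'. measure M (U x))" using Up X' by (intro sum_mono) auto
  also have "\<dots> = (\<Sum>x\<in>X'. \<integral>y. indicator (U x) y \<partial>M)"
    using X' U by (intro sum.cong refl) (simp add: subset_iff sets.Int_space_eq2)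
  also have "\<dots> = (\<integral>y. (\<Sum>x\<in>X'. indicator (U x) y) \<partial>M)"
    using Uf U X' by (subst Bochner_Integration.integral_sum) (auto simp: integrable_indicator_iff)
  also have "\<dots> \<le> (\<integral>y'. real (N y) * indicator B y' \<partial>M)"
  proof (rule integral_mono)
    show "integrable M (\<lambda>y. \<Sum>x\<in>X'. indicator (U x) y :: real)"
      using Uf U X' by (auto intro!: Bochner_Integration.integrable_sum simp: integrable_indicator_iff)
    show "integrable M (\<lambda>y'. real (N y) * indicator B y')" using Bf by simp
    fix y' assume "y' \<in> space M"
    have e: "(\<Sum>x\<in>X'. indicator (U x) y' :: real) = real (N y')"
      using X' by (simp add: N_def indicator_def sum.If_cases Int_def)
    show "(\<Sum>x\<in>X'. indicator (U x) y' :: real) \<le> real (N y) * indicator B y'"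
    proof (cases "y' \<in> B")
      case True then show ?thesis using ymax e by simp
    next
      case False
      then have "{x\<in>X'. y' \<in> U x} = {}" using UB X' by auto
      then show ?thesis using e False by (simp add: N_def)
    qed
  qed
  also have "\<dots> = real (N y) * measure M B" using B by (simp add: sets.Int_space_eq2)
  finally have "(p * real (card X')) * measure M B \<le> real (N y) * measure M B"
    by (simp only: ac_simps)
  then have Ny: "p * real (card X') \<le> real (N y)" using Bp by simp
  have "{x\<in>X. \<forall>z\<in>insert y Z. z \<notin> U x} = X' - {x\<in>X'. y \<in> U x}" by (auto simp: X'_def)
  then have "real (card {x\<in>X. \<forall>z\<in>insert y Z. z \<notin> U x}) = real (card X') - real (N y)"
    using X' NX[of y] by (simp add: card_Diff_subset N_def of_nat_diff)
  also have "\<dots> \<le> (1 - p) * real (card X')" using Ny by (simp add: algebra_simps)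
  also have "\<dots> \<le> (1 - p) * ((1 - p) ^ k * real (card X))"
    using le p by (intro mult_left_mono) (auto simp: X'_def)
  finally show ?case
    using Z by (intro exI[of _ "insert y Z"]) (auto simp: card_insert_if mult.assoc)
qed

lemma emeasure_coord_ball_finite: "finite J \<Longrightarrow> emeasure (coord_space J) (coord_ball J r) < \<infinity>"
proof -
  assume J: "finite J"
  have "coord_ball J r \<subseteq> coord_ball J (max r 1)" by (auto simp: coord_ball_def)
  then have "emeasure (coord_space J) (coord_ball J r) \<le> emeasure (coord_space J) (coord_ball J (max r 1))"
    using J by (intro emeasure_mono) auto
  also have "\<dots> < \<infinity>" using J by (subst emeasure_coord_ball) auto
  finally show ?thesis .
qed

lemma abs_sum_mult_le_L2: "\<bar>\<Sum>i\<in>J. x i * u i\<bar> \<le> L2_set x J * L2_set u J"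
  by (rule order_trans[OF sum_abs order_trans[OF _ L2_set_mult_ineq]]) (simp add: abs_mult)

(* Moving u along x towards the hyperplane orthogonal to x does not increase its norm, so finitely
   many translates of the central slab cover the ball. *)
lemma ball_slab_volume:
  assumes J: "finite J" and x: "L2_set x J \<le> 1" and \<eta>: "\<eta> > 0" and R: "0 < R" "R \<le> 1"
  defines "S \<equiv> {u \<in> coord_ball J R. \<bar>\<Sum>i\<in>J. x i * u i\<bar> \<le> \<eta>}"
  shows "S \<in> sets (coord_space J)"
    and "measure (coord_space J) (coord_ball J R) \<le> (2 / \<eta> + 1) * measure (coord_space J) S"
proof -
  let ?M = "coord_space J"
  have S_eq: "S = coord_ball J R \<inter> {u \<in> space ?M. \<bar>\<Sum>i\<in>J. x i * u i\<bar> \<le> \<eta>}"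
    by (auto simp: S_def coord_ball_def)
  show S: "S \<in> sets ?M" unfolding S_eq using J by measurable
  define X where "X = (\<Sum>i\<in>J. (x i)\<^sup>2)"
  have X0: "X \<ge> 0" unfolding X_def by (simp add: sum_nonneg)
  \<comment> \<open>The inner product of x with a point of the ball has modulus at most 1, so shifts
    by multiples k \<eta> with |k| at most 1/\<eta> suffice. Their number 2 K + 1 is the origin of
    the factor 2/\<eta> + 1.\<close>
  define K where "K = \<lfloor>1 / \<eta>\<rfloor>"
  have K0: "0 \<le> K" "real_of_int K \<le> 1 / \<eta>" unfolding K_def using \<eta> by auto
  let ?B = "\<lambda>k. {u \<in> space ?M. restrict (\<lambda>i. u i - (real_of_int k * \<eta> / X) * x i) J \<in> S}"
  have B: "?B k \<in> sets ?M" for k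
    using measurable_sets[OF coord_affine_measurable[of "\<lambda>i. - ((real_of_int k * \<eta> / X) * x i)" 1 J] S]
    by (simp add: vimage_def Int_def conj_commute)
  have "coord_ball J R \<subseteq> (\<Union>k\<in>{-K..K}. ?B k)"
  proof
    fix u assume u: "u \<in> coord_ball J R"
    define t where "t = (\<Sum>i\<in>J. x i * u i)"
    have "\<bar>t\<bar> \<le> L2_set x J * L2_set u J" unfolding t_def by (rule abs_sum_mult_le_L2)
    also have "\<dots> \<le> 1 * 1" using x u R by (intro mult_mono) (auto simp: coord_ball_def)
    finally have t1: "\<bar>t\<bar> \<le> 1" by simp
    \<comment> \<open>If x vanishes on J, then so does t, and division by X = 0 gives 0: the formula
      for the shift remains valid and describes no movement.\<close>
    have Xt: "t = 0" if "X = 0"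
    proof -
      have "\<forall>i\<in>J. x i = 0" using that J unfolding X_def by (simp add: sum_nonneg_eq_0_iff)
      then show ?thesis unfolding t_def by simp
    qed
    define m where "m = \<lfloor>\<bar>t\<bar> / \<eta>\<rfloor>"
    \<comment> \<open>Rounding t towards 0 puts w between 0 and t. Hence w (w - 2 t) <= 0, and w (w
      - 2 t) / X is exactly the change of the squared norm under the shift.\<close>
    define k where "k = (if t < 0 then - m else m)"
    have m: "0 \<le> m" "real_of_int m * \<eta> \<le> \<bar>t\<bar>" "\<bar>t\<bar> < real_of_int m * \<eta> + \<eta>"
    proof -
      show "0 \<le> m" unfolding m_def using \<eta> by simp
      have "real_of_int m \<le> \<bar>t\<bar> / \<eta>" "\<bar>t\<bar> / \<eta> < real_of_int m + 1" unfolding m_def by linarith+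
      then show "real_of_int m * \<eta> \<le> \<bar>t\<bar>" "\<bar>t\<bar> < real_of_int m * \<eta> + \<eta>"
        using \<eta> by (simp_all add: field_simps)
    qed
    have mK: "m \<le> K" unfolding m_def K_def using t1 \<eta> by (intro floor_mono divide_right_mono) auto
    define w where "w = real_of_int k * \<eta>"
    have wt: "\<bar>t - w\<bar> \<le> \<eta>" and ww: "w * (w - 2 * t) \<le> 0"
    proof -
      show "\<bar>t - w\<bar> \<le> \<eta>" using m \<eta> by (auto simp: w_def k_def split: if_splits)
      show "w * (w - 2 * t) \<le> 0"
      proof (cases "t < 0")
        case True
        then have "w \<le> 0" "w - 2 * t \<ge> 0" using m \<eta> by (auto simp: w_def k_def mult_nonneg_nonneg)
        then show ?thesis by (rule mult_nonpos_nonneg)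
      next
        case False
        then have "w \<ge> 0" "w - 2 * t \<le> 0" using m \<eta> by (auto simp: w_def k_def)
        then show ?thesis by (rule mult_nonneg_nonpos)
      qed
    qed
    define u' where "u' = (\<lambda>i. u i - (w / X) * x i)"
    have dot: "(\<Sum>i\<in>J. x i * u' i) = (if X = 0 then 0 else t - w)"
    proof -
      have "(\<Sum>i\<in>J. x i * (u i - \<alpha> * x i)) = t - \<alpha> * X" for \<alpha>
        unfolding t_def X_def
        by (simp add: algebra_simps sum_subtractf sum_distrib_left power2_eq_square)
      from this[of "w / X"] show ?thesis unfolding u'_def using Xt by (cases "X = 0") auto
    qed
    have "(\<Sum>i\<in>J. (u i - \<alpha> * x i)\<^sup>2) = (\<Sum>i\<in>J. (u i)\<^sup>2) - 2 * \<alpha> * t + \<alpha>\<^sup>2 * X" for \<alpha>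
      unfolding t_def X_def
      by (simp add: power2_diff sum_subtractf sum.distrib sum_distrib_left power_mult_distrib algebra_simps)
    then have "(\<Sum>i\<in>J. (u' i)\<^sup>2) = (\<Sum>i\<in>J. (u i)\<^sup>2) - 2 * (w / X) * t + (w / X)\<^sup>2 * X"
      unfolding u'_def .
    also have "\<dots> = (\<Sum>i\<in>J. (u i)\<^sup>2) + (if X = 0 then 0 else w * (w - 2 * t) / X)"
      by (auto simp: field_simps power2_eq_square)
    also have "\<dots> \<le> (\<Sum>i\<in>J. (u i)\<^sup>2)" using ww X0 by (simp add: divide_nonpos_nonneg)
    also have "\<dots> \<le> R\<^sup>2" using u R by (simp add: coord_ball_def L2_set_le_iff)
    finally have "L2_set u' J \<le> R" using R by (simp add: L2_set_le_iff)
    moreover have "\<bar>\<Sum>i\<in>J. x i * u' i\<bar> \<le> \<eta>" using dot wt \<eta> by auto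
    ultimately have "restrict u' J \<in> S"
      by (simp add: S_def coord_ball_def space_PiM cong: L2_set_cong_simp)
    then have "u \<in> ?B k" using u by (simp add: u'_def w_def coord_ball_def)
    moreover have "k \<in> {-K..K}" using mK m(1) by (auto simp: k_def)
    ultimately show "u \<in> (\<Union>k\<in>{-K..K}. ?B k)" by blast
  qed
  then have "emeasure ?M (coord_ball J R) \<le> emeasure ?M (\<Union>k\<in>{-K..K}. ?B k)"
    using B by (intro emeasure_mono sets.finite_UN) auto
  also have "\<dots> \<le> (\<Sum>k\<in>{-K..K}. emeasure ?M (?B k))"
    using B by (intro emeasure_subadditive_finite) auto
  also have "\<dots> = (\<Sum>k\<in>{-K..K}. emeasure ?M S)"
    using J S by (simp add: emeasure_coord_translate)
  also have "\<dots> = ennreal (2 * real_of_int K + 1) * emeasure ?M S"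
    using K0 by (simp add: ennreal_of_nat_eq_real_of_nat)
  finally have le: "emeasure ?M (coord_ball J R) \<le> ennreal (2 * real_of_int K + 1) * emeasure ?M S" .
  have fin: "emeasure ?M (coord_ball J R) < \<infinity>" using J by (rule emeasure_coord_ball_finite)
  have "emeasure ?M S \<le> emeasure ?M (coord_ball J R)"
    using J by (intro emeasure_mono) (auto simp: S_def)
  with fin have finS: "emeasure ?M S < \<infinity>" by (rule le_less_trans[rotated])
  have "ennreal (measure ?M (coord_ball J R)) \<le> ennreal ((2 * real_of_int K + 1) * measure ?M S)"
    using le fin finS K0 by (simp add: emeasure_eq_ennreal_measure ennreal_mult less_top[symmetric])
  then have "measure ?M (coord_ball J R) \<le> (2 * real_of_int K + 1) * measure ?M S"
    using K0 by (subst (asm) ennreal_le_iff) auto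
  also have "\<dots> \<le> (2 / \<eta> + 1) * measure ?M S" using K0 by (intro mult_right_mono) auto
  finally show "measure ?M (coord_ball J R) \<le> (2 / \<eta> + 1) * measure ?M S" .
qed

lemma measure_coord_ball: "finite J \<Longrightarrow> r > 0 \<Longrightarrow> measure (coord_space J) (coord_ball J r) = r ^ card J * ball_volume J"
  using emeasure_coord_ball[of J r] ball_volume_pos[of J] by (simp add: measure_def)

(* For |x| <= 1 and s^2 + rho^2 = 1, the ball about s^2 x of radius rho s is cut by the hyperplane
   orthogonal to x into a half lying in the ball about 0 of radius s and a half lying in the ball
   about x of radius rho. *)
lemma ball_intersection_volume:
  assumes J: "finite J" and x: "L2_set x J \<le> 1" and \<eta>: "\<eta> > 0"
    and \<rho>: "0 < \<rho>" "0 < s" "s\<^sup>2 + \<rho>\<^sup>2 = 1"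
  defines "U \<equiv> {y \<in> coord_ball J (s * (1 + \<eta>)). L2_set (\<lambda>i. y i - x i) J \<le> \<rho> * (1 + \<eta>)}"
  shows "U \<in> sets (coord_space J)"
    and "(\<rho> / (1 + \<eta>)) ^ card J / (2 / \<eta> + 1) * measure (coord_space J) (coord_ball J (s * (1 + \<eta>)))
      \<le> measure (coord_space J) U"
proof -
  let ?M = "coord_space J"
  let ?R = "\<rho> * s"
  have "U = coord_ball J (s * (1 + \<eta>)) \<inter> {y \<in> space ?M. L2_set (\<lambda>i. y i - x i) J \<le> \<rho> * (1 + \<eta>)}"
    by (auto simp: U_def coord_ball_def)
  then show U: "U \<in> sets ?M" unfolding L2_set_def using J by simp measurable
  have "\<rho>\<^sup>2 \<le> 1" "s\<^sup>2 \<le> 1" using \<rho>(3) zero_le_power2[of \<rho>] zero_le_power2[of s] by linarith+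
  then have "\<rho> \<le> 1" "s \<le> 1" using \<rho> by (simp_all add: power2_le_iff_abs_le abs_le_iff flip: abs_le_square_iff[of _ 1, simplified])
  then have R: "0 < ?R" "?R \<le> 1" using \<rho> by (simp_all add: mult_le_one)
  define S where "S = {u \<in> coord_ball J ?R. \<bar>\<Sum>i\<in>J. x i * u i\<bar> \<le> \<eta>}"
  have S: "S \<in> sets ?M" and Sm: "measure ?M (coord_ball J ?R) \<le> (2 / \<eta> + 1) * measure ?M S"
    using ball_slab_volume[OF J x \<eta> R] unfolding S_def by auto
  let ?S' = "{y \<in> space ?M. restrict (\<lambda>i. y i - s\<^sup>2 * x i) J \<in> S}"
  have "?S' \<subseteq> U"
  proof
    fix y assume y: "y \<in> ?S'"
    define u where "u = (\<lambda>i. y i - s\<^sup>2 * x i)"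
    define X Y t where "X = (\<Sum>i\<in>J. (x i)\<^sup>2)" and "Y = (\<Sum>i\<in>J. (u i)\<^sup>2)" and "t = (\<Sum>i\<in>J. x i * u i)"
    have X: "0 \<le> X" "X \<le> 1" using x by (auto simp: X_def sum_nonneg L2_set_le_iff)
    have uS: "L2_set u J \<le> ?R" "\<bar>t\<bar> \<le> \<eta>"
      using y by (auto simp: S_def coord_ball_def u_def t_def cong: L2_set_cong_simp)
    then have Y: "Y \<le> \<rho>\<^sup>2 * s\<^sup>2" using R by (simp add: L2_set_le_iff Y_def power_mult_distrib)
    have t: "t \<le> \<eta>" "- t \<le> \<eta>" using uS by auto
    \<comment> \<open>The cross term t enters the squared distance to 0 with factor 2 s^2 and the
      squared distance to x with factor -2 \<rho>^2. The slab bounds it by \<eta> in both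
      directions, which is what the factor 1 + \<eta> in both radii pays for.\<close>
    have "(\<Sum>i\<in>J. (y i)\<^sup>2) = (\<Sum>i\<in>J. (u i + s\<^sup>2 * x i)\<^sup>2)" by (simp add: u_def)
    also have "\<dots> = s\<^sup>2 * s\<^sup>2 * X + 2 * s\<^sup>2 * t + Y"
      unfolding X_def Y_def t_def
      by (simp add: power2_eq_square algebra_simps sum.distrib sum_distrib_left)
    also have "\<dots> \<le> s\<^sup>2 * s\<^sup>2 * 1 + 2 * s\<^sup>2 * \<eta> + \<rho>\<^sup>2 * s\<^sup>2"
      using X t Y \<rho> by (intro add_mono mult_left_mono) auto
    also have "\<dots> = s\<^sup>2 * (s\<^sup>2 + \<rho>\<^sup>2) + 2 * s\<^sup>2 * \<eta>" by (simp add: algebra_simps)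
    also have "\<dots> \<le> (s * (1 + \<eta>))\<^sup>2" unfolding \<rho>(3) using \<eta> \<rho> by (simp add: power2_eq_square algebra_simps)
    finally have 1: "L2_set y J \<le> s * (1 + \<eta>)" using \<rho> \<eta> by (simp add: L2_set_le_iff)
    have s2: "s\<^sup>2 - 1 = - \<rho>\<^sup>2" using \<rho>(3) by simp
    have "(\<Sum>i\<in>J. (y i - x i)\<^sup>2) = (\<Sum>i\<in>J. (u i + (s\<^sup>2 - 1) * x i)\<^sup>2)" by (simp add: u_def algebra_simps)
    also have "\<dots> = (\<Sum>i\<in>J. (u i - \<rho>\<^sup>2 * x i)\<^sup>2)" unfolding s2 by simp
    also have "\<dots> = \<rho>\<^sup>2 * \<rho>\<^sup>2 * X + 2 * \<rho>\<^sup>2 * (- t) + Y"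
      unfolding X_def Y_def t_def
      by (simp add: power2_eq_square algebra_simps sum.distrib sum_distrib_left sum_subtractf)
    also have "\<dots> \<le> \<rho>\<^sup>2 * \<rho>\<^sup>2 * 1 + 2 * \<rho>\<^sup>2 * \<eta> + \<rho>\<^sup>2 * s\<^sup>2"
      using X t Y \<rho> by (intro add_mono mult_left_mono) auto
    also have "\<dots> = \<rho>\<^sup>2 * (s\<^sup>2 + \<rho>\<^sup>2) + 2 * \<rho>\<^sup>2 * \<eta>" by (simp add: algebra_simps)
    also have "\<dots> \<le> (\<rho> * (1 + \<eta>))\<^sup>2" unfolding \<rho>(3) using \<eta> \<rho> by (simp add: power2_eq_square algebra_simps)
    finally have 2: "L2_set (\<lambda>i. y i - x i) J \<le> \<rho> * (1 + \<eta>)" using \<rho> \<eta> by (simp add: L2_set_le_iff)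
    show "y \<in> U" using y 1 2 by (simp add: U_def coord_ball_def)
  qed
  moreover have finU: "emeasure ?M U < \<infinity>"
  proof -
    have "emeasure ?M U \<le> emeasure ?M (coord_ball J (s * (1 + \<eta>)))"
      using J by (intro emeasure_mono) (auto simp: U_def)
    also have "\<dots> < \<infinity>" using J by (rule emeasure_coord_ball_finite)
    finally show ?thesis .
  qed
  moreover have mS: "measure ?M ?S' = measure ?M S"
    using emeasure_coord_translate[OF J S, of "\<lambda>i. s\<^sup>2 * x i"] by (simp add: measure_def)
  moreover have "?S' \<in> sets ?M"
    using measurable_sets[OF coord_affine_measurable[of "\<lambda>i. - (s\<^sup>2 * x i)" 1 J] S]
    by (simp add: vimage_def Int_def conj_commute)
  ultimately have SU: "measure ?M S \<le> measure ?M U"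
    using U measure_mono_fmeasurable[of ?S' U ?M] by (simp add: fmeasurable_def)
  have pos: "2 / \<eta> + 1 > 0" using \<eta> by (simp add: add_pos_pos)
  \<comment> \<open>The radii \<rho> s and s (1 + \<eta>) have the ratio \<rho> / (1 +
    \<eta>).\<close>
  have "(\<rho> / (1 + \<eta>)) ^ card J * measure ?M (coord_ball J (s * (1 + \<eta>))) = measure ?M (coord_ball J ?R)"
    using J \<rho> \<eta> by (simp add: measure_coord_ball power_mult_distrib power_divide)
  also have "\<dots> \<le> (2 / \<eta> + 1) * measure ?M U" using Sm SU pos by (meson mult_left_mono order_trans less_imp_le)
  finally have "(\<rho> / (1 + \<eta>)) ^ card J * measure ?M (coord_ball J (s * (1 + \<eta>))) / (2 / \<eta> + 1) \<le> measure ?M U"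
    using pos by (simp add: pos_divide_le_eq mult.commute)
  then show "(\<rho> / (1 + \<eta>)) ^ card J / (2 / \<eta> + 1) * measure ?M (coord_ball J (s * (1 + \<eta>))) \<le> measure ?M U"
    by simp
qed

text \<open>The net is a grid of mesh \<eta>/(n+1). Rounding coordinates towards 0 does not leave
  the unit ball, and n rounding errors add up to at most \<eta> in the sum norm. The size of the net
  is superexponential in n, but only its logarithm enters the greedy bound.\<close>

lemma ball_grid_net:
  assumes J: "finite J" and \<eta>: "\<eta> > 0"
  shows "\<exists>X. finite X \<and> real (card X) \<le> (2 * (real (card J) + 1) / \<eta> + 1) ^ card J \<and>
    (\<forall>x\<in>X. L2_set x J \<le> 1) \<and> (\<forall>y. L2_set y J \<le> 1 \<longrightarrow> (\<exists>x\<in>X. L2_set (\<lambda>i. y i - x i) J \<le> \<eta>))"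
proof -
  define n where "n = card J"
  define h where "h = \<eta> / (real n + 1)"
  have h: "h > 0" unfolding h_def using \<eta> by simp
  define K where "K = \<lfloor>1 / h\<rfloor>"
  have K: "0 \<le> K" "real_of_int K \<le> 1 / h" unfolding K_def using h by auto
  define G where "G = (\<lambda>k. h * real_of_int k) ` {-K..K}"
  have G: "finite G" "card G \<le> nat (2 * K + 1)"
    using card_image_le[of "{-K..K}" "\<lambda>k. h * real_of_int k"] by (auto simp: G_def algebra_simps)
  define X where "X = {x \<in> PiE J (\<lambda>_. G). L2_set x J \<le> 1}"
  have fin: "finite (PiE J (\<lambda>_. G))" using J G by (intro finite_PiE) auto
  have "card X \<le> card (PiE J (\<lambda>_. G))" using fin unfolding X_def by (intro card_mono) auto
  also have "\<dots> = card G ^ n" using J by (simp add: card_PiE n_def)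
  also have "\<dots> \<le> nat (2 * K + 1) ^ n" using G by (intro power_mono) auto
  finally have "real (card X) \<le> real (nat (2 * K + 1)) ^ n" by (metis of_nat_le_iff of_nat_power)
  also have "\<dots> \<le> (2 * (real n + 1) / \<eta> + 1) ^ n"
    using K(1) mult_left_mono[OF K(2), of 2] by (intro power_mono) (auto simp: h_def)
  finally have cX: "real (card X) \<le> (2 * (real n + 1) / \<eta> + 1) ^ n" .
  have net: "\<exists>x\<in>X. L2_set (\<lambda>i. y i - x i) J \<le> \<eta>" if y: "L2_set y J \<le> 1" for y
  proof -
    define k where "k = (\<lambda>i. if y i < 0 then - \<lfloor>\<bar>y i\<bar> / h\<rfloor> else \<lfloor>\<bar>y i\<bar> / h\<rfloor>)"
    define x where "x = restrict (\<lambda>i. h * real_of_int (k i)) J"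
    have k: "0 \<le> \<lfloor>\<bar>y i\<bar> / h\<rfloor>" "h * real_of_int \<lfloor>\<bar>y i\<bar> / h\<rfloor> \<le> \<bar>y i\<bar>"
        "\<bar>y i\<bar> < h * real_of_int \<lfloor>\<bar>y i\<bar> / h\<rfloor> + h" for i
    proof -
      have "h * real_of_int \<lfloor>\<bar>y i\<bar> / h\<rfloor> \<le> h * (\<bar>y i\<bar> / h)" using h by (intro mult_left_mono) auto
      then show "h * real_of_int \<lfloor>\<bar>y i\<bar> / h\<rfloor> \<le> \<bar>y i\<bar>" using h by simp
      have "h * (\<bar>y i\<bar> / h) < h * (real_of_int \<lfloor>\<bar>y i\<bar> / h\<rfloor> + 1)"
        using h by (intro mult_strict_left_mono) linarith+
      then show "\<bar>y i\<bar> < h * real_of_int \<lfloor>\<bar>y i\<bar> / h\<rfloor> + h" using h by (simp add: distrib_left)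
    qed (use h in auto)
    have xy: "\<bar>x i\<bar> \<le> \<bar>y i\<bar>" "\<bar>y i - x i\<bar> \<le> h" if "i \<in> J" for i
    proof -
      define m where "m = h * real_of_int \<lfloor>\<bar>y i\<bar> / h\<rfloor>"
      have "0 \<le> m" "m \<le> \<bar>y i\<bar>" "\<bar>y i\<bar> < m + h" using k[of i] h by (auto simp: m_def)
      moreover have "x i = (if y i < 0 then - m else m)" using that by (simp add: x_def k_def m_def)
      ultimately show "\<bar>x i\<bar> \<le> \<bar>y i\<bar>" "\<bar>y i - x i\<bar> \<le> h" by auto
    qed
    have "L2_set x J \<le> L2_set y J"
      unfolding L2_set_def using xy(1) by (intro real_sqrt_le_mono sum_mono) (simp add: abs_le_square_iff)
    with y have x1: "L2_set x J \<le> 1" by simp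
    have "\<lfloor>\<bar>y i\<bar> / h\<rfloor> \<le> K" if "i \<in> J" for i
    proof -
      have "\<bar>y i\<bar> \<le> L2_set (\<lambda>i. \<bar>y i\<bar>) J" using member_le_L2_set[OF J that, of "\<lambda>i. \<bar>y i\<bar>"] by simp
      also have "\<dots> = L2_set y J" by (simp add: L2_set_def)
      finally have "\<bar>y i\<bar> / h \<le> 1 / h" using y h by (intro divide_right_mono) auto
      then show ?thesis unfolding K_def by (rule floor_mono)
    qed
    then have "k i \<in> {-K..K}" if "i \<in> J" for i
    proof -
      obtain m where m: "m = \<lfloor>\<bar>y i\<bar> / h\<rfloor>" by blast
      then have "0 \<le> m" "m \<le> K" "k i = (if y i < 0 then - m else m)"
        using \<open>\<And>i. i \<in> J \<Longrightarrow> \<lfloor>\<bar>y i\<bar> / h\<rfloor> \<le> K\<close>[OF that] k(1)[of i] by (simp_all only: k_def)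
      then show ?thesis by auto
    qed
    then have "x \<in> PiE J (\<lambda>_. G)" by (auto simp: x_def G_def)
    then have "x \<in> X" using x1 by (simp add: X_def)
    moreover have "L2_set (\<lambda>i. y i - x i) J \<le> (\<Sum>i\<in>J. \<bar>y i - x i\<bar>)" by (rule L2_set_le_sum_abs)
    moreover have "(\<Sum>i\<in>J. \<bar>y i - x i\<bar>) \<le> (\<Sum>i\<in>J. h)" using xy by (intro sum_mono) auto
    moreover have "(\<Sum>i\<in>J. h) \<le> \<eta>" using \<eta> by (simp add: h_def n_def field_simps)
    ultimately show ?thesis by (meson order_trans)
  qed
  show ?thesis using cX net fin unfolding n_def
    by (intro exI[of _ X]) (auto simp: X_def)
qed

text \<open>A polynomial factor in a covering number costs arbitrarily little entropy per dimension.
  The estimate is ln y <= y at y = c (n + 1).\<close>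

lemma log2_poly_le_linear:
  fixes a \<eta> :: real
  assumes "\<eta> > 0" and True: "a > 0"
  shows "\<exists>C. \<forall>n::nat. log 2 (a * (real n + 1)\<^sup>2) \<le> \<eta> * real n + C"
proof -
  \<comment> \<open>Makes the slope 2 c / ln 2 equal to \<eta>.\<close>
  define c where "c = \<eta> * ln 2 / 2"
  have c: "c > 0" using assms by (simp add: c_def)
  have "log 2 (a * (real n + 1)\<^sup>2) \<le> \<eta> * real n + (log 2 a + 2 * (c - ln c) / ln 2)" for n
  proof -
    have "ln (c * (real n + 1)) \<le> c * (real n + 1)" using c by (intro ln_bound) auto
    moreover have "ln (c * (real n + 1)) = ln c + ln (real n + 1)" using c by (subst ln_mult) auto
    ultimately have l: "ln (real n + 1) \<le> c * real n + c - ln c" by (simp add: algebra_simps)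
    have "log 2 (a * (real n + 1)\<^sup>2) = log 2 a + 2 * ln (real n + 1) / ln 2"
      using True by (subst log_mult) (simp_all add: log_nat_power, simp add: log_def)
    also have "\<dots> \<le> log 2 a + 2 * (c * real n + c - ln c) / ln 2"
      using l by (intro add_left_mono divide_right_mono mult_left_mono) auto
    also have "\<dots> = \<eta> * real n + (log 2 a + 2 * (c - ln c) / ln 2)"
      by (simp add: c_def field_simps)
    finally show ?thesis .
  qed
  then show ?thesis by blast
qed

text \<open>C is quantified before J: it is the same for all dimensions and is lost in the limit. A
  ball of radius \<rho> about any point of the unit ball occupies, up to (1 + \<eta>)^n and a
  constant, the fraction \<rho>^n of the ball of radius sqrt (1 - \<rho>^2) about 0. Greedy centres
  from the latter therefore hit a whole net after about \<rho>^(-n) choices, times the logarithm of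
  the size of the net.\<close>

lemma unit_ball_covering:
  fixes \<rho> \<eta> :: real
  assumes \<rho>: "0 < \<rho>" "\<rho> < 1" and \<eta>: "\<eta> > 0"
  shows "\<exists>C. \<forall>J :: 'i set. finite J \<longrightarrow> (\<exists>Z. finite Z \<and> Z \<noteq> {} \<and>
    (\<forall>y. L2_set y J \<le> 1 \<longrightarrow> (\<exists>z\<in>Z. L2_set (\<lambda>i. y i - z i) J \<le> \<rho> + 2 * \<eta>)) \<and>
    log 2 (real (card Z)) \<le> real (card J) * (log 2 (1 / \<rho>) + 3 * \<eta>) + C)"
proof -
  \<comment> \<open>The logarithm L of the size of the net will be at most (2/\<eta>) (n + 1)^2;
    then a (n + 1)^2 bounds L (2/\<eta> + 1) + 1.\<close>
  define a where "a = (2 / \<eta>) * (2 / \<eta> + 1) + 1"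
  have a: "a > 0" unfolding a_def using \<eta> by (intro add_nonneg_pos mult_nonneg_nonneg) auto
  obtain C where C: "\<And>n::nat. log 2 (a * (real n + 1)\<^sup>2) \<le> \<eta> * real n + C"
    using log2_poly_le_linear[OF \<eta> a] by blast
  define s where "s = sqrt (1 - \<rho>\<^sup>2)"
  have "\<rho>\<^sup>2 < 1" using \<rho> by (simp add: power_less_one_iff)
  then have s: "s > 0" "s\<^sup>2 + \<rho>\<^sup>2 = 1" by (auto simp: s_def)
  have "\<exists>Z. finite Z \<and> Z \<noteq> {} \<and>
    (\<forall>y. L2_set y J \<le> 1 \<longrightarrow> (\<exists>z\<in>Z. L2_set (\<lambda>i. y i - z i) J \<le> \<rho> + 2 * \<eta>)) \<and>
    log 2 (real (card Z)) \<le> real (card J) * (log 2 (1 / \<rho>) + 3 * \<eta>) + C" if J: "finite J" for J :: "'i set"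
  proof -
    let ?M = "coord_space J"
    define n where "n = card J"
    obtain X where X: "finite X" "real (card X) \<le> (2 * (real n + 1) / \<eta> + 1) ^ n"
      and X1: "\<And>x. x \<in> X \<Longrightarrow> L2_set x J \<le> 1"
      and Xnet: "\<And>y. L2_set y J \<le> 1 \<Longrightarrow> \<exists>x\<in>X. L2_set (\<lambda>i. y i - x i) J \<le> \<eta>"
      using ball_grid_net[OF J \<eta>] unfolding n_def by metis
    have "X \<noteq> {}" using Xnet[of "\<lambda>_. 0"] by (auto simp: L2_set_0')
    then have cX: "real (card X) \<ge> 1" using X by (simp add: Suc_le_eq card_gt_0_iff)
    define L where "L = ln (real (card X))"
    have L0: "L \<ge> 0" unfolding L_def using cX by simp
    have "L \<le> ln ((2 * (real n + 1) / \<eta> + 1) ^ n)" unfolding L_def using X cX by (subst ln_le_cancel_iff) auto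
    also have "\<dots> = real n * ln (1 + 2 * (real n + 1) / \<eta>)"
      using \<eta> by (subst ln_realpow) (auto simp: add.commute intro!: add_pos_nonneg)
    also have "\<dots> \<le> real n * (2 * (real n + 1) / \<eta>)"
      using \<eta> by (intro mult_left_mono ln_add_one_self_le_self) auto
    also have "\<dots> \<le> (2 / \<eta>) * (real n + 1)\<^sup>2" using \<eta> by (simp add: field_simps power2_eq_square)
    finally have L: "L \<le> (2 / \<eta>) * (real n + 1)\<^sup>2" .
    define B where "B = coord_ball J (s * (1 + \<eta>))"
    define U where "U = (\<lambda>x. {y \<in> B. L2_set (\<lambda>i. y i - x i) J \<le> \<rho> * (1 + \<eta>)})"
    define p where "p = (\<rho> / (1 + \<eta>)) ^ n / (2 / \<eta> + 1)"
    have p0: "p > 0" unfolding p_def using \<rho> \<eta> by (auto intro!: divide_pos_pos add_pos_pos)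
    have "(\<rho> / (1 + \<eta>)) ^ n \<le> 1" using \<rho> \<eta> by (intro power_le_one) auto
    moreover have e: "2 / \<eta> > 0" using \<eta> by simp
    moreover have "1 \<le> 1 * (2 / \<eta> + 1)" using e by simp
    ultimately have "(\<rho> / (1 + \<eta>)) ^ n \<le> 1 * (2 / \<eta> + 1)" using order_trans by blast
    moreover have "2 / \<eta> + 1 > 0" using e by (intro add_pos_pos) simp_all
    ultimately have p1: "p \<le> 1" unfolding p_def by (subst pos_divide_le_eq)
    have U: "U x \<in> sets ?M" "p * measure ?M B \<le> measure ?M (U x)" if "x \<in> X" for x
      using ball_intersection_volume[OF J X1[OF that] \<eta> \<rho>(1) s] by (auto simp: U_def B_def p_def n_def)
    have Bm: "measure ?M B > 0"
      unfolding B_def using s \<eta> ball_volume_pos[OF J] by (simp add: measure_coord_ball[OF J])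
    \<comment> \<open>Strictly larger than L / p, so that (1 - p)^k <= exp (- p k) < 1 / card X.
      Fewer than one point of the net, that is none, is then left unhit.\<close>
    define k where "k = nat \<lfloor>L / p\<rfloor> + 1"
    have "\<exists>Z. finite Z \<and> card Z \<le> k \<and> real (card {x\<in>X. \<forall>z\<in>Z. z \<notin> U x}) \<le> (1 - p) ^ k * real (card X)"
      using X(1) _ _ Bm U(1) _ p1 U(2)
    proof (rule greedy_cover)
      show "B \<in> sets ?M" using J by (simp add: B_def)
      show "emeasure ?M B < \<infinity>" using J unfolding B_def by (rule emeasure_coord_ball_finite)
    qed (auto simp: U_def)
    then obtain Z where Z: "finite Z" "card Z \<le> k"
      and Zc: "real (card {x\<in>X. \<forall>z\<in>Z. z \<notin> U x}) \<le> (1 - p) ^ k * real (card X)" by blast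
    have kL: "L / p < real k" "real k \<le> L / p + 1"
      using L0 p0 unfolding k_def by (simp_all add: of_nat_nat) linarith+
    have "(1 - p) ^ k \<le> exp (- p) ^ k" using p1 exp_ge_add_one_self[of "- p"] by (intro power_mono) auto
    also have "\<dots> = exp (- (p * real k))" by (simp add: exp_of_nat_mult[symmetric] mult.commute)
    also have "\<dots> < exp (- L)" using kL p0 by (simp add: pos_divide_less_eq mult.commute)
    also have "\<dots> = 1 / real (card X)" using cX by (simp add: L_def exp_minus inverse_eq_divide)
    finally have "(1 - p) ^ k * real (card X) < 1" using cX by (simp add: pos_less_divide_eq)
    then have "card {x\<in>X. \<forall>z\<in>Z. z \<notin> U x} = 0" using Zc by linarith
    then have "{x\<in>X. \<forall>z\<in>Z. z \<notin> U x} = {}" using X by simp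
    then have Zcov: "\<exists>z\<in>Z. z \<in> U x" if "x \<in> X" for x using that by blast
    have cov: "\<exists>z\<in>Z. L2_set (\<lambda>i. y i - z i) J \<le> \<rho> + 2 * \<eta>" if y: "L2_set y J \<le> 1" for y
    proof -
      obtain x where x: "x \<in> X" "L2_set (\<lambda>i. y i - x i) J \<le> \<eta>" using Xnet[OF y] by blast
      obtain z where z: "z \<in> Z" "L2_set (\<lambda>i. x i - z i) J \<le> \<rho> * (1 + \<eta>)"
        using Zcov[OF x(1)] by (auto simp: U_def L2_set_minus_commute[of x])
      \<comment> \<open>One \<eta> comes from the enlarged radius, by \<rho> < 1, and the other from
        the distance to the net.\<close>
      have "\<rho> * (1 + \<eta>) \<le> \<rho> + \<eta>" using \<rho> \<eta> by (simp add: algebra_simps)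
      then have "L2_set (\<lambda>i. y i - z i) J \<le> \<rho> + 2 * \<eta>"
        using L2_set_triangle_diff[of y z J x] x z by linarith
      then show ?thesis using z by blast
    qed
    have Zne: "Z \<noteq> {}" using cov[of "\<lambda>_. 0"] by (auto simp: L2_set_0')
    have q: "1 \<le> ((1 + \<eta>) / \<rho>) ^ n" using \<rho> \<eta> by (intro one_le_power) (simp add: le_divide_eq)
    have "real (card Z) \<le> L / p + 1" using Z kL by linarith
    also have "L / p = (L * (2 / \<eta> + 1)) * ((1 + \<eta>) / \<rho>) ^ n"
      unfolding p_def by (simp add: power_divide)
    also have "(L * (2 / \<eta> + 1)) * ((1 + \<eta>) / \<rho>) ^ n + 1 \<le> (L * (2 / \<eta> + 1) + 1) * ((1 + \<eta>) / \<rho>) ^ n"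
      using q by (simp add: algebra_simps)
    also have "\<dots> \<le> (a * (real n + 1)\<^sup>2) * ((1 + \<eta>) / \<rho>) ^ n"
    proof (rule mult_right_mono)
      have "L * (2 / \<eta> + 1) + 1 \<le> ((2 / \<eta>) * (real n + 1)\<^sup>2) * (2 / \<eta> + 1) + (real n + 1)\<^sup>2"
        using L \<eta> by (intro add_mono mult_right_mono) (auto intro: one_le_power)
      also have "\<dots> = a * (real n + 1)\<^sup>2"
      proof -
        have "(q * N) * (q + 1) + N = (q * (q + 1) + 1) * N" for q N :: real by (simp add: algebra_simps)
        then show ?thesis unfolding a_def .
      qed
      finally show "L * (2 / \<eta> + 1) + 1 \<le> a * (real n + 1)\<^sup>2" .
    qed (use q in simp)
    finally have "log 2 (real (card Z)) \<le> log 2 ((a * (real n + 1)\<^sup>2) * ((1 + \<eta>) / \<rho>) ^ n)"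
      using Zne Z by (intro log_mono) (auto simp: card_gt_0_iff)
    also have "\<dots> = log 2 (a * (real n + 1)\<^sup>2) + real n * (log 2 (1 + \<eta>) + log 2 (1 / \<rho>))"
    proof -
      have "log 2 (A * B ^ n) = log 2 A + real n * log 2 B" if "A > 0" "B > 0" for A B :: real
        using that by (subst log_mult) (simp_all add: log_nat_power)
      moreover have "a * (real n + 1)\<^sup>2 > 0" "(1 + \<eta>) / \<rho> > 0" using a \<rho> \<eta> by simp_all
      moreover have "log 2 ((1 + \<eta>) / \<rho>) = log 2 (1 + \<eta>) + log 2 (1 / \<rho>)"
        using \<rho> \<eta> log_mult[of 2 "1 + \<eta>" "1 / \<rho>"] by simp
      ultimately show ?thesis by metis
    qed
    also have "\<dots> \<le> (\<eta> * real n + C) + real n * (2 * \<eta> + log 2 (1 / \<rho>))"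
    proof (intro add_mono C mult_left_mono order_refl)
      have "log 2 (1 + \<eta>) \<le> \<eta> / ln 2"
        using \<eta> ln_add_one_self_le_self[of \<eta>] by (simp add: log_def divide_right_mono)
      also have "\<dots> \<le> \<eta> / (1 / 2)" using \<eta> ln2_ge_two_thirds by (intro divide_left_mono) auto
      finally show "log 2 (1 + \<eta>) \<le> 2 * \<eta>" by simp
    qed simp
    also have "\<dots> = real n * (log 2 (1 / \<rho>) + 3 * \<eta>) + C" by (simp add: algebra_simps)
    finally show ?thesis using Z Zne cov unfolding n_def by blast
  qed
  then show ?thesis by (intro exI[of _ C] allI impI)
qed

section \<open>Diagonalisation of symmetric matrices\<close>

definition fin_orthonormal :: "'i set \<Rightarrow> nat \<Rightarrow> (nat \<Rightarrow> 'i \<Rightarrow> real) \<Rightarrow> bool" where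
  "fin_orthonormal J n v \<longleftrightarrow> (\<forall>k<n. \<forall>l<n. (\<Sum>i\<in>J. v k i * v l i) = (if k = l then 1 else 0))"

text \<open>\<open>w i0\<close> is the unit vector at \<open>i0\<close> minus its projection onto
  the span of the \<open>v k\<close>. It serves both for completeness of a full system and for
  extending an incomplete one.\<close>

lemma fin_bessel_residual:
  assumes J: "finite J" and v: "fin_orthonormal J n v"
  defines "w \<equiv> \<lambda>i0 i. (if i = i0 then 1 else 0) - (\<Sum>k<n. v k i0 * v k i)"
  assumes i0: "i0 \<in> J"
  shows "\<And>l. l < n \<Longrightarrow> (\<Sum>i\<in>J. w i0 i * v l i) = 0"
    and "(\<Sum>i\<in>J. w i0 i * w i0 i) = 1 - (\<Sum>k<n. (v k i0)\<^sup>2)"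
proof -
  show o: "(\<Sum>i\<in>J. w i0 i * v l i) = 0" if "l < n" for l
  proof -
    have "(\<Sum>i\<in>J. w i0 i * v l i) = v l i0 - (\<Sum>i\<in>J. \<Sum>k<n. v k i0 * (v k i * v l i))"
      using J i0 by (simp add: w_def left_diff_distrib sum_subtractf sum_distrib_right mult.assoc if_distrib[of "\<lambda>x. x * _"] sum.delta cong: if_cong)
    also have "(\<Sum>i\<in>J. \<Sum>k<n. v k i0 * (v k i * v l i)) = (\<Sum>k<n. v k i0 * (\<Sum>i\<in>J. v k i * v l i))"
      by (subst sum.swap) (simp add: sum_distrib_left)
    also have "\<dots> = (\<Sum>k<n. v k i0 * (if k = l then 1 else 0))"
      using v that by (intro sum.cong) (auto simp: fin_orthonormal_def)
    also have "\<dots> = v l i0" using that by (simp add: sum.delta if_distrib[of "\<lambda>x. _ * x"] cong: if_cong)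
    finally show ?thesis by simp
  qed
  have "(\<Sum>i\<in>J. w i0 i * w i0 i) = w i0 i0 - (\<Sum>i\<in>J. \<Sum>k<n. v k i0 * (w i0 i * v k i))"
    using J i0 by (subst (2) w_def) (simp add: right_diff_distrib sum_subtractf sum_distrib_left ac_simps if_distrib[of "\<lambda>x. _ * x"] sum.delta cong: if_cong)
  also have "(\<Sum>i\<in>J. \<Sum>k<n. v k i0 * (w i0 i * v k i)) = (\<Sum>k<n. v k i0 * (\<Sum>i\<in>J. w i0 i * v k i))"
    by (subst sum.swap) (simp add: sum_distrib_left)
  also have "\<dots> = 0" using o by simp
  finally show "(\<Sum>i\<in>J. w i0 i * w i0 i) = 1 - (\<Sum>k<n. (v k i0)\<^sup>2)"
    by (simp add: w_def power2_eq_square)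
qed

text \<open>The squared lengths of the residuals of all unit vectors sum to card J - card J = 0, so
  every residual vanishes: a square matrix with orthonormal rows has orthonormal columns.\<close>

lemma fin_orthonormal_complete:
  assumes J: "finite J" and v: "fin_orthonormal J (card J) v" and i: "i \<in> J" and j: "j \<in> J"
  shows "(\<Sum>k<card J. v k i * v k j) = (if i = j then 1 else 0)"
proof -
  let ?n = "card J"
  define w where "w = (\<lambda>i0 i. (if i = i0 then 1 else 0) - (\<Sum>k<?n. v k i0 * v k i))"
  have ww: "(\<Sum>i\<in>J. w i0 i * w i0 i) = 1 - (\<Sum>k<?n. (v k i0)\<^sup>2)" if "i0 \<in> J" for i0
    using fin_bessel_residual(2)[OF J v that] unfolding w_def .
  have "(\<Sum>i0\<in>J. \<Sum>i\<in>J. w i0 i * w i0 i) = real ?n - (\<Sum>i0\<in>J. \<Sum>k<?n. (v k i0)\<^sup>2)"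
    using ww by (simp add: sum_subtractf)
  also have "(\<Sum>i0\<in>J. \<Sum>k<?n. (v k i0)\<^sup>2) = (\<Sum>k<?n. \<Sum>i0\<in>J. v k i0 * v k i0)"
    by (subst sum.swap) (simp add: power2_eq_square)
  also have "\<dots> = (\<Sum>k<?n. 1)" using v by (intro sum.cong) (auto simp: fin_orthonormal_def)
  finally have "(\<Sum>i0\<in>J. \<Sum>i\<in>J. w i0 i * w i0 i) = 0" by simp
  then have "\<forall>i0\<in>J. (\<Sum>i\<in>J. w i0 i * w i0 i) = 0"
    using J by (subst (asm) sum_nonneg_eq_0_iff) (auto intro: sum_nonneg)
  then have "\<forall>i0\<in>J. \<forall>i\<in>J. w i0 i * w i0 i = 0"
    using J by (subst (asm) sum_nonneg_eq_0_iff) auto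
  then have "w i j = 0" using i j by simp
  then show ?thesis by (auto simp: w_def)
qed

text \<open>Tychonoff's theorem. It makes the unit sphere over J compact inside the full function
  type, once the coordinates outside J are pinned to 0.\<close>

lemma compact_fun_box:
  fixes I :: "'i \<Rightarrow> real set"
  assumes "\<And>i. compact (I i)"
  shows "compact (PiE UNIV I)"
proof -
  have "compactin (product_topology (\<lambda>_. euclidean) UNIV) (PiE UNIV I)"
    using assms by (simp add: compactin_PiE compactin_euclidean_iff)
  then show ?thesis by (simp add: euclidean_product_topology compactin_euclidean_iff)
qed

(* A maximiser x of the form on a subspace satisfies g(x, w) = 0 for every w of the subspace
   orthogonal to x: the first variation vanishes. *)
lemma rayleigh_step:
  fixes g :: "'i \<Rightarrow> 'i \<Rightarrow> real"
  assumes J: "finite J" and sym: "\<And>i j. i \<in> J \<Longrightarrow> j \<in> J \<Longrightarrow> g i j = g j i"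
    and v: "fin_orthonormal J n v" and n: "n < card J"
  shows "\<exists>x. (\<Sum>i\<in>J. x i * x i) = 1 \<and> (\<forall>k<n. (\<Sum>i\<in>J. v k i * x i) = 0) \<and>
    (\<forall>w. (\<forall>k<n. (\<Sum>i\<in>J. v k i * w i) = 0) \<and> (\<Sum>i\<in>J. x i * w i) = 0 \<longrightarrow>
       (\<Sum>i\<in>J. \<Sum>j\<in>J. g i j * x i * w j) = 0)"
proof -
  \<comment> \<open>The unit sphere of the orthogonal complement of the \<open>v k\<close>. The box
    is implied by the sphere on J and pins the other coordinates to 0.\<close>
  define S where "S = PiE UNIV (\<lambda>i. if i \<in> J then {-1..1} else {0}) \<inter>
    ({x :: 'i \<Rightarrow> real. (\<Sum>i\<in>J. x i * x i) = 1} \<inter> (\<Inter>k\<in>{..<n}. {x. (\<Sum>i\<in>J. v k i * x i) = 0}))"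
  define q where "q = (\<lambda>x. \<Sum>i\<in>J. \<Sum>j\<in>J. g i j * x i * x j)"
  have cont: "continuous_on UNIV (\<lambda>x :: 'i \<Rightarrow> real. x i)" for i
    by (rule continuous_on_product_coordinates)
  have "compact S" unfolding S_def
    by (intro compact_Int_closed compact_fun_box closed_Int closed_INT ballI closed_Collect_eq
        continuous_intros cont) auto
  moreover have "S \<noteq> {}"
  proof -
    \<comment> \<open>Summed over J, the squared projections of the unit vectors give n < card J;
      some unit vector hence has a nonzero residual, which is then normalised.\<close>
    have "\<exists>i0\<in>J. (\<Sum>k<n. (v k i0)\<^sup>2) < 1"
    proof (rule ccontr)
      assume "\<not> ?thesis"
      then have "(\<Sum>i0\<in>J. 1) \<le> (\<Sum>i0\<in>J. \<Sum>k<n. (v k i0)\<^sup>2)" by (intro sum_mono) auto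
      also have "\<dots> = (\<Sum>k<n. \<Sum>i0\<in>J. v k i0 * v k i0)" by (subst sum.swap) (simp add: power2_eq_square)
      also have "\<dots> = (\<Sum>k<n. 1)" using v by (intro sum.cong) (auto simp: fin_orthonormal_def)
      finally show False using n by simp
    qed
    then obtain i0 where i0: "i0 \<in> J" "(\<Sum>k<n. (v k i0)\<^sup>2) < 1" by blast
    define w where "w = (\<lambda>i. (if i = i0 then 1 else 0) - (\<Sum>k<n. v k i0 * v k i))"
    define N where "N = (\<Sum>i\<in>J. w i * w i)"
    have N: "N > 0" using fin_bessel_residual(2)[OF J v i0(1)] i0 by (simp add: N_def w_def)
    have wo: "(\<Sum>i\<in>J. w i * v l i) = 0" if "l < n" for l
      using fin_bessel_residual(1)[OF J v i0(1) that] by (simp add: w_def)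
    define x where "x = (\<lambda>i. if i \<in> J then w i / sqrt N else 0)"
    have x1: "(\<Sum>i\<in>J. x i * x i) = 1"
    proof -
      have "(\<Sum>i\<in>J. x i * x i) = (\<Sum>i\<in>J. w i * w i) / N"
        using N by (simp add: x_def sum_divide_distrib)
      then show ?thesis using N by (simp add: N_def)
    qed
    moreover have "\<bar>x i\<bar> \<le> 1" if "i \<in> J" for i
    proof -
      have "x i * x i \<le> (\<Sum>i\<in>J. x i * x i)" using that J by (intro member_le_sum) auto
      then have "(x i)\<^sup>2 \<le> 1" using x1 by (simp add: power2_eq_square)
      then show ?thesis using abs_le_square_iff[of "x i" 1] by simp
    qed
    moreover have "(\<Sum>i\<in>J. v k i * x i) = 0" if "k < n" for k
      using wo[OF that] by (simp add: x_def mult.commute flip: sum_divide_distrib)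
    moreover have "x i = 0" if "i \<notin> J" for i using that by (simp add: x_def)
    ultimately have "x \<in> S" by (auto simp: S_def abs_le_iff minus_le_iff)
    then show ?thesis by blast
  qed
  moreover have "continuous_on S q"
    unfolding q_def by (intro continuous_intros continuous_on_subset[OF cont]) auto
  ultimately obtain x where x: "x \<in> S" and qmax: "\<And>y. y \<in> S \<Longrightarrow> q y \<le> q x"
    using continuous_attains_sup[of S q] by blast
  have x1: "(\<Sum>i\<in>J. x i * x i) = 1" and xv: "\<And>k. k < n \<Longrightarrow> (\<Sum>i\<in>J. v k i * x i) = 0"
    using x by (auto simp: S_def)
  \<comment> \<open>By homogeneity the maximum over the sphere yields an inequality on the whole
    complement, in which x may be varied freely.\<close>
  have hom: "q y \<le> q x * (\<Sum>i\<in>J. y i * y i)" if yv: "\<And>k. k < n \<Longrightarrow> (\<Sum>i\<in>J. v k i * y i) = 0" for y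
  proof -
    define N where "N = (\<Sum>i\<in>J. y i * y i)"
    have N0: "N \<ge> 0" unfolding N_def by (intro sum_nonneg) auto
    show ?thesis
    proof (cases "N = 0")
      case True
      then have "\<forall>i\<in>J. y i = 0" unfolding N_def using J by (subst (asm) sum_nonneg_eq_0_iff) auto
      then show ?thesis by (simp add: q_def)
    next
      case False
      then have N: "N > 0" using N0 by simp
      define z where "z = (\<lambda>i. if i \<in> J then y i / sqrt N else 0)"
      have z1: "(\<Sum>i\<in>J. z i * z i) = 1"
      proof -
        have "(\<Sum>i\<in>J. z i * z i) = (\<Sum>i\<in>J. y i * y i) / N"
          using N by (simp add: z_def sum_divide_distrib)
        then show ?thesis using N by (simp add: N_def)
      qed
      moreover have "\<bar>z i\<bar> \<le> 1" if "i \<in> J" for i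
      proof -
        have "z i * z i \<le> (\<Sum>i\<in>J. z i * z i)" using that J by (intro member_le_sum) auto
        then have "(z i)\<^sup>2 \<le> 1" using z1 by (simp add: power2_eq_square)
        then show ?thesis using abs_le_square_iff[of "z i" 1] by simp
      qed
      moreover have "(\<Sum>i\<in>J. v k i * z i) = 0" if "k < n" for k
        using yv[OF that] by (simp add: z_def flip: sum_divide_distrib)
      moreover have "z i = 0" if "i \<notin> J" for i using that by (simp add: z_def)
      ultimately have "z \<in> S" by (auto simp: S_def abs_le_iff minus_le_iff)
      then have "q z \<le> q x" by (rule qmax)
      moreover have "q z = q y / N"
        unfolding q_def sum_divide_distrib using N
        by (intro sum.cong refl) (simp add: z_def)
      ultimately show ?thesis using N by (simp add: N_def pos_divide_le_eq)
    qed
  qed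
  have "(\<Sum>i\<in>J. \<Sum>j\<in>J. g i j * x i * w j) = 0"
    if wv: "\<And>k. k < n \<Longrightarrow> (\<Sum>i\<in>J. v k i * w i) = 0" and wx: "(\<Sum>i\<in>J. x i * w i) = 0" for w
  proof -
    define b where "b = (\<Sum>i\<in>J. \<Sum>j\<in>J. g i j * x i * w j)"
    define m where "m = (\<Sum>i\<in>J. w i * w i)"
    have b': "(\<Sum>i\<in>J. \<Sum>j\<in>J. g i j * w i * x j) = b"
      unfolding b_def by (subst sum.swap) (intro sum.cong refl, simp add: sym)
    have "2 * t * b \<le> t\<^sup>2 * (q x * m - q w)" for t
    proof -
      have "q (\<lambda>i. x i + t * w i) \<le> q x * (\<Sum>i\<in>J. (x i + t * w i) * (x i + t * w i))"
        using xv wv by (intro hom) (simp add: distrib_left sum.distrib ac_simps flip: sum_distrib_left)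
      also have "(\<Sum>i\<in>J. (x i + t * w i) * (x i + t * w i)) =
          (\<Sum>i\<in>J. x i * x i) + 2 * t * (\<Sum>i\<in>J. x i * w i) + t\<^sup>2 * m"
        by (simp add: m_def algebra_simps sum.distrib sum_distrib_left power2_eq_square)
      also have "\<dots> = 1 + t\<^sup>2 * m" using x1 wx by simp
      also have "q (\<lambda>i. x i + t * w i) = q x + t * b + t * (\<Sum>i\<in>J. \<Sum>j\<in>J. g i j * w i * x j) + t\<^sup>2 * q w"
        unfolding q_def b_def by (simp add: algebra_simps sum.distrib sum_distrib_left power2_eq_square)
      finally show ?thesis unfolding b' by (simp add: algebra_simps)
    qed note var = this
    \<comment> \<open>D dominates the coefficient of t^2. At t = b / D the inequality reads 2 b^2 /
      D <= b^2 / D, so b = 0.\<close>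
    define D where "D = \<bar>q x * m - q w\<bar> + 1"
    have D: "D > 0" "q x * m - q w \<le> D" by (auto simp: D_def)
    have "2 * (b / D) * b \<le> (b / D)\<^sup>2 * (q x * m - q w)" by (rule var)
    also have "\<dots> \<le> (b / D)\<^sup>2 * D" using D by (intro mult_left_mono) auto
    finally have "2 * (b\<^sup>2 / D) \<le> b\<^sup>2 / D" using D by (simp add: power2_eq_square)
    then have "b\<^sup>2 / D \<le> 0" by simp
    then have "b\<^sup>2 \<le> 0" using D by (simp add: divide_le_0_iff)
    then show ?thesis by (simp add: b_def)
  qed
  then show ?thesis using x1 xv by (intro exI[of _ x]) blast
qed

text \<open>Each \<open>v k\<close> maximises the form on the complement of its predecessors. The
  invariant speaks only of w orthogonal to v 0, ..., v k, so it survives the choice of later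
  vectors; with w = v l for l > k it says that the matrix of the form is triangular.\<close>

lemma exists_diagonalising_orthonormal:
  fixes g :: "'i \<Rightarrow> 'i \<Rightarrow> real"
  assumes J: "finite J" and sym: "\<And>i j. i \<in> J \<Longrightarrow> j \<in> J \<Longrightarrow> g i j = g j i"
  shows "n \<le> card J \<Longrightarrow> \<exists>v. fin_orthonormal J n v \<and>
    (\<forall>k<n. \<forall>w. (\<forall>l\<le>k. (\<Sum>i\<in>J. v l i * w i) = 0) \<longrightarrow> (\<Sum>i\<in>J. \<Sum>j\<in>J. g i j * v k i * w j) = 0)"
proof (induction n)
  case 0
  show ?case by (simp add: fin_orthonormal_def)
next
  case (Suc n)
  then obtain v where v: "fin_orthonormal J n v"
    and vd: "\<And>k w. k < n \<Longrightarrow> (\<forall>l\<le>k. (\<Sum>i\<in>J. v l i * w i) = 0) \<Longrightarrow> (\<Sum>i\<in>J. \<Sum>j\<in>J. g i j * v k i * w j) = 0"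
    by auto
  have "n < card J" using Suc.prems by simp
  from rayleigh_step[where g = g, OF J sym v this] obtain x where x: "(\<Sum>i\<in>J. x i * x i) = 1"
    "\<And>k. k < n \<Longrightarrow> (\<Sum>i\<in>J. v k i * x i) = 0"
    "\<And>w. (\<forall>k<n. (\<Sum>i\<in>J. v k i * w i) = 0) \<Longrightarrow> (\<Sum>i\<in>J. x i * w i) = 0 \<Longrightarrow>
       (\<Sum>i\<in>J. \<Sum>j\<in>J. g i j * x i * w j) = 0" by blast
  define v' where "v' = v(n := x)"
  have xv: "(\<Sum>i\<in>J. x i * v k i) = 0" if "k < n" for k using x(2)[OF that] by (simp add: mult.commute)
  have "fin_orthonormal J (Suc n) v'"
    using v x xv by (auto simp: fin_orthonormal_def v'_def less_Suc_eq)
  moreover have "(\<Sum>i\<in>J. \<Sum>j\<in>J. g i j * v' k i * w j) = 0"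
    if k: "k < Suc n" and w: "\<forall>l\<le>k. (\<Sum>i\<in>J. v' l i * w i) = 0" for k w
  proof (cases "k = n")
    case True
    have "(\<Sum>i\<in>J. v k i * w i) = 0" if "k < n" for k
      using w True that by (auto simp: v'_def dest: spec[of _ k])
    moreover have "(\<Sum>i\<in>J. x i * w i) = 0" using w True by (auto simp: v'_def dest: spec[of _ n])
    ultimately show ?thesis using x(3)[of w] True by (simp add: v'_def)
  next
    case False
    then have "k < n" using k by simp
    moreover have "\<forall>l\<le>k. (\<Sum>i\<in>J. v l i * w i) = 0"
      using w \<open>k < n\<close> by (auto simp: v'_def split: if_splits)
    ultimately show ?thesis using vd[of k w] by (simp add: v'_def)
  qed
  ultimately show ?case by (intro exI[of _ v']) blast
qed

text \<open>Triangular and symmetric means diagonal in the basis v, and completeness carries this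
  back to the entries of g. The eigenvalues are also given as values of the form, so that bounds of
  the form become bounds of eigenvalues.\<close>

lemma symmetric_spectral_decomposition:
  fixes g :: "'i \<Rightarrow> 'i \<Rightarrow> real"
  assumes J: "finite J" and sym: "\<And>i j. i \<in> J \<Longrightarrow> j \<in> J \<Longrightarrow> g i j = g j i"
  obtains v \<mu> where "fin_orthonormal J (card J) v"
    "\<And>i j. i \<in> J \<Longrightarrow> j \<in> J \<Longrightarrow> g i j = (\<Sum>k<card J. \<mu> k * v k i * v k j)"
    "\<And>k. k < card J \<Longrightarrow> \<mu> k = (\<Sum>i\<in>J. \<Sum>j\<in>J. g i j * v k i * v k j)"
proof -
  let ?n = "card J"
  obtain v where v: "fin_orthonormal J ?n v"
    and vd: "\<And>k w. k < ?n \<Longrightarrow> (\<forall>l\<le>k. (\<Sum>i\<in>J. v l i * w i) = 0) \<Longrightarrow> (\<Sum>i\<in>J. \<Sum>j\<in>J. g i j * v k i * w j) = 0"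
    using exists_diagonalising_orthonormal[where g = g and n = ?n, OF J sym] by auto
  define b where "b = (\<lambda>k l. \<Sum>i\<in>J. \<Sum>j\<in>J. g i j * v k i * v l j)"
  have bsym: "b k l = b l k" for k l
    unfolding b_def by (subst sum.swap) (intro sum.cong refl, simp add: sym ac_simps)
  have b0: "b k l = 0" if "k < l" "l < ?n" for k l
    unfolding b_def using that v by (intro vd) (auto simp: fin_orthonormal_def)
  have b: "b k l = (if k = l then b k k else 0)" if "k < ?n" "l < ?n" for k l
    using b0[of k l] b0[of l k] bsym[of k l] that by (cases k l rule: linorder_cases) auto
  define h where "h = (\<lambda>k c. \<Sum>a\<in>J. g a c * v k a)"
  have bh: "b k l = (\<Sum>c\<in>J. h k c * v l c)" for k l
    unfolding b_def h_def by (subst sum.swap) (simp add: sum_distrib_right)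
  \<comment> \<open>The eigenvector equation: \<open>h k\<close> is g applied to \<open>v k\<close>,
    expanded in the basis v.\<close>
  have h: "h k j = b k k * v k j" if "k < ?n" "j \<in> J" for k j
  proof -
    have "(\<Sum>l<?n. b k l * v l j) = (\<Sum>l<?n. if k = l then b k k * v k j else 0)"
      using that by (intro sum.cong refl) (subst b, simp_all)
    then have "b k k * v k j = (\<Sum>l<?n. b k l * v l j)" using that by (simp add: sum.delta')
    also have "\<dots> = (\<Sum>l<?n. \<Sum>c\<in>J. h k c * (v l c * v l j))"
      by (simp add: bh sum_distrib_right mult.assoc)
    also have "\<dots> = (\<Sum>c\<in>J. h k c * (\<Sum>l<?n. v l c * v l j))"
      by (subst sum.swap) (simp add: sum_distrib_left)
    also have "\<dots> = (\<Sum>c\<in>J. h k c * (if c = j then 1 else 0))"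
      using fin_orthonormal_complete[OF J v] that by (intro sum.cong refl) simp
    also have "\<dots> = h k j"
      using J that by (simp add: if_distrib[of "\<lambda>x. _ * x"] sum.delta cong: if_cong)
    finally show ?thesis by simp
  qed
  have "g i j = (\<Sum>k<?n. b k k * v k i * v k j)" if ij: "i \<in> J" "j \<in> J" for i j
  proof -
    have "(\<Sum>k<?n. b k k * v k i * v k j) = (\<Sum>k<?n. v k i * h k j)"
      using ij by (intro sum.cong refl) (subst h, simp_all)
    also have "\<dots> = (\<Sum>k<?n. \<Sum>a\<in>J. g a j * (v k a * v k i))"
      by (simp add: h_def sum_distrib_left ac_simps)
    also have "\<dots> = (\<Sum>a\<in>J. g a j * (\<Sum>k<?n. v k a * v k i))"
      by (subst sum.swap) (simp add: sum_distrib_left)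
    also have "\<dots> = (\<Sum>a\<in>J. g a j * (if a = i then 1 else 0))"
      using fin_orthonormal_complete[OF J v] ij by (intro sum.cong refl) simp
    also have "\<dots> = g i j"
      using J ij by (simp add: if_distrib[of "\<lambda>x. _ * x"] sum.delta cong: if_cong)
    finally show ?thesis by simp
  qed
  then show ?thesis using v by (intro that[of v "\<lambda>k. b k k"]) (auto simp: b_def)
qed

section \<open>The real inner product on square-integrable functions\<close>

lemma L2_measurable[measurable_dest]: "f \<in> L2 \<Longrightarrow> f \<in> borel_measurable lebesgue"
  and L2_integrable: "f \<in> L2 \<Longrightarrow> integrable lebesgue (\<lambda>x. (cmod (f x))\<^sup>2)"
  by (auto simp: L2_def)

lemma L2_zero[simp]: "(\<lambda>x. 0) \<in> L2"
  by (simp add: L2_def)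

lemma L2_norm_zero[simp]: "L2_norm (\<lambda>x. 0) = 0"
  by (simp add: L2_norm_def)

lemma L2_norm_nonneg[simp]: "0 \<le> L2_norm f"
  by (simp add: L2_norm_def)

lemma L2_norm_square: "(L2_norm f)\<^sup>2 = (\<integral>x. (cmod (f x))\<^sup>2 \<partial>lebesgue)"
  by (simp add: L2_norm_def)

lemma cmod_add_square_le: "(cmod (a + b))\<^sup>2 \<le> 2 * (cmod a)\<^sup>2 + 2 * (cmod b)\<^sup>2"
proof -
  have "(cmod (a + b))\<^sup>2 \<le> (cmod a + cmod b)\<^sup>2" by (intro power_mono norm_triangle_ineq) auto
  also have "\<dots> \<le> 2 * (cmod a)\<^sup>2 + 2 * (cmod b)\<^sup>2"
    using sum_squares_bound[of "cmod a" "cmod b"] by (simp add: power2_sum)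
  finally show ?thesis .
qed

lemma L2_add: assumes "f \<in> L2" "g \<in> L2" shows "(\<lambda>x. f x + g x) \<in> L2"
proof -
  note [measurable] = L2_measurable[OF assms(1)] L2_measurable[OF assms(2)]
  have "integrable lebesgue (\<lambda>x. (cmod (f x + g x))\<^sup>2)"
    by (rule Bochner_Integration.integrable_bound[of _ "\<lambda>x. 2 * (cmod (f x))\<^sup>2 + 2 * (cmod (g x))\<^sup>2"])
      (use assms in \<open>auto intro!: L2_integrable cmod_add_square_le\<close>)
  then show ?thesis by (simp add: L2_def)
qed

lemma L2_cmult: assumes "f \<in> L2" shows "(\<lambda>x. c * f x) \<in> L2"
  using L2_measurable[OF assms] L2_integrable[OF assms]
  by (auto simp: L2_def norm_mult power_mult_distrib)

lemma L2_diff: "f \<in> L2 \<Longrightarrow> g \<in> L2 \<Longrightarrow> (\<lambda>x. f x - g x) \<in> L2"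
  using L2_add[of f "\<lambda>x. (-1) * g x"] L2_cmult[of g "-1"] by simp

lemma L2_sum: "(\<And>k. k \<in> K \<Longrightarrow> u k \<in> L2) \<Longrightarrow> (\<lambda>x. \<Sum>k\<in>K. u k x) \<in> L2"
  by (induction K rule: infinite_finite_induct) (auto intro: L2_add)

text \<open>The real part of the complex inner product: f and i f become orthogonal, and
  coefficients are real, as in the covering bounds for coordinate balls.\<close>

definition L2_inner :: "('a::euclidean_space \<Rightarrow> complex) \<Rightarrow> ('a \<Rightarrow> complex) \<Rightarrow> real" where
  "L2_inner f g = (\<integral>x. Re (f x * cnj (g x)) \<partial>lebesgue)"

lemma L2_inner_integrable:
  assumes "f \<in> L2" "g \<in> L2"
  shows "integrable lebesgue (\<lambda>x. f x * cnj (g x))"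
proof -
  note [measurable] = L2_measurable[OF assms(1)] L2_measurable[OF assms(2)]
  have [measurable]: "(\<lambda>x. cnj (g x)) \<in> borel_measurable lebesgue"
    using L2_measurable[OF assms(2)] by (intro borel_measurable_continuous_on[of cnj]) (auto intro: continuous_intros)
  have bound: "cmod (a * cnj b) \<le> (cmod a)\<^sup>2 + (cmod b)\<^sup>2" for a b
    using sum_squares_bound[of "cmod a" "cmod b"] mult_nonneg_nonneg[of "cmod a" "cmod b"]
    by (simp add: norm_mult del: mult_nonneg_nonneg)
  show ?thesis
  proof (rule Bochner_Integration.integrable_bound)
    show "integrable lebesgue (\<lambda>x. (cmod (f x))\<^sup>2 + (cmod (g x))\<^sup>2)"
      using assms by (intro Bochner_Integration.integrable_add L2_integrable)
    show "AE x in lebesgue. cmod (f x * cnj (g x)) \<le> norm ((cmod (f x))\<^sup>2 + (cmod (g x))\<^sup>2)"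
      by (intro AE_I2 order_trans[OF bound]) simp
  qed measurable
qed

lemma L2_inner_integrable_Re:
  "f \<in> L2 \<Longrightarrow> g \<in> L2 \<Longrightarrow> integrable lebesgue (\<lambda>x. Re (f x * cnj (g x)))"
  by (intro integrable_Re L2_inner_integrable)

lemma L2_inner_commute: "L2_inner f g = L2_inner g f"
  unfolding L2_inner_def by (intro Bochner_Integration.integral_cong) auto

lemma L2_inner_add_left:
  assumes "f \<in> L2" "g \<in> L2" "h \<in> L2"
  shows "L2_inner (\<lambda>x. f x + g x) h = L2_inner f h + L2_inner g h"
  unfolding L2_inner_def using L2_inner_integrable_Re assms
  by (subst Bochner_Integration.integral_add[symmetric]) (auto simp: algebra_simps)

lemma L2_inner_scale_left: "L2_inner (\<lambda>x. of_real c * f x) h = c * L2_inner f h"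
  unfolding L2_inner_def
  by (subst Bochner_Integration.integral_mult_right_zero[symmetric])
    (auto simp: algebra_simps intro!: Bochner_Integration.integral_cong)

lemma L2_inner_diff_left:
  assumes "f \<in> L2" "g \<in> L2" "h \<in> L2"
  shows "L2_inner (\<lambda>x. f x - g x) h = L2_inner f h - L2_inner g h"
  unfolding L2_inner_def using L2_inner_integrable_Re assms
  by (subst Bochner_Integration.integral_diff[symmetric]) (auto simp: algebra_simps)

lemma L2_inner_zero_left[simp]: "L2_inner (\<lambda>x. 0) h = 0"
  by (simp add: L2_inner_def)

lemma L2_inner_sum_left:
  assumes "\<And>k. k \<in> K \<Longrightarrow> u k \<in> L2" "h \<in> L2"
  shows "L2_inner (\<lambda>x. \<Sum>k\<in>K. u k x) h = (\<Sum>k\<in>K. L2_inner (u k) h)"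
  using assms by (induction K rule: infinite_finite_induct) (auto simp: L2_inner_add_left L2_sum)

lemma L2_inner_self: "L2_inner f f = (L2_norm f)\<^sup>2"
  unfolding L2_inner_def L2_norm_square
  by (intro Bochner_Integration.integral_cong) (auto simp: complex_mult_cnj cmod_power2 simp flip: of_real_power of_real_add)

lemma L2_norm_diff_square:
  assumes "f \<in> L2" "g \<in> L2"
  shows "(L2_norm (\<lambda>x. f x - g x))\<^sup>2 = (L2_norm f)\<^sup>2 - 2 * L2_inner f g + (L2_norm g)\<^sup>2"
proof -
  have d: "(\<lambda>x. f x - g x) \<in> L2" using assms by (rule L2_diff)
  have "(L2_norm (\<lambda>x. f x - g x))\<^sup>2 = L2_inner f (\<lambda>x. f x - g x) - L2_inner g (\<lambda>x. f x - g x)"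
    unfolding L2_inner_self[symmetric] using assms d by (intro L2_inner_diff_left)
  also have "\<dots> = (L2_inner f f - L2_inner g f) - (L2_inner f g - L2_inner g g)"
    using assms by (simp add: L2_inner_commute[of _ "\<lambda>x. f x - g x"] L2_inner_diff_left)
  finally show ?thesis by (simp add: L2_inner_self L2_inner_commute[of g f])
qed

lemma L2_Cauchy_Schwarz:
  assumes "f \<in> L2" "g \<in> L2"
  shows "\<bar>L2_inner f g\<bar> \<le> L2_norm f * L2_norm g"
proof -
  have main: "2 * t * L2_inner f g \<le> (L2_norm f)\<^sup>2 + t\<^sup>2 * (L2_norm g)\<^sup>2" for t
  proof -
    have g': "(\<lambda>x. of_real t * g x) \<in> L2" using assms by (intro L2_cmult)
    have "0 \<le> (L2_norm (\<lambda>x. f x - of_real t * g x))\<^sup>2" by simp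
    also have "\<dots> = (L2_norm f)\<^sup>2 - 2 * L2_inner f (\<lambda>x. of_real t * g x) + L2_inner (\<lambda>x. of_real t * g x) (\<lambda>x. of_real t * g x)"
      by (subst L2_norm_diff_square[OF assms(1) g']) (simp add: L2_inner_self)
    also have "L2_inner f (\<lambda>x. of_real t * g x) = t * L2_inner f g"
      by (simp add: L2_inner_commute[of f] L2_inner_scale_left)
    also have "L2_inner (\<lambda>x. of_real t * g x) (\<lambda>x. of_real t * g x) = t\<^sup>2 * (L2_norm g)\<^sup>2"
      by (simp add: L2_inner_scale_left L2_inner_commute[of g] L2_inner_self power2_eq_square)
    finally show ?thesis by simp
  qed
  let ?a = "L2_norm f" and ?b = "L2_norm g" and ?c = "L2_inner f g"
  show ?thesis
  proof (cases "?b = 0")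
    case True
    \<comment> \<open>The form is only semidefinite, since functions are not identified almost
      everywhere. With no t^2 term on the right, this value of t would give 2 (a^2 + 1) <= a^2 if c
      were nonzero.\<close>
    have "2 * ((?a\<^sup>2 + 1) / ?c) * ?c \<le> ?a\<^sup>2" using main[of "(?a\<^sup>2 + 1) / ?c"] True by simp
    then have "?c = 0" using zero_le_power2[of ?a] by (cases "?c = 0") (auto simp del: zero_le_power2)
    then show ?thesis by simp
  next
    case False
    then have b: "?b\<^sup>2 > 0" by simp
    have "2 * (?c / ?b\<^sup>2) * ?c \<le> ?a\<^sup>2 + (?c / ?b\<^sup>2)\<^sup>2 * ?b\<^sup>2" by (rule main)
    moreover have "2 * (c / \<beta>) * c = 2 * (c\<^sup>2 / \<beta>)" "\<beta> > 0 \<Longrightarrow> (c / \<beta>)\<^sup>2 * \<beta> = c\<^sup>2 / \<beta>" for c \<beta> :: real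
      by (simp_all add: power2_eq_square)
    from this(1)[of ?c "?b\<^sup>2"] this(2)[OF b, of ?c] calculation
    have "?c\<^sup>2 / ?b\<^sup>2 \<le> ?a\<^sup>2" by linarith
    then have "?c\<^sup>2 \<le> (?a * ?b)\<^sup>2" using b by (simp add: pos_divide_le_eq power_mult_distrib)
    then show ?thesis by (metis abs_le_square_iff abs_of_nonneg L2_norm_nonneg mult_nonneg_nonneg)
  qed
qed

lemma L2_norm_triangle_diff:
  assumes "f \<in> L2" "g \<in> L2"
  shows "L2_norm (\<lambda>x. f x - g x) \<le> L2_norm f + L2_norm g"
proof -
  have "(L2_norm (\<lambda>x. f x - g x))\<^sup>2 \<le> (L2_norm f + L2_norm g)\<^sup>2"
    using L2_norm_diff_square[OF assms] L2_Cauchy_Schwarz[OF assms] by (simp add: power2_sum abs_le_iff)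
  then show ?thesis by (rule power2_le_imp_le) simp
qed

lemma L2_norm_minus_commute: "L2_norm (\<lambda>x. f x - g x) = L2_norm (\<lambda>x. g x - f x)"
  by (simp add: L2_norm_def norm_minus_commute)

lemma L2_dist_commute: "L2_dist f g = L2_dist g f"
  unfolding L2_dist_def by (rule L2_norm_minus_commute)

lemma L2_dist_triangle:
  assumes "f \<in> L2" "g \<in> L2" "h \<in> L2"
  shows "L2_dist f h \<le> L2_dist f g + L2_dist g h"
proof -
  have "L2_dist f h = L2_norm (\<lambda>x. (f x - g x) - (h x - g x))" by (simp add: L2_dist_def)
  also have "\<dots> \<le> L2_norm (\<lambda>x. f x - g x) + L2_norm (\<lambda>x. h x - g x)"
    using assms by (intro L2_norm_triangle_diff L2_diff)
  finally show ?thesis by (simp add: L2_dist_def L2_norm_minus_commute[of h])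
qed

definition L2_orthonormal :: "nat \<Rightarrow> (nat \<Rightarrow> 'a::euclidean_space \<Rightarrow> complex) \<Rightarrow> bool" where
  "L2_orthonormal n u \<longleftrightarrow> (\<forall>k<n. u k \<in> L2) \<and> (\<forall>k<n. \<forall>l<n. L2_inner (u k) (u l) = (if k = l then 1 else 0))"

definition L2_combination :: "nat \<Rightarrow> (nat \<Rightarrow> 'a::euclidean_space \<Rightarrow> complex) \<Rightarrow> (nat \<Rightarrow> real) \<Rightarrow> 'a \<Rightarrow> complex" where
  "L2_combination n u c = (\<lambda>x. \<Sum>k<n. of_real (c k) * u k x)"

lemma L2_combination_L2: "L2_orthonormal n u \<Longrightarrow> L2_combination n u c \<in> L2"
  unfolding L2_combination_def by (intro L2_sum L2_cmult) (auto simp: L2_orthonormal_def)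

lemma L2_inner_combination:
  assumes "L2_orthonormal n u" "f \<in> L2"
  shows "L2_inner (L2_combination n u c) f = (\<Sum>k<n. c k * L2_inner f (u k))"
  unfolding L2_combination_def using assms
  by (subst L2_inner_sum_left) (auto simp: L2_orthonormal_def L2_inner_scale_left L2_cmult L2_inner_commute[of f])

lemma L2_inner_combination_basis:
  assumes u: "L2_orthonormal n u" and k: "k < n"
  shows "L2_inner (L2_combination n u c) (u k) = c k"
proof -
  have "L2_inner (L2_combination n u c) (u k) = (\<Sum>l<n. c l * (if k = l then 1 else 0))"
    using u k by (subst L2_inner_combination) (auto simp: L2_orthonormal_def intro!: sum.cong)
  also have "\<dots> = c k" using k by (simp add: if_distrib[of "\<lambda>x. _ * x"] sum.delta' cong: if_cong)
  finally show ?thesis .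
qed

lemma L2_norm_combination:
  assumes u: "L2_orthonormal n u"
  shows "L2_norm (L2_combination n u c) = L2_set c {..<n}"
proof -
  have "(L2_norm (L2_combination n u c))\<^sup>2 = (\<Sum>k<n. c k * c k)"
    unfolding L2_inner_self[symmetric]
    by (subst L2_inner_combination[OF u L2_combination_L2[OF u]]) (simp add: L2_inner_combination_basis[OF u])
  then show ?thesis by (simp add: L2_set_def power2_eq_square[of "c _"] real_sqrt_unique)
qed

lemma L2_combination_diff:
  "(\<lambda>x. L2_combination n u c x - L2_combination n u d x) = L2_combination n u (\<lambda>k. c k - d k)"
  by (simp add: L2_combination_def sum_subtractf algebra_simps)

lemma L2_bessel:
  assumes u: "L2_orthonormal n u" and f: "f \<in> L2"
  shows "L2_set (\<lambda>k. L2_inner f (u k)) {..<n} \<le> L2_norm f"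
proof -
  let ?c = "\<lambda>k. L2_inner f (u k)"
  have "0 \<le> (L2_norm (\<lambda>x. f x - L2_combination n u ?c x))\<^sup>2" by simp
  also have "\<dots> = (L2_norm f)\<^sup>2 - 2 * (\<Sum>k<n. ?c k * ?c k) + (L2_set ?c {..<n})\<^sup>2"
    by (subst L2_norm_diff_square[OF f L2_combination_L2[OF u]])
      (simp add: L2_inner_commute[of f "L2_combination _ _ _"] L2_inner_combination[OF u f] L2_norm_combination[OF u])
  finally have "(L2_set ?c {..<n})\<^sup>2 \<le> (L2_norm f)\<^sup>2"
    by (simp add: L2_set_square power2_eq_square[of "L2_inner _ _"])
  then show ?thesis by (rule power2_le_imp_le) simp
qed

section \<open>Metric entropy of operators of finite rank up to a small error\<close>

lemma covering_number_le:
  assumes "finite S" "S \<subseteq> X" "\<And>x. x \<in> K \<Longrightarrow> \<exists>s\<in>S. d x s \<le> eps"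
  shows "covering_number eps K X d \<le> card S"
  unfolding covering_number_def by (rule Least_le) (use assms in \<open>auto intro!: exI[of _ S]\<close>)

text \<open>\<open>LEAST\<close> carries information only if some finite cover exists; every use
  therefore exhibits one.\<close>

lemma covering_number_attained:
  assumes "finite S" "S \<subseteq> X" "\<And>x. x \<in> K \<Longrightarrow> \<exists>s\<in>S. d x s \<le> eps"
  shows "\<exists>S'. finite S' \<and> card S' = covering_number eps K X d \<and> S' \<subseteq> X \<and> (\<forall>x\<in>K. \<exists>s\<in>S'. d x s \<le> eps)"
proof -
  let ?P = "\<lambda>n. \<exists>S. finite S \<and> card S = n \<and> S \<subseteq> X \<and> (\<forall>x\<in>K. \<exists>s\<in>S. d x s \<le> eps)"
  have "?P (card S)" using assms by (intro exI[of _ S]) simp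
  then show ?thesis unfolding covering_number_def by (rule LeastI)
qed

lemma image_subset_L2_closure:
  assumes "K \<subseteq> L2" shows "K \<subseteq> L2_closure K"
proof -
  have "L2_dist f f = 0" for f :: "'a \<Rightarrow> complex" by (simp add: L2_dist_def)
  then have "\<exists>f\<in>K. L2_dist f g < \<delta>" if "g \<in> K" "\<delta> > 0" for g \<delta>
    using that by (intro bexI[of _ g]) auto
  then show ?thesis using assms by (auto simp: L2_closure_def)
qed

text \<open>T is close, uniformly on the unit ball, to the diagonal operator with eigenvalues \<mu>
  in the system u. A single \<kappa> measures both the error and the excess of the eigenvalues over
  1.\<close>

definition finite_rank_approx ::
  "(('a::euclidean_space \<Rightarrow> complex) \<Rightarrow> ('a \<Rightarrow> complex)) \<Rightarrow> real \<Rightarrow> nat \<Rightarrow> (nat \<Rightarrow> 'a \<Rightarrow> complex) \<Rightarrow> (nat \<Rightarrow> real) \<Rightarrow> bool" where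
  "finite_rank_approx T \<kappa> n u \<mu> \<longleftrightarrow> L2_orthonormal n u \<and> (\<forall>k<n. 0 \<le> \<mu> k \<and> \<mu> k \<le> 1 + \<kappa>) \<and>
    (\<forall>f\<in>L2_unit_ball. T f \<in> L2 \<and> L2_dist (T f) (L2_combination n u (\<lambda>k. \<mu> k * L2_inner f (u k))) \<le> \<kappa>)"

lemma L2_set_restrict_le: "finite B \<Longrightarrow> A \<subseteq> B \<Longrightarrow> L2_set f A \<le> L2_set f B"
  unfolding L2_set_def by (intro real_sqrt_le_mono sum_mono2) auto

text \<open>Coordinates with eigenvalue at most \<delta> are replaced by 0, at a cost of \<delta> by
  Bessel's inequality. The others, divided by 1 + \<kappa>, lie in the unit ball over the remaining
  indices, so the cover Z scaled by 1 + \<kappa> serves for them.\<close>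

lemma operator_cover_from_ball_cover:
  assumes T: "finite_rank_approx T \<kappa> n u \<mu>" and \<kappa>: "\<kappa> \<ge> 0" and \<delta>: "\<delta> \<ge> 0"
    and Z: "finite Z" "Z \<noteq> {}"
    and cov: "\<And>y. L2_set y {k\<in>{..<n}. \<delta> < \<mu> k} \<le> 1 \<Longrightarrow> \<exists>z\<in>Z. L2_set (\<lambda>i. y i - z i) {k\<in>{..<n}. \<delta> < \<mu> k} \<le> \<rho>"
    and eps: "(1 + \<kappa>) * \<rho> + \<delta> + \<kappa> < \<epsilon>"
  obtains S where "finite S" "S \<subseteq> L2" "card S \<le> card Z" "\<And>g. g \<in> L2_closure (T ` L2_unit_ball) \<Longrightarrow> \<exists>s\<in>S. L2_dist g s \<le> \<epsilon>"
proof -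
  let ?J = "{k\<in>{..<n}. \<delta> < \<mu> k}"
  have u: "L2_orthonormal n u" and \<mu>: "\<And>k. k < n \<Longrightarrow> 0 \<le> \<mu> k \<and> \<mu> k \<le> 1 + \<kappa>"
    and Tf: "\<And>f. f \<in> L2_unit_ball \<Longrightarrow> T f \<in> L2 \<and> L2_dist (T f) (L2_combination n u (\<lambda>k. \<mu> k * L2_inner f (u k))) \<le> \<kappa>"
    using T by (auto simp: finite_rank_approx_def)
  define s where "s = (\<lambda>z. L2_combination n u (\<lambda>k. if k \<in> ?J then (1 + \<kappa>) * z k else 0))"
  define S where "S = s ` Z"
  have S: "finite S" "S \<subseteq> L2" "card S \<le> card Z"
    using Z u by (auto simp: S_def s_def L2_combination_L2 card_image_le)
  have near: "\<exists>s\<in>S. L2_dist (T f) s \<le> (1 + \<kappa>) * \<rho> + \<delta> + \<kappa>" if f: "f \<in> L2_unit_ball" for f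
  proof -
    have fL: "f \<in> L2" "L2_norm f \<le> 1" using f by (auto simp: L2_unit_ball_def)
    define c where "c = (\<lambda>k. L2_inner f (u k))"
    have c1: "L2_set c {..<n} \<le> 1" using L2_bessel[OF u fL(1)] fL(2) by (simp add: c_def)
    have "L2_set (\<lambda>k. \<mu> k / (1 + \<kappa>) * c k) ?J \<le> L2_set c ?J"
      unfolding L2_set_def
    proof (intro real_sqrt_le_mono sum_mono)
      fix k assume "k \<in> ?J"
      then have "\<bar>\<mu> k / (1 + \<kappa>)\<bar> \<le> 1" using \<mu>[of k] \<kappa> by (simp add: abs_le_iff)
      then have "\<bar>\<mu> k / (1 + \<kappa>)\<bar> * \<bar>c k\<bar> \<le> 1 * \<bar>c k\<bar>" by (intro mult_right_mono) auto
      then have "\<bar>\<mu> k / (1 + \<kappa>) * c k\<bar> \<le> \<bar>c k\<bar>" by (simp only: abs_mult mult_1_left)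
      then show "(\<mu> k / (1 + \<kappa>) * c k)\<^sup>2 \<le> (c k)\<^sup>2" by (simp only: abs_le_square_iff)
    qed
    also have "\<dots> \<le> L2_set c {..<n}" by (intro L2_set_restrict_le) auto
    also have "\<dots> \<le> 1" by (rule c1)
    finally obtain z where z: "z \<in> Z" "L2_set (\<lambda>k. \<mu> k / (1 + \<kappa>) * c k - z k) ?J \<le> \<rho>"
      using cov[of "\<lambda>k. \<mu> k / (1 + \<kappa>) * c k"] by blast
    let ?a = "\<lambda>k. if k \<in> ?J then \<mu> k * c k - (1 + \<kappa>) * z k else 0"
    let ?b = "\<lambda>k. if k \<in> ?J then 0 else \<mu> k * c k"
    have "L2_set ?a {..<n} = L2_set ?a ?J"
      unfolding L2_set_def by (intro arg_cong[of _ _ sqrt] sum.mono_neutral_right) auto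
    also have "\<dots> = L2_set (\<lambda>k. (1 + \<kappa>) * (\<mu> k / (1 + \<kappa>) * c k - z k)) ?J"
    proof (intro L2_set_cong refl)
      have e: "(1 + \<kappa>) * (m / (1 + \<kappa>) * a) = m * a" for m a using \<kappa> by simp
      show "?a k = (1 + \<kappa>) * (\<mu> k / (1 + \<kappa>) * c k - z k)" if "k \<in> ?J" for k
        using that by (simp only: right_diff_distrib e if_True)
    qed
    also have "\<dots> = (1 + \<kappa>) * L2_set (\<lambda>k. \<mu> k / (1 + \<kappa>) * c k - z k) ?J"
      using \<kappa> by (intro L2_set_right_distrib[symmetric]) simp
    also have "\<dots> \<le> (1 + \<kappa>) * \<rho>" using z \<kappa> by (intro mult_left_mono) auto
    finally have a: "L2_set ?a {..<n} \<le> (1 + \<kappa>) * \<rho>" .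
    have "L2_set ?b {..<n} \<le> L2_set (\<lambda>k. \<delta> * c k) {..<n}"
      unfolding L2_set_def
    proof (intro real_sqrt_le_mono sum_mono)
      fix k assume "k \<in> {..<n}"
      then have "\<bar>?b k\<bar> \<le> \<bar>\<delta> * c k\<bar>" using \<mu>[of k] \<delta> by (auto simp: abs_mult intro!: mult_right_mono)
      then show "(?b k)\<^sup>2 \<le> (\<delta> * c k)\<^sup>2" by (simp only: abs_le_square_iff)
    qed
    also have "\<dots> = \<delta> * L2_set c {..<n}" using \<delta> by (intro L2_set_right_distrib[symmetric])
    also have "\<dots> \<le> \<delta> * 1" using c1 \<delta> by (intro mult_left_mono)
    finally have b: "L2_set ?b {..<n} \<le> \<delta>" by simp
    have "L2_dist (L2_combination n u (\<lambda>k. \<mu> k * c k)) (s z) = L2_set (\<lambda>k. ?a k + ?b k) {..<n}"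
      unfolding L2_dist_def s_def L2_combination_diff L2_norm_combination[OF u]
      by (intro L2_set_cong) auto
    also have "\<dots> \<le> (1 + \<kappa>) * \<rho> + \<delta>" using L2_set_triangle_ineq[of ?a ?b "{..<n}"] a b by linarith
    finally have "L2_dist (T f) (s z) \<le> (1 + \<kappa>) * \<rho> + \<delta> + \<kappa>"
      using L2_dist_triangle[of "T f" "L2_combination n u (\<lambda>k. \<mu> k * c k)" "s z"] Tf[OF f]
        L2_combination_L2[OF u] unfolding s_def c_def by force
    then show ?thesis using z by (auto simp: S_def)
  qed
  have "\<exists>s\<in>S. L2_dist g s \<le> \<epsilon>" if g: "g \<in> L2_closure (T ` L2_unit_ball)" for g
  proof -
    \<comment> \<open>The slack in the strict inequality pays for the passage from the image to its
      closure.\<close>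
    have "\<epsilon> - ((1 + \<kappa>) * \<rho> + \<delta> + \<kappa>) > 0" using eps by simp
    then obtain f where f: "f \<in> L2_unit_ball" "L2_dist (T f) g < \<epsilon> - ((1 + \<kappa>) * \<rho> + \<delta> + \<kappa>)"
      using g unfolding L2_closure_def by blast
    obtain s where s: "s \<in> S" "L2_dist (T f) s \<le> (1 + \<kappa>) * \<rho> + \<delta> + \<kappa>" using near[OF f(1)] by blast
    have "L2_dist g s \<le> L2_dist g (T f) + L2_dist (T f) s"
      using g Tf[OF f(1)] s S by (intro L2_dist_triangle) (auto simp: L2_closure_def)
    then have "L2_dist g s \<le> \<epsilon>" using f s by (simp add: L2_dist_commute[of g])
    then show ?thesis using s by blast
  qed
  then show ?thesis using that S by blast
qed

text \<open>For the lower bound, the coordinates with eigenvalue at least \<alpha> of the diagonal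
  operator's image of the unit ball contain the whole ball of radius \<alpha>. The coefficients of
  the centres of a cover of the true image cover it with radius \<epsilon> + \<kappa>, and volumes
  can be compared.\<close>

lemma operator_entropy_bounds:
  assumes T: "finite_rank_approx T \<kappa> n u \<mu>" and \<kappa>: "\<kappa> \<ge> 0" and \<delta>: "\<delta> \<ge> 0"
    and Z: "finite Z" "Z \<noteq> {}"
    and cov: "\<And>y. L2_set y {k\<in>{..<n}. \<delta> < \<mu> k} \<le> 1 \<Longrightarrow> \<exists>z\<in>Z. L2_set (\<lambda>i. y i - z i) {k\<in>{..<n}. \<delta> < \<mu> k} \<le> \<rho>"
    and eps: "(1 + \<kappa>) * \<rho> + \<delta> + \<kappa> < \<epsilon>" and \<epsilon>: "\<epsilon> > 0"
  shows "0 \<le> operator_entropy \<epsilon> T"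
    and "operator_entropy \<epsilon> T \<le> log 2 (real (card Z))"
    and "\<alpha> > 0 \<Longrightarrow> real (card {k\<in>{..<n}. \<alpha> \<le> \<mu> k}) * log 2 (\<alpha> / (\<epsilon> + \<kappa>)) \<le> operator_entropy \<epsilon> T"
proof -
  let ?K = "L2_closure (T ` L2_unit_ball)"
  let ?N = "covering_number \<epsilon> ?K L2 L2_dist"
  obtain S0 where S0: "finite S0" "S0 \<subseteq> L2" "card S0 \<le> card Z" "\<And>g. g \<in> ?K \<Longrightarrow> \<exists>s\<in>S0. L2_dist g s \<le> \<epsilon>"
    using operator_cover_from_ball_cover[OF T \<kappa> \<delta> Z cov eps] by blast
  have "\<exists>S. finite S \<and> card S = ?N \<and> S \<subseteq> L2 \<and> (\<forall>g\<in>?K. \<exists>s\<in>S. L2_dist g s \<le> \<epsilon>)"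
    by (rule covering_number_attained) (fact S0)+
  then obtain S where S: "finite S" "S \<subseteq> L2" "\<And>g. g \<in> ?K \<Longrightarrow> \<exists>s\<in>S. L2_dist g s \<le> \<epsilon>" "card S = ?N"
    by auto
  have "?N \<le> card S0" by (rule covering_number_le) (fact S0)+
  then have NZ: "?N \<le> card Z" using S0(3) by (rule order_trans)
  have u: "L2_orthonormal n u" and \<mu>: "\<And>k. k < n \<Longrightarrow> 0 \<le> \<mu> k \<and> \<mu> k \<le> 1 + \<kappa>"
    and Tf: "\<And>f. f \<in> L2_unit_ball \<Longrightarrow> T f \<in> L2 \<and> L2_dist (T f) (L2_combination n u (\<lambda>k. \<mu> k * L2_inner f (u k))) \<le> \<kappa>"
    using T by (auto simp: finite_rank_approx_def)
  have "T ` L2_unit_ball \<subseteq> L2" using Tf by auto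
  then have sub: "T ` L2_unit_ball \<subseteq> ?K" by (rule image_subset_L2_closure)
  \<comment> \<open>The image is nonempty, so the covering number is at least 1 and its logarithm
    nonnegative.\<close>
  have "(\<lambda>x. 0) \<in> (L2_unit_ball :: ('a \<Rightarrow> complex) set)" by (simp add: L2_unit_ball_def)
  then have "S \<noteq> {}" using S(3) sub by blast
  then have N1: "?N \<ge> 1" using S by (metis One_nat_def Suc_leI card_gt_0_iff)
  show "0 \<le> operator_entropy \<epsilon> T" unfolding operator_entropy_def metric_entropy_def using N1 by simp
  show "operator_entropy \<epsilon> T \<le> log 2 (real (card Z))"
    unfolding operator_entropy_def metric_entropy_def using N1 NZ by (intro log_mono) auto
  assume \<alpha>: "\<alpha> > 0"
  define J where "J = {k\<in>{..<n}. \<alpha> \<le> \<mu> k}"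
  define z where "z = (\<lambda>s k. L2_inner s (u k))"
  have "(\<alpha> / (\<epsilon> + \<kappa>)) ^ card J \<le> real (card (z ` S))"
  proof (rule covering_card_lower)
    show "finite J" "finite (z ` S)" "\<alpha> > 0" "\<epsilon> + \<kappa> > 0" using S \<alpha> \<epsilon> \<kappa> by (auto simp: J_def)
    fix y :: "nat \<Rightarrow> real" assume y: "L2_set y J \<le> \<alpha>"
    \<comment> \<open>A preimage of y under the diagonal operator; dividing by eigenvalues at least
      \<alpha> keeps it in the unit ball.\<close>
    define c where "c = (\<lambda>k. if k \<in> J then y k / \<mu> k else 0)"
    define f where "f = L2_combination n u c"
    have "L2_set c {..<n} = L2_set c J"
      unfolding L2_set_def by (intro arg_cong[of _ _ sqrt] sum.mono_neutral_right) (auto simp: J_def c_def)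
    also have "\<dots> \<le> L2_set (\<lambda>k. (1 / \<alpha>) * y k) J"
      unfolding L2_set_def
    proof (intro real_sqrt_le_mono sum_mono)
      fix k assume k: "k \<in> J"
      then have "\<alpha> \<le> \<mu> k" by (simp add: J_def)
      then have "\<bar>y k\<bar> / \<mu> k \<le> \<bar>y k\<bar> / \<alpha>" using \<alpha> by (intro divide_left_mono) auto
      then have "\<bar>c k\<bar> \<le> \<bar>(1 / \<alpha>) * y k\<bar>" using k \<alpha> \<open>\<alpha> \<le> \<mu> k\<close> by (simp add: c_def abs_mult abs_divide)
      then show "(c k)\<^sup>2 \<le> ((1 / \<alpha>) * y k)\<^sup>2" by (simp only: abs_le_square_iff)
    qed
    also have "\<dots> = (1 / \<alpha>) * L2_set y J" using \<alpha> by (intro L2_set_right_distrib[symmetric]) simp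
    also have "\<dots> \<le> 1" using y \<alpha> by simp
    finally have "L2_norm f \<le> 1" unfolding f_def L2_norm_combination[OF u] .
    then have f: "f \<in> L2_unit_ball" unfolding L2_unit_ball_def f_def using L2_combination_L2[OF u] by simp
    then obtain s where s: "s \<in> S" "L2_dist (T f) s \<le> \<epsilon>" using S(3) sub by blast
    define g where "g = L2_combination n u (\<lambda>k. \<mu> k * L2_inner f (u k))"
    have gL: "g \<in> L2" "s \<in> L2" using s S u by (auto simp: g_def L2_combination_L2)
    have "L2_dist g s \<le> L2_dist g (T f) + L2_dist (T f) s"
      using Tf[OF f] gL by (intro L2_dist_triangle) auto
    moreover have "L2_dist g (T f) \<le> \<kappa>" using Tf[OF f] unfolding g_def by (subst L2_dist_commute) simp
    ultimately have gs: "L2_dist g s \<le> \<epsilon> + \<kappa>" using s(2) by linarith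
    have gk: "L2_inner g (u k) = y k" if "k \<in> J" for k
      using that \<alpha> by (auto simp: g_def f_def L2_inner_combination_basis[OF u] J_def c_def)
    \<comment> \<open>By Bessel's inequality, passing to coefficients does not increase
      distances.\<close>
    have "L2_set (\<lambda>k. y k - z s k) J = L2_set (\<lambda>k. L2_inner (\<lambda>x. g x - s x) (u k)) J"
      using gk gL u by (intro L2_set_cong refl) (auto simp: z_def J_def L2_inner_diff_left L2_orthonormal_def)
    also have "\<dots> \<le> L2_set (\<lambda>k. L2_inner (\<lambda>x. g x - s x) (u k)) {..<n}"
      by (intro L2_set_restrict_le) (auto simp: J_def)
    also have "\<dots> \<le> L2_norm (\<lambda>x. g x - s x)" using gL by (intro L2_bessel u L2_diff)
    also have "\<dots> \<le> \<epsilon> + \<kappa>" using gs by (simp add: L2_dist_def)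
    finally show "\<exists>z\<in>z ` S. L2_set (\<lambda>k. y k - z k) J \<le> \<epsilon> + \<kappa>" using s by blast
  qed
  also have "\<dots> \<le> real ?N" using card_image_le[OF S(1), of z] S(4) by simp
  finally have "log 2 ((\<alpha> / (\<epsilon> + \<kappa>)) ^ card J) \<le> log 2 (real ?N)"
    using \<alpha> \<epsilon> \<kappa> by (intro log_mono) auto
  then show "real (card {k\<in>{..<n}. \<alpha> \<le> \<mu> k}) * log 2 (\<alpha> / (\<epsilon> + \<kappa>)) \<le> operator_entropy \<epsilon> T"
    unfolding operator_entropy_def metric_entropy_def J_def using \<alpha> \<epsilon> \<kappa> by (simp add: log_nat_power)
qed

section \<open>Gaussians and their Fourier transforms\<close>

definition cis_inner :: "'a::euclidean_space \<Rightarrow> 'a \<Rightarrow> complex" where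
  "cis_inner x y = exp (\<i> * complex_of_real (x \<bullet> y))"

lemma cis_inner_measurable[measurable]: "(\<lambda>y. cis_inner x y) \<in> borel_measurable borel"
  unfolding cis_inner_def by (intro borel_measurable_continuous_onI continuous_intros)

lemma cis_inner_measurable2[measurable]: "(\<lambda>(x, y). cis_inner x y) \<in> borel_measurable (borel \<Otimes>\<^sub>M borel)"
  unfolding cis_inner_def case_prod_beta borel_prod by (intro borel_measurable_continuous_onI continuous_intros)

lemma norm_cis_inner[simp]: "cmod (cis_inner x y) = 1"
  by (simp add: cis_inner_def)

lemma cis_inner_commute: "cis_inner x y = cis_inner y x"
  by (simp add: cis_inner_def inner_commute)

lemma cis_inner_diff: "cis_inner (x - y) z = cis_inner x z * cnj (cis_inner y z)"
  by (simp add: cis_inner_def exp_cnj exp_add[symmetric] inner_diff_left algebra_simps)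

lemma cis_inner_minus: "cis_inner (- x) z = cnj (cis_inner x z)"
  by (simp add: cis_inner_def exp_cnj)

lemma cis_inner_zero[simp]: "cis_inner 0 z = 1"
  by (simp add: cis_inner_def)

lemma norm_cis_inner_diff_le: "cmod (cis_inner x z - cis_inner y z) \<le> norm (x - y) * norm z"
proof -
  have "cis_inner x z - cis_inner y z = cis_inner y z * (iexp (x \<bullet> z - y \<bullet> z) - 1)"
    by (simp add: cis_inner_def right_diff_distrib exp_add[symmetric])
  then have "cmod (cis_inner x z - cis_inner y z) \<le> \<bar>x \<bullet> z - y \<bullet> z\<bar>"
    using iexp_approx1[of "x \<bullet> z - y \<bullet> z" 0] by (simp add: norm_mult)
  also have "\<dots> = \<bar>(x - y) \<bullet> z\<bar>" by (simp add: inner_diff_left)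
  also have "\<dots> \<le> norm (x - y) * norm z" by (rule Cauchy_Schwarz_ineq2)
  finally show ?thesis .
qed

lemma integrable_mult_cis:
  fixes f :: "'a::euclidean_space \<Rightarrow> complex"
  assumes f: "integrable M f" and [measurable]: "(\<lambda>x. x) \<in> M \<rightarrow>\<^sub>M borel"
  shows "integrable M (\<lambda>x. f x * cis_inner y x)"
proof -
  have [measurable]: "f \<in> borel_measurable M" using f by auto
  have "(\<lambda>x. cis_inner y x) \<in> borel_measurable M" by measurable
  then show ?thesis
    by (intro Bochner_Integration.integrable_bound[OF f]) (auto simp: norm_mult)
qed

text \<open>The multiplication formula of the Fourier transform. As exponentials have modulus 1,
  integrability of f and g makes Fubini applicable. The measures are general so that the formula
  serves for both \<open>lborel\<close> and \<open>lebesgue\<close>.\<close>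

lemma fourier_swap:
  fixes f g :: "'a::euclidean_space \<Rightarrow> complex"
  assumes M: "sigma_finite_measure M" and N: "sigma_finite_measure N"
    and [measurable]: "(\<lambda>x. x) \<in> M \<rightarrow>\<^sub>M borel" "(\<lambda>x. x) \<in> N \<rightarrow>\<^sub>M borel"
    and f: "integrable M f" and g: "integrable N g"
  shows "(\<integral>x. f x * (\<integral>y. g y * cis_inner x y \<partial>N) \<partial>M) = (\<integral>y. g y * (\<integral>x. f x * cis_inner y x \<partial>M) \<partial>N)"
proof -
  interpret pair_sigma_finite M N by (intro pair_sigma_finite.intro M N)
  have [measurable]: "f \<in> borel_measurable M" "g \<in> borel_measurable N" using f g by auto
  have "(\<lambda>p. (\<lambda>(x, y). cis_inner x y) (fst p, snd p)) \<in> borel_measurable (M \<Otimes>\<^sub>M N)" by measurable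
  then have [measurable]: "(\<lambda>p. cis_inner (fst p) (snd p)) \<in> borel_measurable (M \<Otimes>\<^sub>M N)" by simp
  have m: "(\<lambda>(x, y). f x * g y * cis_inner x y) \<in> borel_measurable (M \<Otimes>\<^sub>M N)"
    unfolding case_prod_beta by measurable
  have int: "integrable (M \<Otimes>\<^sub>M N) (\<lambda>(x, y). f x * g y * cis_inner x y)"
  proof (rule Fubini_integrable[OF m])
    show "integrable M (\<lambda>x. \<integral>y. norm (case (x, y) of (x, y) \<Rightarrow> f x * g y * cis_inner x y) \<partial>N)"
      using f g by (simp add: norm_mult)
    show "AE x in M. integrable N (\<lambda>y. case (x, y) of (x, y) \<Rightarrow> f x * g y * cis_inner x y)"
      using g by (intro AE_I2) (simp add: mult.assoc integrable_mult_cis)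
  qed
  have "(\<integral>x. f x * (\<integral>y. g y * cis_inner x y \<partial>N) \<partial>M) = (\<integral>x. \<integral>y. f x * g y * cis_inner x y \<partial>N \<partial>M)"
    by (simp add: mult.assoc)
  also have "\<dots> = (\<integral>y. \<integral>x. f x * g y * cis_inner x y \<partial>M \<partial>N)"
    using Fubini_integral[OF int] by simp
  also have "\<dots> = (\<integral>y. g y * (\<integral>x. f x * cis_inner y x \<partial>M) \<partial>N)"
    by (simp add: cis_inner_commute mult.assoc mult.left_commute[of "f _" "g _"])
  finally show ?thesis .
qed

text \<open>The density of the centred normal law with covariance s^2 times the identity.\<close>

definition gauss :: "real \<Rightarrow> 'a::euclidean_space \<Rightarrow> real" where
  "gauss s u = (1 / (sqrt (2 * pi) * s)) ^ DIM('a) * exp (- (norm u)\<^sup>2 / (2 * s\<^sup>2))"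

lemma gauss_measurable[measurable]: "gauss s \<in> borel_measurable borel"
  unfolding gauss_def[abs_def] by measurable

lemma gauss_nonneg: "s > 0 \<Longrightarrow> 0 \<le> gauss s u"
  by (simp add: gauss_def)

lemma gauss_continuous: "s > 0 \<Longrightarrow> continuous_on UNIV (gauss s)"
  unfolding gauss_def[abs_def] by (intro continuous_intros) auto

text \<open>The characteristic function of the standard normal law after the substitution of s x for
  x.\<close>

lemma gaussian_char_real:
  fixes s t :: real
  assumes s: "s > 0"
  shows "has_bochner_integral lborel (\<lambda>x. iexp (t * x) * of_real (exp (- s\<^sup>2 * x\<^sup>2 / 2)))
    (of_real (sqrt (2 * pi) / s * exp (- t\<^sup>2 / (2 * s\<^sup>2))))"
proof -
  let ?f = "\<lambda>x. complex_of_real (std_normal_density x) * iexp (t / s * x)"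
  have i: "integrable lborel ?f"
  proof (rule Bochner_Integration.integrable_bound)
    show "integrable lborel std_normal_density" by (rule integrable_normal_density) simp
  qed (auto simp: norm_mult)
  have "(\<integral>x. ?f x \<partial>lborel) = char std_normal_distribution (t / s)"
    unfolding char_def by (subst integral_density) (auto simp: scaleR_conv_of_real)
  also have "\<dots> = of_real (exp (- (t / s)\<^sup>2 / 2))" by (simp add: char_std_normal_distribution)
  finally have v: "(\<integral>x. ?f x \<partial>lborel) = of_real (exp (- (t / s)\<^sup>2 / 2))" .
  have i': "integrable lborel (\<lambda>x. ?f (0 + s * x))" using i s by (intro lborel_integrable_real_affine) auto
  have v': "(\<integral>x. ?f (0 + s * x) \<partial>lborel) = of_real (1 / s * exp (- (t / s)\<^sup>2 / 2))"
    using lborel_integral_real_affine[of s ?f 0] s v by (simp add: scaleR_conv_of_real field_simps)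
  have e: "iexp (t * x) * of_real (exp (- s\<^sup>2 * x\<^sup>2 / 2)) = of_real (sqrt (2 * pi)) * ?f (0 + s * x)" for x
    using s by (simp add: std_normal_density_def power_mult_distrib real_sqrt_mult)
  have "has_bochner_integral lborel (\<lambda>x. of_real (sqrt (2 * pi)) * ?f (0 + s * x))
      (of_real (sqrt (2 * pi)) * of_real (1 / s * exp (- (t / s)\<^sup>2 / 2)))"
    using i' v' by (intro has_bochner_integral_mult_right) (simp add: has_bochner_integral_iff)
  then show ?thesis unfolding e
    by (simp add: power_divide mult.commute flip: of_real_mult)
qed

text \<open>Lebesgue measure is the image of the product measure over \<open>Basis\<close>, where
  integrals of products factorise.\<close>

lemma lborel_integral_prod_Basis:
  fixes h :: "'a::euclidean_space \<Rightarrow> real \<Rightarrow> complex"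
  assumes h: "\<And>b. b \<in> Basis \<Longrightarrow> integrable lborel (h b)"
  shows "integrable lborel (\<lambda>x::'a. \<Prod>b\<in>Basis. h b (x \<bullet> b))"
    and "(\<integral>x. (\<Prod>b\<in>Basis. h b (x \<bullet> b)) \<partial>(lborel::'a measure)) = (\<Prod>b\<in>Basis. \<integral>x. h b x \<partial>lborel)"
proof -
  let ?B = "Basis :: 'a set"
  let ?T = "\<lambda>f. \<Sum>b\<in>?B. f b *\<^sub>R b"
  let ?P = "PiM ?B (\<lambda>_. lborel :: real measure)"
  let ?F = "\<lambda>x::'a. \<Prod>b\<in>?B. h b (x \<bullet> b)"
  have T[measurable]: "?T \<in> ?P \<rightarrow>\<^sub>M borel" by measurable
  have hm: "h b \<in> borel_measurable borel" if "b \<in> ?B" for b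
    using borel_measurable_integrable[OF h[OF that]] by simp
  have F[measurable]: "?F \<in> borel_measurable borel"
    using hm by (intro borel_measurable_prod measurable_compose[OF _ hm]) auto
  have FT: "?F (?T f) = (\<Prod>b\<in>?B. h b (f b))" for f
    by (intro prod.cong refl) (simp add: inner_sum_left inner_Basis if_distrib sum.delta cong: if_cong)
  have "integrable ?P (\<lambda>f. ?F (?T f))"
    unfolding FT using h by (intro lborel_product.product_integrable_prod) auto
  then show "integrable lborel ?F"
    by (subst lborel_eq) (simp add: integrable_distr_eq)
  have "(\<integral>x. ?F x \<partial>lborel) = (\<integral>f. ?F (?T f) \<partial>?P)"
    by (subst lborel_eq) (simp add: integral_distr)
  also have "\<dots> = (\<Prod>b\<in>?B. \<integral>x. h b x \<partial>lborel)"
    unfolding FT using h by (intro lborel_product.product_integral_prod) auto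
  finally show "(\<integral>x. ?F x \<partial>lborel) = (\<Prod>b\<in>?B. \<integral>x. h b x \<partial>lborel)" .
qed

lemma gaussian_fourier:
  fixes z :: "'a::euclidean_space"
  assumes s: "s > 0"
  shows "has_bochner_integral lborel (\<lambda>x::'a. of_real (exp (- s\<^sup>2 * (norm x)\<^sup>2 / 2)) * cis_inner z x)
    (of_real ((2 * pi) ^ DIM('a) * gauss s z))"
proof -
  let ?h = "\<lambda>(b::'a) x::real. iexp ((z \<bullet> b) * x) * of_real (exp (- s\<^sup>2 * x\<^sup>2 / 2)) :: complex"
  have hi: "integrable lborel (?h b)" for b
    using gaussian_char_real[OF s, of "z \<bullet> b"] by (simp only: has_bochner_integral_iff)
  have e: "(\<Prod>b\<in>Basis. ?h b (x \<bullet> b)) = of_real (exp (- s\<^sup>2 * (norm x)\<^sup>2 / 2)) * cis_inner z x" for x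
  proof -
    have "(norm x)\<^sup>2 = (\<Sum>b\<in>Basis. (x \<bullet> b)\<^sup>2)"
      unfolding power2_norm_eq_inner by (subst euclidean_inner) (simp add: power2_eq_square)
    then have "of_real (exp (- s\<^sup>2 * (norm x)\<^sup>2 / 2)) = (\<Prod>b\<in>Basis. complex_of_real (exp (- s\<^sup>2 * (x \<bullet> b)\<^sup>2 / 2)))"
      by (simp add: sum_distrib_left sum_divide_distrib sum_negf[symmetric] exp_sum of_real_prod[symmetric] del: of_real_prod)
    moreover have "cis_inner z x = (\<Prod>b\<in>Basis. iexp ((z \<bullet> b) * (x \<bullet> b)))"
      unfolding cis_inner_def by (subst euclidean_inner) (simp add: sum_distrib_left exp_sum)
    ultimately show ?thesis by (simp add: prod.distrib mult.commute)
  qed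
  have v: "(\<integral>x. ?h b x \<partial>lborel) = of_real (sqrt (2 * pi) / s * exp (- (z \<bullet> b)\<^sup>2 / (2 * s\<^sup>2)))" for b
    using gaussian_char_real[OF s] by (rule has_bochner_integral_integral_eq)
  have "(\<Prod>b\<in>Basis. \<integral>x. ?h b x \<partial>lborel) = of_real (\<Prod>b\<in>(Basis :: 'a set). (2 * pi) * (1 / (sqrt (2 * pi) * s)) * exp (- (z \<bullet> b)\<^sup>2 / (2 * s\<^sup>2)))"
  proof -
    \<comment> \<open>Splits each factor into 2 pi times the normalising constant of a
      one-dimensional Gaussian density, so that the product over \<open>Basis\<close> assembles
      \<open>gauss s z\<close>.\<close>
    have "w / s = w\<^sup>2 * (1 / (w * s))" if "w > 0" for w using that by (simp add: power2_eq_square)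
    from this[of "sqrt (2 * pi)"] have "sqrt (2 * pi) / s = (2 * pi) * (1 / (sqrt (2 * pi) * s))" by simp
    then show ?thesis unfolding v of_real_prod by (intro prod.cong refl) simp
  qed
  also have "(\<Prod>b\<in>(Basis :: 'a set). (2 * pi) * (1 / (sqrt (2 * pi) * s)) * exp (- (z \<bullet> b)\<^sup>2 / (2 * s\<^sup>2)))
      = (2 * pi) ^ DIM('a) * gauss s z"
  proof -
    have "(norm z)\<^sup>2 = (\<Sum>b\<in>Basis. (z \<bullet> b)\<^sup>2)"
      unfolding power2_norm_eq_inner by (subst euclidean_inner) (simp add: power2_eq_square)
    then have "exp (- (norm z)\<^sup>2 / (2 * s\<^sup>2)) = (\<Prod>b\<in>Basis. exp (- (z \<bullet> b)\<^sup>2 / (2 * s\<^sup>2)))"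
      by (simp add: sum_divide_distrib sum_negf[symmetric] exp_sum)
    then show ?thesis by (simp only: prod.distrib prod_constant gauss_def mult.assoc power_mult_distrib)
  qed
  finally show ?thesis
    using lborel_integral_prod_Basis[of ?h, OF hi] unfolding e by (simp add: has_bochner_integral_iff)
qed

text \<open>The total mass is the Fourier integral at frequency 0, taken with 1/s in place of
  s.\<close>

lemma gauss_integral:
  assumes s: "s > 0"
  shows "has_bochner_integral lborel (gauss s :: 'a::euclidean_space \<Rightarrow> real) 1"
proof -
  let ?n = "DIM('a)"
  have "has_bochner_integral lborel (\<lambda>x::'a. of_real (exp (- (1 / s)\<^sup>2 * (norm x)\<^sup>2 / 2)) * cis_inner 0 x)
    (complex_of_real ((2 * pi) ^ ?n * gauss (1 / s) (0::'a)))"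
    using s by (intro gaussian_fourier) simp
  from has_bochner_integral_bounded_linear[OF bounded_linear_Re this]
  have "has_bochner_integral lborel (\<lambda>x::'a. Re (of_real (exp (- (1 / s)\<^sup>2 * (norm x)\<^sup>2 / 2)) * cis_inner 0 x))
    (Re (complex_of_real ((2 * pi) ^ ?n * gauss (1 / s) (0::'a))))" .
  then have "has_bochner_integral lborel (\<lambda>x::'a. exp (- (norm x)\<^sup>2 / (2 * s\<^sup>2))) ((2 * pi) ^ ?n * gauss (1 / s) (0::'a))"
    by (simp add: power_divide mult.commute)
  then have "has_bochner_integral lborel (\<lambda>x::'a. (1 / (sqrt (2 * pi) * s)) ^ ?n * exp (- (norm x)\<^sup>2 / (2 * s\<^sup>2)))
      ((1 / (sqrt (2 * pi) * s)) ^ ?n * ((2 * pi) ^ ?n * gauss (1 / s) (0::'a)))"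
    by (rule has_bochner_integral_mult_right)
  moreover have "(1 / (sqrt (2 * pi) * s)) ^ ?n * ((2 * pi) ^ ?n * gauss (1 / s) (0::'a)) = 1"
  proof -
    have "(1 / (sqrt (2 * pi) * s)) * ((2 * pi) * (s / sqrt (2 * pi))) = 1"
      using s by (simp add: field_simps)
    then have "((1 / (sqrt (2 * pi) * s)) * ((2 * pi) * (s / sqrt (2 * pi)))) ^ ?n = 1" by simp
    then show ?thesis by (simp only: power_mult_distrib) (simp add: gauss_def power_divide power_mult_distrib)
  qed
  ultimately show ?thesis unfolding gauss_def[abs_def] by simp
qed

section \<open>The kernel of the band-limiting operator\<close>

definition band_kernel :: "'a::euclidean_space set \<Rightarrow> 'a \<Rightarrow> complex" where
  "band_kernel W z = of_real (1 / (2 * pi) ^ DIM('a)) * (\<integral>\<xi>. indicator W \<xi> * cis_inner z \<xi> \<partial>lborel)"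

lemma compact_integrable_indicator:
  fixes W :: "'a::euclidean_space set"
  assumes "compact W"
  shows "integrable lborel (indicator W :: 'a \<Rightarrow> real)" "integrable lborel (indicator W :: 'a \<Rightarrow> complex)"
proof -
  show r: "integrable lborel (indicator W :: 'a \<Rightarrow> real)"
    using emeasure_compact_finite[OF assms] borel_compact[OF assms] by (simp add: integrable_indicator_iff)
  have "indicator W = (\<lambda>x. complex_of_real (indicator W x))" by (auto simp: indicator_def)
  then show "integrable lborel (indicator W :: 'a \<Rightarrow> complex)" using integrable_of_real[OF r, where 'a = complex] by simp
qed

lemma band_kernel_bound:
  fixes W :: "'a::euclidean_space set"
  assumes W: "compact W"
  shows "cmod (band_kernel W z) \<le> measure lborel W / (2 * pi) ^ DIM('a)"
proof -
  have "cmod (\<integral>\<xi>. indicator W \<xi> * cis_inner z \<xi> \<partial>lborel) \<le> (\<integral>\<xi>. cmod (indicator W \<xi> * cis_inner z \<xi>) \<partial>lborel)"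
    by (rule integral_norm_bound)
  also have "\<dots> = (\<integral>\<xi>. indicator W \<xi> \<partial>lborel)"
    by (intro Bochner_Integration.integral_cong refl) (simp add: norm_mult indicator_def)
  also have "\<dots> = measure lborel W" using borel_compact[OF W] by simp
  finally show ?thesis by (simp add: band_kernel_def norm_mult divide_right_mono norm_divide norm_power)
qed

lemma band_kernel_zero: "compact W \<Longrightarrow> band_kernel W (0::'a::euclidean_space) = of_real (measure lborel W / (2 * pi) ^ DIM('a))"
proof -
  assume "compact W"
  then have [simp]: "W \<in> sets borel" by (rule borel_compact)
  have "indicator W = (\<lambda>x. complex_of_real (indicator W x))" by (auto simp: indicator_def)
  then have "(\<integral>\<xi>. indicator W \<xi> \<partial>lborel) = complex_of_real (\<integral>\<xi>. indicator W \<xi> \<partial>lborel)"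
    using integral_complex_of_real[of lborel "indicator W"] by simp
  then show ?thesis by (simp add: band_kernel_def)
qed

lemma band_kernel_minus: "band_kernel W (- z) = cnj (band_kernel W z)"
proof -
  have "(\<integral>\<xi>. indicator W \<xi> * cis_inner (- z) \<xi> \<partial>lborel) = (\<integral>\<xi>. cnj (indicator W \<xi> * cis_inner z \<xi>) \<partial>lborel)"
    by (intro Bochner_Integration.integral_cong refl) (simp add: cis_inner_minus indicator_def)
  also have "\<dots> = cnj (\<integral>\<xi>. indicator W \<xi> * cis_inner z \<xi> \<partial>lborel)" by (rule Bochner_Integration.integral_cnj)
  finally show ?thesis by (simp add: band_kernel_def)
qed

text \<open>W is bounded, say by R, so each exponential in the integral is R-Lipschitz in z. This is
  the source of both the continuity of the kernel and the accuracy of its samples.\<close>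

lemma band_kernel_lipschitz:
  fixes W :: "'a::euclidean_space set"
  assumes W: "compact W"
  obtains L where "L \<ge> 0" "\<And>y z. cmod (band_kernel W y - band_kernel W z) \<le> L * norm (y - z)"
proof -
  obtain R where R: "R > 0" "\<And>x. x \<in> W \<Longrightarrow> norm x \<le> R"
    using compact_imp_bounded[OF W] by (auto simp: bounded_pos)
  let ?c = "1 / (2 * pi) ^ DIM('a)"
  have "cmod (band_kernel W y - band_kernel W z) \<le> (?c * (R * measure lborel W)) * norm (y - z)" for y z
  proof -
    have i: "integrable lborel (\<lambda>\<xi>. indicator W \<xi> * cis_inner y \<xi>)" for y
      using compact_integrable_indicator[OF W] by (intro integrable_mult_cis) auto
    have "cmod ((\<integral>\<xi>. indicator W \<xi> * cis_inner y \<xi> \<partial>lborel) - (\<integral>\<xi>. indicator W \<xi> * cis_inner z \<xi> \<partial>lborel))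
      = cmod (\<integral>\<xi>. indicator W \<xi> * cis_inner y \<xi> - indicator W \<xi> * cis_inner z \<xi> \<partial>lborel)"
      using i by (subst Bochner_Integration.integral_diff) auto
    also have "\<dots> \<le> (\<integral>\<xi>. indicator W \<xi> * (norm (y - z) * R) \<partial>lborel)"
    proof (rule Bochner_Integration.integral_norm_bound_integral)
      show "integrable lborel (\<lambda>\<xi>. indicator W \<xi> * cis_inner y \<xi> - indicator W \<xi> * cis_inner z \<xi>)"
        using i by (intro Bochner_Integration.integrable_diff)
      show "integrable lborel (\<lambda>\<xi>. indicator W \<xi> * (norm (y - z) * R))"
        using compact_integrable_indicator[OF W] by (intro integrable_mult_left) auto
      fix \<xi> :: 'a
      have "cmod (cis_inner y \<xi> - cis_inner z \<xi>) \<le> norm (y - z) * R" if "\<xi> \<in> W"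
        using norm_cis_inner_diff_le[of y \<xi> z] mult_left_mono[OF R(2)[OF that] norm_ge_zero[of "y - z"]] by linarith
      then show "norm (indicator W \<xi> * cis_inner y \<xi> - indicator W \<xi> * cis_inner z \<xi>) \<le> indicator W \<xi> * (norm (y - z) * R)"
        by (auto simp: indicator_def)
    qed
    also have "\<dots> = measure lborel W * (norm (y - z) * R)" using borel_compact[OF W] by simp
    finally have b: "cmod ((\<integral>\<xi>. indicator W \<xi> * cis_inner y \<xi> \<partial>lborel) - (\<integral>\<xi>. indicator W \<xi> * cis_inner z \<xi> \<partial>lborel))
      \<le> measure lborel W * (norm (y - z) * R)" .
    have "cmod (band_kernel W y - band_kernel W z) = ?c * cmod ((\<integral>\<xi>. indicator W \<xi> * cis_inner y \<xi> \<partial>lborel) - (\<integral>\<xi>. indicator W \<xi> * cis_inner z \<xi> \<partial>lborel))"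
      unfolding band_kernel_def right_diff_distrib[symmetric] norm_mult norm_of_real by simp
    also have "\<dots> \<le> ?c * (measure lborel W * (norm (y - z) * R))" using b by (intro mult_left_mono) auto
    finally show ?thesis by (simp add: ac_simps)
  qed
  then show ?thesis using R by (intro that[of "?c * (R * measure lborel W)"]) auto
qed

lemma band_kernel_continuous: "compact W \<Longrightarrow> continuous_on S (band_kernel W)"
proof -
  assume "compact W"
  then obtain L where L: "L \<ge> 0" "\<And>y z. cmod (band_kernel W y - band_kernel W z) \<le> L * norm (y - z)"
    using band_kernel_lipschitz by metis
  then have "L-lipschitz_on S (band_kernel W)" by (intro lipschitz_onI) (auto simp: dist_norm)
  then show ?thesis by (rule lipschitz_on_continuous_on)
qed

lemma band_kernel_measurable: "compact W \<Longrightarrow> band_kernel W \<in> borel_measurable borel"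
  by (intro borel_measurable_continuous_onI band_kernel_continuous)

text \<open>Plancherel's identity with a Gaussian weight. Each factor K is written as an integral
  over W, and two applications of the multiplication formula leave the explicit transform of the
  weight. As s tends to 0, \<open>gauss s\<close> concentrates at 0 and the right side approaches
  |W| / (2 pi)^d.\<close>

lemma band_kernel_gaussian_energy:
  fixes W :: "'a::euclidean_space set"
  assumes W: "compact W" and s: "s > 0"
  shows "(\<integral>z. exp (- s\<^sup>2 * (norm z)\<^sup>2 / 2) * (cmod (band_kernel W z))\<^sup>2 \<partial>lborel) =
    1 / (2 * pi) ^ DIM('a) * (\<integral>\<xi>. indicator W \<xi> * (\<integral>\<eta>. indicator W \<eta> * gauss s (\<eta> - \<xi>) \<partial>lborel) \<partial>lborel)"
proof -
  let ?K = "band_kernel W" and ?c = "1 / (2 * pi) ^ DIM('a)"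
  let ?h = "\<lambda>z::'a. complex_of_real (exp (- s\<^sup>2 * (norm z)\<^sup>2 / 2))"
  let ?w = "indicator W :: 'a \<Rightarrow> complex"
  have [measurable]: "?K \<in> borel_measurable borel" using W by (rule band_kernel_measurable)
  have cnjK[measurable]: "(\<lambda>z. cnj (?K z)) \<in> borel_measurable borel"
    using W by (intro borel_measurable_continuous_onI continuous_intros band_kernel_continuous)
  have hint: "integrable lborel ?h" using gaussian_fourier[OF s, of "0::'a"] by (simp add: has_bochner_integral_iff)
  have wint: "integrable lborel ?w" using compact_integrable_indicator[OF W] by simp
  have hK: "integrable lborel (\<lambda>z. ?h z * cnj (?K z))"
  proof (rule Bochner_Integration.integrable_bound)
    show "integrable lborel (\<lambda>z. of_real (measure lborel W / (2 * pi) ^ DIM('a)) * ?h z)" using hint by (intro integrable_mult_right)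
    show "AE z in lborel. cmod (?h z * cnj (?K z)) \<le> cmod (of_real (measure lborel W / (2 * pi) ^ DIM('a)) * ?h z)"
    proof (intro AE_I2)
      fix z :: 'a
      have "exp (- s\<^sup>2 * (norm z)\<^sup>2 / 2) * cmod (?K z) \<le> exp (- s\<^sup>2 * (norm z)\<^sup>2 / 2) * (measure lborel W / (2 * pi) ^ DIM('a))"
        by (intro mult_left_mono band_kernel_bound W) simp
      then show "cmod (?h z * cnj (?K z)) \<le> cmod (of_real (measure lborel W / (2 * pi) ^ DIM('a)) * ?h z)"
        by (simp only: norm_mult norm_of_real complex_mod_cnj abs_exp_cancel) (simp add: abs_divide mult.commute)
    qed
  qed measurable
  have sf: "sigma_finite_measure (lborel :: 'a measure)" by standard
  \<comment> \<open>The conjugate is computed instead, because it contains K itself and not its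
    conjugate, as the multiplication formula requires.\<close>
  have inner: "(\<integral>z. (?h z * cnj (?K z)) * cis_inner \<xi> z \<partial>lborel) = of_real (\<integral>\<eta>. indicator W \<eta> * gauss s (\<eta> - \<xi>) \<partial>lborel)" for \<xi>
  proof -
    have "cnj (\<integral>z. (?h z * cnj (?K z)) * cis_inner \<xi> z \<partial>lborel) = (\<integral>z. cnj ((?h z * cnj (?K z)) * cis_inner \<xi> z) \<partial>lborel)"
      by (rule Bochner_Integration.integral_cnj[symmetric])
    also have "\<dots> = (\<integral>z. of_real ?c * ((?h z * cis_inner (- \<xi>) z) * (\<integral>\<eta>. ?w \<eta> * cis_inner z \<eta> \<partial>lborel)) \<partial>lborel)"
      by (intro Bochner_Integration.integral_cong refl) (simp add: band_kernel_def cis_inner_minus ac_simps)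
    also have "\<dots> = of_real ?c * (\<integral>z. (?h z * cis_inner (- \<xi>) z) * (\<integral>\<eta>. ?w \<eta> * cis_inner z \<eta> \<partial>lborel) \<partial>lborel)"
      by (rule Bochner_Integration.integral_mult_right_zero)
    also have "(\<integral>z. (?h z * cis_inner (- \<xi>) z) * (\<integral>\<eta>. ?w \<eta> * cis_inner z \<eta> \<partial>lborel) \<partial>lborel) =
        (\<integral>\<eta>. ?w \<eta> * (\<integral>z. (?h z * cis_inner (- \<xi>) z) * cis_inner \<eta> z \<partial>lborel) \<partial>lborel)"
      using hint wint by (intro fourier_swap sf integrable_mult_cis) auto
    also have "\<dots> = (\<integral>\<eta>. of_real ((2 * pi) ^ DIM('a) * (indicator W \<eta> * gauss s (\<eta> - \<xi>))) \<partial>lborel)"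
    proof (intro Bochner_Integration.integral_cong refl)
      fix \<eta> :: 'a
      have "(\<integral>z. (?h z * cis_inner (- \<xi>) z) * cis_inner \<eta> z \<partial>lborel) = (\<integral>z. ?h z * cis_inner (\<eta> - \<xi>) z \<partial>lborel)"
        by (simp add: cis_inner_diff cis_inner_minus ac_simps)
      also have "\<dots> = of_real ((2 * pi) ^ DIM('a) * gauss s (\<eta> - \<xi>))"
        using gaussian_fourier[OF s] by (rule has_bochner_integral_integral_eq)
      finally show "?w \<eta> * (\<integral>z. (?h z * cis_inner (- \<xi>) z) * cis_inner \<eta> z \<partial>lborel) =
          of_real ((2 * pi) ^ DIM('a) * (indicator W \<eta> * gauss s (\<eta> - \<xi>)))"
        by (simp add: indicator_def)
    qed
    also have "\<dots> = of_real ((2 * pi) ^ DIM('a) * (\<integral>\<eta>. indicator W \<eta> * gauss s (\<eta> - \<xi>) \<partial>lborel))"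
      by (subst integral_complex_of_real) simp
    finally have "cnj (\<integral>z. (?h z * cnj (?K z)) * cis_inner \<xi> z \<partial>lborel) = of_real (\<integral>\<eta>. indicator W \<eta> * gauss s (\<eta> - \<xi>) \<partial>lborel)"
      by simp
    from arg_cong[OF this, of cnj] show ?thesis by (simp only: complex_cnj_cnj complex_cnj_complex_of_real)
  qed
  have "complex_of_real (\<integral>z. exp (- s\<^sup>2 * (norm z)\<^sup>2 / 2) * (cmod (?K z))\<^sup>2 \<partial>lborel) =
      (\<integral>z. of_real (exp (- s\<^sup>2 * (norm z)\<^sup>2 / 2) * (cmod (?K z))\<^sup>2) \<partial>lborel)"
    by (rule integral_complex_of_real[symmetric])
  also have "\<dots> = (\<integral>z. of_real ?c * ((?h z * cnj (?K z)) * (\<integral>\<xi>. ?w \<xi> * cis_inner z \<xi> \<partial>lborel)) \<partial>lborel)"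
  proof (intro Bochner_Integration.integral_cong refl)
    fix z :: 'a
    have "of_real ((cmod (?K z))\<^sup>2) = ?K z * cnj (?K z)" by (rule complex_norm_square)
    then have "of_real (exp (- s\<^sup>2 * (norm z)\<^sup>2 / 2) * (cmod (?K z))\<^sup>2) = ?h z * (?K z * cnj (?K z))"
      by (simp only: of_real_mult)
    also have "\<dots> = (?h z * cnj (?K z)) * ?K z" by (simp only: ac_simps)
    also have "\<dots> = (?h z * cnj (?K z)) * (of_real ?c * (\<integral>\<xi>. ?w \<xi> * cis_inner z \<xi> \<partial>lborel))"
      by (simp only: band_kernel_def)
    finally show "of_real (exp (- s\<^sup>2 * (norm z)\<^sup>2 / 2) * (cmod (?K z))\<^sup>2) =
      of_real ?c * ((?h z * cnj (?K z)) * (\<integral>\<xi>. ?w \<xi> * cis_inner z \<xi> \<partial>lborel))"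
      by (simp only: ac_simps)
  qed
  also have "\<dots> = of_real ?c * (\<integral>z. (?h z * cnj (?K z)) * (\<integral>\<xi>. ?w \<xi> * cis_inner z \<xi> \<partial>lborel) \<partial>lborel)"
    by (rule Bochner_Integration.integral_mult_right_zero)
  also have "(\<integral>z. (?h z * cnj (?K z)) * (\<integral>\<xi>. ?w \<xi> * cis_inner z \<xi> \<partial>lborel) \<partial>lborel) =
      (\<integral>\<xi>. ?w \<xi> * (\<integral>z. (?h z * cnj (?K z)) * cis_inner \<xi> z \<partial>lborel) \<partial>lborel)"
    using hK wint by (intro fourier_swap sf) auto
  also have "\<dots> = (\<integral>\<xi>. of_real (indicator W \<xi> * (\<integral>\<eta>. indicator W \<eta> * gauss s (\<eta> - \<xi>) \<partial>lborel)) \<partial>lborel)"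
    unfolding inner by (intro Bochner_Integration.integral_cong refl) (simp add: indicator_def)
  also have "\<dots> = of_real (\<integral>\<xi>. indicator W \<xi> * (\<integral>\<eta>. indicator W \<eta> * gauss s (\<eta> - \<xi>) \<partial>lborel) \<partial>lborel)"
    by (rule integral_complex_of_real)
  finally show ?thesis by (simp only: of_real_mult[symmetric] of_real_eq_iff)
qed

section \<open>Covariograms and double integrals over A x A\<close>

text \<open>The covariogram: the measure of the intersection of A with its translate by -u. It is
  the weight with which the difference u occurs among pairs of points of A.\<close>

definition autocorr :: "'a::euclidean_space set \<Rightarrow> 'a \<Rightarrow> real" where
  "autocorr A u = (\<integral>x. indicator A x * indicator A (x + u) \<partial>lborel)"

lemma lborel_integral_translate:
  fixes f :: "'a::euclidean_space \<Rightarrow> real"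
  assumes [measurable]: "f \<in> borel_measurable borel"
  shows "(\<integral>y. f y \<partial>lborel) = (\<integral>u. f (x + u) \<partial>lborel)"
proof -
  have "(\<integral>y. f y \<partial>lborel) = (\<integral>y. f y \<partial>distr lborel borel ((+) x))" by (simp add: lborel_distr_plus)
  also have "\<dots> = (\<integral>u. f (x + u) \<partial>lborel)" by (simp add: integral_distr)
  finally show ?thesis .
qed

lemma lborel_integral_scale:
  fixes f :: "'a::euclidean_space \<Rightarrow> real"
  assumes [measurable]: "f \<in> borel_measurable borel" and r: "r > 0"
  shows "(\<integral>y. f y \<partial>lborel) = r ^ DIM('a) * (\<integral>u. f (r *\<^sub>R u) \<partial>lborel)"
proof -
  have "(\<integral>y. f y \<partial>lborel) = (\<integral>y. f y \<partial>density (distr lborel borel (\<lambda>x. 0 + r *\<^sub>R x)) (\<lambda>_. ennreal (\<bar>r\<bar> ^ DIM('a))))"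
    using lborel_affine[of r "0::'a"] r by (simp add: ennreal_power)
  also have "\<dots> = (\<integral>u. r ^ DIM('a) * f (r *\<^sub>R u) \<partial>lborel)"
    using r by (simp add: integral_density integral_distr)
  finally show ?thesis by simp
qed

lemma autocorr_measurable[measurable]:
  assumes A[measurable]: "A \<in> sets borel" shows "autocorr A \<in> borel_measurable borel"
proof -
  have "(\<lambda>p::'a \<times> 'a. indicator A (snd p) * indicator A (snd p + fst p) :: real) \<in> borel_measurable (borel \<Otimes>\<^sub>M lborel)"
    by measurable
  then have "(\<lambda>(u, x). indicator A x * indicator A (x + u) :: real) \<in> borel_measurable (borel \<Otimes>\<^sub>M lborel)"
    by (simp add: case_prod_beta)
  then show ?thesis unfolding autocorr_def[abs_def] by (rule lborel.borel_measurable_lebesgue_integral)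
qed

lemma autocorr_le:
  assumes A: "compact A" shows "0 \<le> autocorr A u" "autocorr A u \<le> measure lborel A"
proof -
  have [measurable]: "A \<in> sets borel" using A by (rule borel_compact)
  show "0 \<le> autocorr A u" unfolding autocorr_def by simp
  have "autocorr A u \<le> (\<integral>x. indicator A x \<partial>lborel)"
    unfolding autocorr_def
  proof (rule integral_mono)
    show "integrable lborel (\<lambda>x. indicator A x * indicator A (x + u) :: real)"
      by (rule Bochner_Integration.integrable_bound[OF compact_integrable_indicator(1)[OF A]]) (measurable, auto simp: indicator_def)
  qed (use compact_integrable_indicator(1)[OF A] in \<open>auto split: split_indicator\<close>)
  then show "autocorr A u \<le> measure lborel A" by simp
qed

text \<open>By outer regularity A has an open neighbourhood U of little more measure, and by
  compactness small translates of A stay in U. Such a translate misses A by at most |U - A|.\<close>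

lemma autocorr_near_zero:
  assumes A: "compact A" and e: "e > 0"
  shows "\<exists>\<delta>>0. \<forall>u. norm u < \<delta> \<longrightarrow> measure lborel A - e \<le> autocorr A u"
proof -
  have Ab[measurable]: "A \<in> sets borel" using A by (rule borel_compact)
  have fin: "emeasure lborel A < \<infinity>" using A by (rule emeasure_compact_finite)
  obtain U where U: "open U" "A \<subseteq> U" "emeasure lborel (U - A) < ennreal e"
    using outer_regular_lborel[of A e] Ab e by auto
  have [measurable]: "U \<in> sets borel" using U by simp
  obtain \<delta> where \<delta>: "\<delta> > 0" "(\<Union>x\<in>A. ball x \<delta>) \<subseteq> U"
    using compact_subset_open_imp_ball_epsilon_subset[OF A U(1,2)] by blast
  have UA: "measure lborel (U - A) \<le> e"
    using U(3) e unfolding measure_def by (metis enn2real_leI less_imp_le)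
  have UAi: "integrable lborel (indicator (U - A) :: _ \<Rightarrow> real)"
    using U(3) by (simp add: integrable_indicator_iff) (metis ennreal_less_top less_trans)
  have "measure lborel A - e \<le> autocorr A u" if u: "norm u < \<delta>" for u
  proof -
    have "measure lborel A = (\<integral>x. indicator A (u + x) \<partial>lborel)"
      using lborel_integral_translate[of "indicator A" u] by simp
    also have "\<dots> \<le> (\<integral>x. indicator A x * indicator A (x + u) + indicator (U - A) x \<partial>lborel)"
    proof (rule integral_mono)
      have "integrable (distr lborel borel ((+) u)) (indicator A :: _ \<Rightarrow> real)"
        unfolding lborel_distr_plus by (rule compact_integrable_indicator(1)[OF A])
      then show "integrable lborel (\<lambda>x. indicator A (u + x) :: real)"
        by (subst (asm) integrable_distr_eq) auto
      have "integrable lborel (\<lambda>x. indicator A x * indicator A (x + u) :: real)"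
        by (rule Bochner_Integration.integrable_bound[OF compact_integrable_indicator(1)[OF A]]) (measurable, auto simp: indicator_def)
      then show "integrable lborel (\<lambda>x. indicator A x * indicator A (x + u) + indicator (U - A) x :: real)"
        using UAi by (rule Bochner_Integration.integrable_add)
      fix x
      have "x \<in> U" if "u + x \<in> A"
      proof -
        have "x \<in> ball (u + x) \<delta>" using u by (simp add: dist_norm)
        then show ?thesis using \<delta>(2) that by blast
      qed
      then show "(indicator A (u + x) :: real) \<le> indicator A x * indicator A (x + u) + indicator (U - A) x"
        by (auto simp: indicator_def add.commute)
    qed
    also have "\<dots> = autocorr A u + measure lborel (U - A)"
    proof -
      have "integrable lborel (\<lambda>x. indicator A x * indicator A (x + u) :: real)"
        by (rule Bochner_Integration.integrable_bound[OF compact_integrable_indicator(1)[OF A]]) (measurable, auto simp: indicator_def)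
      then show ?thesis unfolding autocorr_def using UAi by (subst Bochner_Integration.integral_add) auto
    qed
    finally show ?thesis using UA by simp
  qed
  then show ?thesis using \<delta> by blast
qed

lemma autocorr_tendsto:
  fixes A :: "'a::euclidean_space set"
  assumes A: "compact A"
  shows "((\<lambda>r. autocorr A (u /\<^sub>R r)) \<longlongrightarrow> measure lborel A) at_top"
proof (rule tendstoI)
  fix e :: real assume e: "e > 0"
  obtain \<delta> where \<delta>: "\<delta> > 0" "\<And>u. norm u < \<delta> \<Longrightarrow> measure lborel A - e / 2 \<le> autocorr A u"
    using autocorr_near_zero[OF A, of "e / 2"] e by auto
  have "eventually (\<lambda>r. r > norm u / \<delta> \<and> r > 0) at_top"
    by (intro eventually_conj eventually_gt_at_top)
  then show "eventually (\<lambda>r. dist (autocorr A (u /\<^sub>R r)) (measure lborel A) < e) at_top"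
  proof eventually_elim
    case (elim r)
    then have "norm (u /\<^sub>R r) < \<delta>" using \<delta> by (simp add: field_simps)
    then show ?case using \<delta>(2)[of "u /\<^sub>R r"] autocorr_le(2)[OF A, of "u /\<^sub>R r"] e by (simp add: dist_real_def)
  qed
qed

text \<open>Dominated convergence. It serves twice: for a Gaussian over W, and for the damped
  squared kernel over \<Omega>.\<close>

lemma autocorr_integral_tendsto:
  fixes A :: "'a::euclidean_space set" and g :: "'a \<Rightarrow> real"
  assumes A: "compact A" and g: "integrable lborel g"
  shows "((\<lambda>r. \<integral>u. g u * autocorr A (u /\<^sub>R r) \<partial>lborel) \<longlongrightarrow> (\<integral>u. g u \<partial>lborel) * measure lborel A) at_top"
proof -
  have [measurable]: "A \<in> sets borel" using A by (rule borel_compact)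
  have [measurable]: "g \<in> borel_measurable borel" using g by auto
  have "((\<lambda>r. \<integral>u. g u * autocorr A (u /\<^sub>R r) \<partial>lborel) \<longlongrightarrow> (\<integral>u. g u * measure lborel A \<partial>lborel)) at_top"
  proof (rule integral_dominated_convergence_at_top)
    show "integrable lborel (\<lambda>u. \<bar>g u\<bar> * measure lborel A)" using g by simp
    show "\<forall>\<^sub>F r in at_top. AE u in lborel. norm (g u * autocorr A (u /\<^sub>R r)) \<le> \<bar>g u\<bar> * measure lborel A"
      using autocorr_le[OF A] by (intro always_eventually allI AE_I2) (simp add: abs_mult mult_left_mono)
    show "AE u in lborel. ((\<lambda>r. g u * autocorr A (u /\<^sub>R r)) \<longlongrightarrow> g u * measure lborel A) at_top"
      by (intro AE_I2 tendsto_mult tendsto_const autocorr_tendsto A)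
  qed measurable
  then show ?thesis by simp
qed

lemma autocorr_scale:
  fixes A :: "'a::euclidean_space set"
  assumes A: "compact A" and r: "r > 0"
  shows "autocorr ((*\<^sub>R) r ` A) u = r ^ DIM('a) * autocorr A (u /\<^sub>R r)"
proof -
  have rA: "compact ((*\<^sub>R) r ` A)" using A by (rule compact_scaling)
  have [measurable]: "(*\<^sub>R) r ` A \<in> sets borel" using rA by (rule borel_compact)
  have i: "indicator ((*\<^sub>R) r ` A) (r *\<^sub>R x) = (indicator A x :: real)" for x
    using r by (auto simp: indicator_def)
  have i2: "indicator ((*\<^sub>R) r ` A) (r *\<^sub>R x + u) = (indicator A (x + u /\<^sub>R r) :: real)" for x
    using i[of "x + u /\<^sub>R r"] r by (simp add: scaleR_add_right)
  have "autocorr ((*\<^sub>R) r ` A) u = r ^ DIM('a) * (\<integral>x. indicator ((*\<^sub>R) r ` A) (r *\<^sub>R x) * indicator ((*\<^sub>R) r ` A) (r *\<^sub>R x + u) \<partial>lborel)"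
    unfolding autocorr_def using r by (intro lborel_integral_scale) auto
  then show ?thesis unfolding i i2 autocorr_def .
qed

text \<open>The substitution y = x + u followed by Fubini. Only |u| <= 2 R occurs if A lies in the
  ball of radius R, so a bounded H gives an integrable function of the pair (x, u).\<close>

lemma autocorr_integral:
  fixes A :: "'a::euclidean_space set" and H :: "'a \<Rightarrow> real"
  assumes A: "compact A" and [measurable]: "H \<in> borel_measurable borel" and HC: "\<And>u. \<bar>H u\<bar> \<le> C"
  shows "integrable lborel (\<lambda>u. H u * autocorr A u)"
    and "(\<integral>x. indicator A x * (\<integral>y. indicator A y * H (y - x) \<partial>lborel) \<partial>lborel) = (\<integral>u. H u * autocorr A u \<partial>lborel)"
proof -
  have [measurable]: "A \<in> sets borel" using A by (rule borel_compact)
  obtain R where R: "\<And>x. x \<in> A \<Longrightarrow> norm x \<le> R"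
    using compact_imp_bounded[OF A] by (auto simp: bounded_iff)
  let ?f = "\<lambda>x u. indicator A x * indicator A (x + u) * H u :: real"
  have int: "integrable (lborel \<Otimes>\<^sub>M lborel) (\<lambda>(x, u). ?f x u)"
  proof (rule Bochner_Integration.integrable_bound)
    have "compact (A \<times> cball (0::'a) (2 * R))" using A by (intro compact_Times) auto
    then have "integrable lborel (indicator (A \<times> cball (0::'a) (2 * R)) :: _ \<Rightarrow> real)"
      by (rule compact_integrable_indicator)
    then show "integrable (lborel \<Otimes>\<^sub>M lborel) (\<lambda>p. C * indicator (A \<times> cball (0::'a) (2 * R)) p :: real)"
      unfolding lborel_prod by simp
    show "(\<lambda>(x, u). ?f x u) \<in> borel_measurable (lborel \<Otimes>\<^sub>M lborel)"
      unfolding case_prod_beta by measurable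
    show "AE p in lborel \<Otimes>\<^sub>M lborel. norm (case p of (x, u) \<Rightarrow> ?f x u) \<le> norm (C * indicator (A \<times> cball (0::'a) (2 * R)) p :: real)"
    proof (intro AE_I2, clarify)
      fix x u :: 'a
      have C0: "C \<ge> 0" using HC[of 0] by linarith
      have "norm u \<le> 2 * R" if "x \<in> A" "x + u \<in> A"
      proof -
        have "norm u \<le> norm (x + u) + norm x" using norm_triangle_ineq4[of "x + u" x] by simp
        then show ?thesis using R[OF that(1)] R[OF that(2)] by simp
      qed
      then show "norm (?f x u) \<le> norm (C * indicator (A \<times> cball (0::'a) (2 * R)) (x, u) :: real)"
        using HC[of u] C0 by (auto simp: indicator_def)
    qed
  qed
  have e: "(\<integral>x. ?f x u \<partial>lborel) = H u * autocorr A u" for u by (simp add: autocorr_def)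
  show "integrable lborel (\<lambda>u. H u * autocorr A u)"
    using lborel_pair.integrable_snd[OF int] unfolding e .
  have "(\<integral>x. indicator A x * (\<integral>y. indicator A y * H (y - x) \<partial>lborel) \<partial>lborel) = (\<integral>x. \<integral>u. ?f x u \<partial>lborel \<partial>lborel)"
  proof (intro Bochner_Integration.integral_cong refl)
    fix x :: 'a
    have "(\<integral>y. indicator A y * H (y - x) \<partial>lborel) = (\<integral>u. indicator A (x + u) * H u \<partial>lborel)"
      by (subst lborel_integral_translate[of _ x]) simp_all
    then show "indicator A x * (\<integral>y. indicator A y * H (y - x) \<partial>lborel) = (\<integral>u. ?f x u \<partial>lborel)"
      by (simp add: mult.assoc)
  qed
  also have "\<dots> = (\<integral>u. \<integral>x. ?f x u \<partial>lborel \<partial>lborel)"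
    using lborel_pair.Fubini_integral[OF int] by simp
  finally show "(\<integral>x. indicator A x * (\<integral>y. indicator A y * H (y - x) \<partial>lborel) \<partial>lborel) = (\<integral>u. H u * autocorr A u \<partial>lborel)"
    unfolding e .
qed

text \<open>The width is s = 1/r. Rescaling u by 1/r turns the shrinking Gaussian into the fixed
  \<open>gauss 1\<close> and moves r into the covariogram of W.\<close>

lemma gaussian_energy_tendsto:
  fixes W :: "'a::euclidean_space set"
  assumes W: "compact W"
  shows "((\<lambda>r. \<integral>z. exp (- (1 / r)\<^sup>2 * (norm z)\<^sup>2 / 2) * (cmod (band_kernel W z))\<^sup>2 \<partial>lborel)
    \<longlongrightarrow> measure lborel W / (2 * pi) ^ DIM('a)) at_top"
proof -
  have [measurable]: "W \<in> sets borel" using W by (rule borel_compact)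
  have "((\<lambda>r. 1 / (2 * pi) ^ DIM('a) * (\<integral>u. gauss 1 u * autocorr W (u /\<^sub>R r) \<partial>lborel)) \<longlongrightarrow>
      1 / (2 * pi) ^ DIM('a) * ((\<integral>u. gauss 1 (u::'a) \<partial>lborel) * measure lborel W)) at_top"
    using gauss_integral[of 1, where 'a = 'a]
    by (intro tendsto_mult tendsto_const autocorr_integral_tendsto W) (auto simp: has_bochner_integral_iff)
  also have "1 / (2 * pi) ^ DIM('a) * ((\<integral>u. gauss 1 (u::'a) \<partial>lborel) * measure lborel W) = measure lborel W / (2 * pi) ^ DIM('a)"
    using gauss_integral[of 1, where 'a = 'a] by (simp add: has_bochner_integral_iff)
  finally have lim: "((\<lambda>r. 1 / (2 * pi) ^ DIM('a) * (\<integral>u. gauss 1 u * autocorr W (u /\<^sub>R r) \<partial>lborel)) \<longlongrightarrow>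
      measure lborel W / (2 * pi) ^ DIM('a)) at_top" .
  have "\<forall>\<^sub>F r in at_top. 1 / (2 * pi) ^ DIM('a) * (\<integral>u. gauss 1 u * autocorr W (u /\<^sub>R r) \<partial>lborel) =
      (\<integral>z. exp (- (1 / r)\<^sup>2 * (norm z)\<^sup>2 / 2) * (cmod (band_kernel W z))\<^sup>2 \<partial>lborel)"
    using eventually_gt_at_top[of 0]
  proof eventually_elim
    case (elim r)
    then have s: "1 / r > 0" by simp
    have g: "(1 / r) ^ DIM('a) * gauss (1 / r) ((1 / r) *\<^sub>R u) = gauss 1 u" for u :: 'a
      using elim by (simp add: gauss_def power_mult_distrib power_divide field_simps)
    have "(\<integral>z. exp (- (1 / r)\<^sup>2 * (norm z)\<^sup>2 / 2) * (cmod (band_kernel W z))\<^sup>2 \<partial>lborel)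
      = 1 / (2 * pi) ^ DIM('a) * (\<integral>\<xi>. indicator W \<xi> * (\<integral>\<eta>. indicator W \<eta> * gauss (1 / r) (\<eta> - \<xi>) \<partial>lborel) \<partial>lborel)"
      by (rule band_kernel_gaussian_energy[OF W s])
    also have "(\<integral>\<xi>. indicator W \<xi> * (\<integral>\<eta>. indicator W \<eta> * gauss (1 / r) (\<eta> - \<xi>) \<partial>lborel) \<partial>lborel) = (\<integral>u. gauss (1 / r) u * autocorr W u \<partial>lborel)"
    proof (rule autocorr_integral(2)[OF W gauss_measurable])
      show "\<bar>gauss (1 / r) u\<bar> \<le> (1 / (sqrt (2 * pi) * (1 / r))) ^ DIM('a)" for u :: 'a
        using elim by (simp add: gauss_def abs_mult mult_left_le)
    qed
    also have "\<dots> = (1 / r) ^ DIM('a) * (\<integral>u. gauss (1 / r) ((1 / r) *\<^sub>R u) * autocorr W ((1 / r) *\<^sub>R u) \<partial>lborel)"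
      using s by (intro lborel_integral_scale) auto
    also have "\<dots> = (\<integral>u. (1 / r) ^ DIM('a) * (gauss (1 / r) ((1 / r) *\<^sub>R u) * autocorr W ((1 / r) *\<^sub>R u)) \<partial>lborel)"
      by (rule Bochner_Integration.integral_mult_right_zero[symmetric])
    also have "\<dots> = (\<integral>u. gauss 1 u * autocorr W (u /\<^sub>R r) \<partial>lborel)"
      unfolding mult.assoc[symmetric] g by (simp add: divide_inverse)
    finally show ?case by simp
  qed
  then show ?thesis using lim by (rule Lim_transform_eventually[rotated])
qed

section \<open>Energy of the kernel on dilated sets\<close>

text \<open>The squared Hilbert-Schmidt norm of the time- and band-limiting operator over the
  complex numbers; the real form counts it twice.\<close>

definition kernel_energy :: "'a::euclidean_space set \<Rightarrow> 'a set \<Rightarrow> real" where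
  "kernel_energy A W = (\<integral>x. indicator A x * (\<integral>y. indicator A y * (cmod (band_kernel W (y - x)))\<^sup>2 \<partial>lborel) \<partial>lborel)"

text \<open>Two limits in a fixed order: the damping s is fixed such that the damped energy of K is
  nearly |W| / (2 pi)^d, and only then r tends to infinity. Since the damping factor is at most 1,
  the true energy is at least as large.\<close>

lemma kernel_energy_lower:
  fixes \<Omega> W :: "'a::euclidean_space set"
  assumes \<Omega>: "compact \<Omega>" and W: "compact W" and \<eta>: "\<eta> > 0"
  shows "\<forall>\<^sub>F r in at_top. (measure lborel \<Omega> * measure lborel W / (2 * pi) ^ DIM('a) - \<eta>) * r ^ DIM('a)
    \<le> kernel_energy ((*\<^sub>R) r ` \<Omega>) W"
proof -
  let ?K = "band_kernel W" and ?o = "measure lborel \<Omega>"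
  define kmax where "kmax = measure lborel W / (2 * pi) ^ DIM('a)"
  have [measurable]: "?K \<in> borel_measurable borel" using W by (rule band_kernel_measurable)
  have K: "(cmod (?K z))\<^sup>2 \<le> kmax\<^sup>2" for z
    unfolding kmax_def using band_kernel_bound[OF W, of z] by (intro power_mono) auto
  define E where "E = (\<lambda>s. \<integral>z. exp (- s\<^sup>2 * (norm z)\<^sup>2 / 2) * (cmod (?K z))\<^sup>2 \<partial>lborel)"
  have "((\<lambda>r. E (1 / r) * ?o) \<longlongrightarrow> kmax * ?o) at_top"
    unfolding E_def kmax_def by (intro tendsto_mult tendsto_const gaussian_energy_tendsto W)
  then have "\<forall>\<^sub>F r in at_top. E (1 / r) * ?o > kmax * ?o - \<eta> / 2"
    using \<eta> by (intro order_tendstoD(1)) auto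
  then have "\<forall>\<^sub>F r in at_top. E (1 / r) * ?o > kmax * ?o - \<eta> / 2 \<and> r > 0"
    using eventually_gt_at_top[of 0] by (rule eventually_conj)
  then obtain r0 where r0: "E (1 / r0) * ?o > kmax * ?o - \<eta> / 2" "r0 > 0"
    by (auto dest!: eventually_happens)
  define s where "s = 1 / r0"
  have s: "s > 0" using r0 by (simp add: s_def)
  let ?g = "\<lambda>z. exp (- s\<^sup>2 * (norm z)\<^sup>2 / 2) * (cmod (?K z))\<^sup>2"
  have gi: "integrable lborel ?g"
  proof (rule Bochner_Integration.integrable_bound)
    have "integrable lborel (\<lambda>z::'a. Re (of_real (exp (- s\<^sup>2 * (norm z)\<^sup>2 / 2)) * cis_inner 0 z))"
      using gaussian_fourier[OF s, of "0::'a"] by (intro integrable_Re) (simp add: has_bochner_integral_iff)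
    then show "integrable lborel (\<lambda>z::'a. kmax\<^sup>2 * exp (- s\<^sup>2 * (norm z)\<^sup>2 / 2))" by simp
    show "AE z in lborel. norm (?g z) \<le> norm (kmax\<^sup>2 * exp (- s\<^sup>2 * (norm z)\<^sup>2 / 2))"
      using K by (intro AE_I2) (simp add: abs_mult mult.commute mult_left_mono)
  qed measurable
  have "((\<lambda>r. \<integral>u. ?g u * autocorr \<Omega> (u /\<^sub>R r) \<partial>lborel) \<longlongrightarrow> E s * ?o) at_top"
    unfolding E_def by (intro autocorr_integral_tendsto \<Omega> gi)
  moreover have "kmax * ?o - \<eta> < E s * ?o" using r0 \<eta> by (simp add: s_def)
  ultimately have "\<forall>\<^sub>F r in at_top. kmax * ?o - \<eta> < (\<integral>u. ?g u * autocorr \<Omega> (u /\<^sub>R r) \<partial>lborel)"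
    by (rule order_tendstoD(1))
  then show ?thesis using eventually_gt_at_top[of 0]
  proof eventually_elim
    case (elim r)
    have rO: "compact ((*\<^sub>R) r ` \<Omega>)" using \<Omega> by (rule compact_scaling)
    have "(kmax * ?o - \<eta>) * r ^ DIM('a) \<le> (\<integral>u. ?g u * autocorr \<Omega> (u /\<^sub>R r) \<partial>lborel) * r ^ DIM('a)"
      using elim by (intro mult_right_mono) auto
    also have "\<dots> = (\<integral>u. ?g u * autocorr ((*\<^sub>R) r ` \<Omega>) u \<partial>lborel)"
      unfolding Bochner_Integration.integral_mult_left_zero[symmetric]
      by (intro Bochner_Integration.integral_cong refl) (simp add: autocorr_scale[OF \<Omega> elim(2)])
    also have "\<dots> \<le> (\<integral>u. (cmod (?K u))\<^sup>2 * autocorr ((*\<^sub>R) r ` \<Omega>) u \<partial>lborel)"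
    proof (rule integral_mono)
      show "integrable lborel (\<lambda>u. (cmod (?K u))\<^sup>2 * autocorr ((*\<^sub>R) r ` \<Omega>) u)"
        using K by (intro autocorr_integral(1)[where C = "kmax\<^sup>2"] rO) auto
      show "integrable lborel (\<lambda>u. ?g u * autocorr ((*\<^sub>R) r ` \<Omega>) u)"
      proof (rule autocorr_integral(1)[where C = "kmax\<^sup>2", OF rO])
        show "\<bar>?g u\<bar> \<le> kmax\<^sup>2" for u
          using mult_mono[OF _ K[of u], of "exp (- s\<^sup>2 * (norm u)\<^sup>2 / 2)" 1] by (simp add: abs_mult)
      qed measurable
      fix u :: 'a
      show "?g u * autocorr ((*\<^sub>R) r ` \<Omega>) u \<le> (cmod (?K u))\<^sup>2 * autocorr ((*\<^sub>R) r ` \<Omega>) u"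
        using autocorr_le(1)[OF rO, of u] by (intro mult_right_mono) (auto simp: mult_left_le_one_le)
    qed
    also have "\<dots> = kernel_energy ((*\<^sub>R) r ` \<Omega>) W"
      unfolding kernel_energy_def using K by (intro autocorr_integral(2)[where C = "kmax\<^sup>2", symmetric] rO) auto
    finally show ?case by (simp add: kmax_def mult.commute)
  qed
qed

section \<open>The time- and band-limiting operator as an integral operator\<close>

lemma sigma_finite_lebesgue: "sigma_finite_measure (lebesgue :: 'a::euclidean_space measure)"
proof
  obtain A :: "'a set set" where A: "countable A" "A \<subseteq> sets lborel" "\<Union>A = space lborel" "\<forall>a\<in>A. emeasure lborel a \<noteq> \<infinity>"
    using lborel.sigma_finite_countable by blast
  then show "\<exists>A. countable A \<and> A \<subseteq> sets lebesgue \<and> \<Union>A = space (lebesgue :: 'a measure) \<and> (\<forall>a\<in>A. emeasure lebesgue a \<noteq> \<infinity>)"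
    by (intro exI[of _ A]) (auto simp: subset_iff)
qed

lemma id_lebesgue_borel: "(\<lambda>x. x) \<in> lebesgue \<rightarrow>\<^sub>M borel"
  by (rule measurable_completion) simp

lemma borel_imp_lebesgue_measurable: "f \<in> borel_measurable borel \<Longrightarrow> f \<in> borel_measurable lebesgue"
  by (rule measurable_completion) simp

lemma fourier_swap_cnj:
  fixes f g :: "'a::euclidean_space \<Rightarrow> complex"
  assumes M: "sigma_finite_measure M" and N: "sigma_finite_measure N"
    and "(\<lambda>x. x) \<in> M \<rightarrow>\<^sub>M borel" "(\<lambda>x. x) \<in> N \<rightarrow>\<^sub>M borel"
    and f: "integrable M f" and g: "integrable N g"
  shows "(\<integral>x. f x * (\<integral>y. g y * cis_inner (- x) y \<partial>N) \<partial>M) = (\<integral>y. g y * (\<integral>x. f x * cis_inner (- y) x \<partial>M) \<partial>N)"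
proof -
  have "(\<integral>x. cnj (f x) * (\<integral>y. cnj (g y) * cis_inner x y \<partial>N) \<partial>M) = (\<integral>y. cnj (g y) * (\<integral>x. cnj (f x) * cis_inner y x \<partial>M) \<partial>N)"
    using assms by (intro fourier_swap) auto
  moreover have "(\<integral>x. f x * (\<integral>y. g y * cis_inner (- x) y \<partial>N) \<partial>M) = cnj (\<integral>x. cnj (f x) * (\<integral>y. cnj (g y) * cis_inner x y \<partial>N) \<partial>M)"
    for M N :: "'a measure" and f g :: "'a \<Rightarrow> complex"
    by (simp add: Bochner_Integration.integral_cnj[symmetric] cis_inner_minus del: Bochner_Integration.integral_cnj)
  ultimately show ?thesis by simp
qed

lemma L2_indicator:
  assumes A: "A \<in> sets borel" "emeasure lborel A < \<infinity>"
  shows "(\<lambda>x. indicator A x :: complex) \<in> L2" "L2_norm (\<lambda>x. indicator A x :: complex) = sqrt (measure lborel A)"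
proof -
  have [measurable]: "A \<in> sets lebesgue" using A by simp
  have e: "(\<lambda>x. (cmod (indicator A x))\<^sup>2) = (indicator A :: _ \<Rightarrow> real)" by (auto simp: indicator_def)
  show "(\<lambda>x. indicator A x :: complex) \<in> L2"
    unfolding L2_def mem_Collect_eq e using A by (simp add: integrable_indicator_iff)
  show "L2_norm (\<lambda>x. indicator A x :: complex) = sqrt (measure lborel A)"
    unfolding L2_norm_def e using A by simp
qed

lemma L2_indicator_integrable:
  assumes f: "f \<in> L2" and A: "A \<in> sets borel" "emeasure lborel A < \<infinity>"
  shows "integrable lebesgue (\<lambda>x. indicator A x * f x)"
proof -
  have "integrable lebesgue (\<lambda>x. f x * cnj (indicator A x))" by (rule L2_inner_integrable[OF f L2_indicator(1)[OF A]])
  moreover have "f x * cnj (indicator A x) = indicator A x * f x" for x by (simp add: indicator_def)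
  ultimately show ?thesis by simp
qed

lemma L2_norm1_bound:
  assumes f: "f \<in> L2" and A: "A \<in> sets borel" "emeasure lborel A < \<infinity>"
  shows "(\<integral>x. cmod (indicator A x * f x) \<partial>lebesgue) \<le> sqrt (measure lborel A) * L2_norm f"
proof -
  have f': "(\<lambda>x. complex_of_real (cmod (f x))) \<in> L2"
    using f L2_measurable[OF f] by (auto simp: L2_def)
  have "(\<integral>x. cmod (indicator A x * f x) \<partial>lebesgue) = L2_inner (\<lambda>x. complex_of_real (cmod (f x))) (\<lambda>x. indicator A x)"
    unfolding L2_inner_def by (intro Bochner_Integration.integral_cong refl) (simp add: indicator_def norm_mult)
  also have "\<dots> \<le> L2_norm (\<lambda>x. complex_of_real (cmod (f x))) * L2_norm (\<lambda>x. indicator A x :: complex)"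
    using L2_Cauchy_Schwarz[OF f' L2_indicator(1)[OF A]] by simp
  also have "L2_norm (\<lambda>x. complex_of_real (cmod (f x))) = L2_norm f" by (simp add: L2_norm_def)
  finally show ?thesis by (simp add: L2_indicator(2)[OF A] mult.commute)
qed

lemma L2_norm_bounded_support:
  assumes g: "g \<in> L2" and A: "A \<in> sets borel" "emeasure lborel A < \<infinity>" and C: "C \<ge> 0"
    and b: "AE x in lebesgue. cmod (g x) \<le> C * indicator A x"
  shows "L2_norm g \<le> C * sqrt (measure lborel A)"
proof -
  have [measurable]: "A \<in> sets lebesgue" using A by simp
  have Ai: "integrable lebesgue (indicator A :: _ \<Rightarrow> real)" using A by (simp add: integrable_indicator_iff)
  have "(\<integral>x. (cmod (g x))\<^sup>2 \<partial>lebesgue) \<le> (\<integral>x. C\<^sup>2 * indicator A x \<partial>lebesgue)"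
  proof (rule integral_mono_AE)
    show "AE x in lebesgue. (cmod (g x))\<^sup>2 \<le> C\<^sup>2 * indicator A x"
      using b
    proof eventually_elim
      case (elim x)
      then have "(cmod (g x))\<^sup>2 \<le> (C * indicator A x)\<^sup>2" by (intro power_mono) auto
      then show ?case by (cases "x \<in> A") (use elim in \<open>auto simp: power_mult_distrib\<close>)
    qed
  qed (use L2_integrable[OF g] Ai in auto)
  also have "\<dots> = C\<^sup>2 * measure lborel A" using A by simp
  finally have "L2_norm g \<le> sqrt (C\<^sup>2 * measure lborel A)" unfolding L2_norm_def by (rule real_sqrt_le_mono)
  then show ?thesis using C by (simp add: real_sqrt_mult)
qed

text \<open>Both 1_W and 1_A f are integrable, so the two Fourier integrals may be exchanged for
  fixed x. The phase of x is attached to 1_W, which makes the inner integral the kernel at x -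
  y.\<close>

lemma time_band_limit_kernel:
  fixes A W :: "'a::euclidean_space set"
  assumes A: "compact A" and W: "compact W" and f: "f \<in> L2"
  shows "time_limit A (band_limit W (time_limit A f)) x =
    indicator A x * (\<integral>y. band_kernel W (x - y) * (indicator A y * f y) \<partial>lebesgue)"
proof -
  let ?g = "\<lambda>y. indicator A y * f y"
  have g: "integrable lebesgue ?g"
    using f borel_compact[OF A] emeasure_compact_finite[OF A] by (rule L2_indicator_integrable)
  have w: "integrable lebesgue (\<lambda>\<xi>. indicator W \<xi> * cis_inner x \<xi>)"
  proof (rule integrable_mult_cis[OF _ id_lebesgue_borel])
    show "integrable lebesgue (indicator W :: 'a \<Rightarrow> complex)"
      using compact_integrable_indicator(2)[OF W] borel_compact[OF W] by (subst integrable_completion) auto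
  qed
  have p: "complex_of_real ((2 * pi) powi (- int DIM('a))) = of_real (1 / (2 * pi) ^ DIM('a))"
    by (simp add: power_int_minus divide_inverse)
  have "band_limit W ?g x = of_real (1 / (2 * pi) ^ DIM('a)) *
      (\<integral>\<xi>. (indicator W \<xi> * cis_inner x \<xi>) * (\<integral>y. ?g y * cis_inner (- \<xi>) y \<partial>lebesgue) \<partial>lebesgue)"
  proof -
    have "cis_inner (- \<xi>) y = exp (- \<i> * complex_of_real (y \<bullet> \<xi>))" for \<xi> y :: 'a
      by (simp add: cis_inner_def inner_commute)
    then show ?thesis
      unfolding band_limit_def inv_fourier_def fourier_def p by (simp add: cis_inner_def ac_simps)
  qed
  also have "(\<integral>\<xi>. (indicator W \<xi> * cis_inner x \<xi>) * (\<integral>y. ?g y * cis_inner (- \<xi>) y \<partial>lebesgue) \<partial>lebesgue) =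
      (\<integral>y. ?g y * (\<integral>\<xi>. (indicator W \<xi> * cis_inner x \<xi>) * cis_inner (- y) \<xi> \<partial>lebesgue) \<partial>lebesgue)"
    by (rule fourier_swap_cnj[OF sigma_finite_lebesgue sigma_finite_lebesgue id_lebesgue_borel id_lebesgue_borel w g])
  also have "of_real (1 / (2 * pi) ^ DIM('a)) * \<dots> =
      (\<integral>y. of_real (1 / (2 * pi) ^ DIM('a)) * (?g y * (\<integral>\<xi>. (indicator W \<xi> * cis_inner x \<xi>) * cis_inner (- y) \<xi> \<partial>lebesgue)) \<partial>lebesgue)"
    by (rule Bochner_Integration.integral_mult_right_zero[symmetric])
  also have "\<dots> = (\<integral>y. band_kernel W (x - y) * ?g y \<partial>lebesgue)"
  proof (intro Bochner_Integration.integral_cong refl)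
    fix y
    have "(\<integral>\<xi>. (indicator W \<xi> * cis_inner x \<xi>) * cis_inner (- y) \<xi> \<partial>lebesgue) = (\<integral>\<xi>. indicator W \<xi> * cis_inner (x - y) \<xi> \<partial>lebesgue)"
      by (intro Bochner_Integration.integral_cong refl) (simp add: cis_inner_diff cis_inner_minus)
    also have "\<dots> = (\<integral>\<xi>. indicator W \<xi> * cis_inner (x - y) \<xi> \<partial>lborel)"
      using borel_compact[OF W] by (intro integral_completion) simp
    finally show "of_real (1 / (2 * pi) ^ DIM('a)) * (?g y * (\<integral>\<xi>. (indicator W \<xi> * cis_inner x \<xi>) * cis_inner (- y) \<xi> \<partial>lebesgue))
        = band_kernel W (x - y) * ?g y"
      by (simp add: band_kernel_def)
  qed
  finally show ?thesis by (simp add: time_limit_def)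
qed

lemma band_kernel_mult_integrable:
  fixes W :: "'a::euclidean_space set"
  assumes W: "compact W" and g: "integrable lebesgue g"
  shows "integrable lebesgue (\<lambda>y. band_kernel W (x - y) * g y)"
proof (rule Bochner_Integration.integrable_bound)
  show "integrable lebesgue (\<lambda>y. of_real (measure lborel W / (2 * pi) ^ DIM('a)) * g y)"
    using g by (intro integrable_mult_right)
  have "(\<lambda>y. band_kernel W (x - y)) \<in> borel_measurable borel"
    using measurable_compose[OF _ band_kernel_measurable[OF W], of "\<lambda>y. x - y" borel] by simp
  then have [measurable]: "(\<lambda>y. band_kernel W (x - y)) \<in> borel_measurable lebesgue" by (rule borel_imp_lebesgue_measurable)
  have [measurable]: "g \<in> borel_measurable lebesgue" using g by auto
  show "(\<lambda>y. band_kernel W (x - y) * g y) \<in> borel_measurable lebesgue" by measurable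
  show "AE y in lebesgue. cmod (band_kernel W (x - y) * g y) \<le> cmod (of_real (measure lborel W / (2 * pi) ^ DIM('a)) * g y)"
  proof (intro AE_I2)
    fix y
    have "cmod (band_kernel W (x - y)) * cmod (g y) \<le> measure lborel W / (2 * pi) ^ DIM('a) * cmod (g y)"
      by (intro mult_right_mono band_kernel_bound W) simp
    then show "cmod (band_kernel W (x - y) * g y) \<le> cmod (of_real (measure lborel W / (2 * pi) ^ DIM('a)) * g y)"
      by (simp only: norm_mult norm_of_real) (simp add: abs_divide)
  qed
qed

text \<open>Before the final cut-off to A, the integral is Lipschitz in x, which gives
  measurability, and bounded; the cut-off has finite measure.\<close>

lemma time_band_limit_L2:
  fixes A W :: "'a::euclidean_space set"
  assumes A: "compact A" and W: "compact W" and f: "f \<in> L2"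
  shows "time_limit A (band_limit W (time_limit A f)) \<in> L2"
proof -
  have Ab: "A \<in> sets borel" "emeasure lborel A < \<infinity>" using borel_compact[OF A] emeasure_compact_finite[OF A] by auto
  let ?g = "\<lambda>y. indicator A y * f y"
  have g: "integrable lebesgue ?g" using f Ab by (rule L2_indicator_integrable)
  let ?G = "\<lambda>x. \<integral>y. band_kernel W (x - y) * ?g y \<partial>lebesgue"
  let ?n = "\<integral>y. cmod (?g y) \<partial>lebesgue" and ?k = "measure lborel W / (2 * pi) ^ DIM('a)"
  obtain L where L: "L \<ge> 0" "\<And>y z. cmod (band_kernel W y - band_kernel W z) \<le> L * norm (y - z)"
    using band_kernel_lipschitz[OF W] by metis
  note i = band_kernel_mult_integrable[OF W g]
  have "cmod (?G x - ?G x') \<le> (L * ?n) * norm (x - x')" for x x'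
  proof -
    have "cmod (?G x - ?G x') = cmod (\<integral>y. band_kernel W (x - y) * ?g y - band_kernel W (x' - y) * ?g y \<partial>lebesgue)"
      using i by (subst Bochner_Integration.integral_diff) auto
    also have "\<dots> \<le> (\<integral>y. (L * norm (x - x')) * cmod (?g y) \<partial>lebesgue)"
    proof (rule Bochner_Integration.integral_norm_bound_integral)
      show "integrable lebesgue (\<lambda>y. (L * norm (x - x')) * cmod (?g y))" using g by (intro integrable_mult_right integrable_norm)
      fix y
      have "cmod (band_kernel W (x - y) - band_kernel W (x' - y)) \<le> L * norm (x - x')"
        using L(2)[of "x - y" "x' - y"] by simp
      from mult_right_mono[OF this norm_ge_zero[of "?g y"]]
      show "cmod (band_kernel W (x - y) * ?g y - band_kernel W (x' - y) * ?g y) \<le> (L * norm (x - x')) * cmod (?g y)"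
        by (simp only: left_diff_distrib[symmetric] norm_mult)
    qed (use i in auto)
    also have "\<dots> = (L * norm (x - x')) * ?n" by (rule Bochner_Integration.integral_mult_right_zero)
    finally show ?thesis by (simp only: ac_simps)
  qed
  then have "(L * ?n)-lipschitz_on UNIV ?G"
    using L by (intro lipschitz_onI) (auto simp: dist_norm)
  then have "continuous_on UNIV ?G" by (rule lipschitz_on_continuous_on)
  then have [measurable]: "?G \<in> borel_measurable lebesgue"
    by (intro borel_imp_lebesgue_measurable borel_measurable_continuous_onI)
  have [measurable]: "A \<in> sets lebesgue" using Ab by simp
  have Gb: "cmod (?G x) \<le> ?k * ?n" for x
  proof -
    have "cmod (?G x) \<le> (\<integral>y. ?k * cmod (?g y) \<partial>lebesgue)"
    proof (rule Bochner_Integration.integral_norm_bound_integral[OF i])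
      show "integrable lebesgue (\<lambda>y. ?k * cmod (?g y))" using g by (intro integrable_mult_right integrable_norm)
      show "cmod (band_kernel W (x - y) * ?g y) \<le> ?k * cmod (?g y)" for y
        unfolding norm_mult[of "band_kernel W (x - y)"] by (intro mult_right_mono band_kernel_bound W) simp
    qed
    also have "\<dots> = ?k * ?n" by (rule Bochner_Integration.integral_mult_right_zero)
    finally show ?thesis .
  qed
  have "integrable lebesgue (\<lambda>x. (cmod (indicator A x * ?G x))\<^sup>2)"
  proof (rule Bochner_Integration.integrable_bound)
    show "integrable lebesgue (\<lambda>x. (?k * ?n)\<^sup>2 * indicator A x)"
      using Ab by (intro integrable_mult_right) (simp add: integrable_indicator_iff)
    show "AE x in lebesgue. norm ((cmod (indicator A x * ?G x))\<^sup>2) \<le> norm ((?k * ?n)\<^sup>2 * indicator A x)"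
    proof (intro AE_I2)
      fix x
      have "(cmod (?G x))\<^sup>2 \<le> (?k * ?n)\<^sup>2" using Gb by (intro power_mono) auto
      then show "norm ((cmod (indicator A x * ?G x))\<^sup>2) \<le> norm ((?k * ?n)\<^sup>2 * indicator A x)"
        by (cases "x \<in> A") simp_all
    qed
  qed measurable
  then show ?thesis
    unfolding L2_def mem_Collect_eq time_band_limit_kernel[OF A W f, abs_def] by simp
qed

section \<open>Discretisation\<close>

text \<open>The real basis 1, i of the complex numbers: every cell carries one real coordinate for
  each.\<close>

definition re_im_unit :: "bool \<Rightarrow> complex" where
  "re_im_unit b = (if b then \<i> else 1)"

lemma re_im_unit_sum: "(\<Sum>b\<in>UNIV. re_im_unit b * of_real (Re (cnj (re_im_unit b) * z))) = z"
  by (simp add: UNIV_bool re_im_unit_def complex_eq_iff)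

lemma Re_of_real_mult: "Re (of_real r * z) = r * Re z"
  by simp

lemma re_im_unit_inner: "Re (re_im_unit b * cnj (re_im_unit b')) = (if b = b' then 1 else 0)"
  by (simp add: re_im_unit_def)

lemma norm_re_im_unit[simp]: "cmod (re_im_unit b) = 1"
  by (simp add: re_im_unit_def)

text \<open>A partition of A into cells D with sample points p. The number \<kappa> bounds the error
  of replacing the kernel on a pair of cells by its sample.\<close>

locale discretisation =
  fixes A W :: "'a::euclidean_space set" and D :: "nat \<Rightarrow> 'a set" and p :: "nat \<Rightarrow> 'a" and N :: nat and \<kappa> :: real
  assumes A: "compact A" and W: "compact W"
    and D_borel: "\<And>i. D i \<in> sets borel" and D_disj: "\<And>i j. i \<noteq> j \<Longrightarrow> D i \<inter> D j = {}"
    and D_union: "(\<Union>i<N. D i) = A"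
    and close: "\<And>i j x y. i < N \<Longrightarrow> j < N \<Longrightarrow> x \<in> D i \<Longrightarrow> y \<in> D j \<Longrightarrow>
      cmod (band_kernel W (x - y) - band_kernel W (p i - p j)) \<le> \<kappa>"
    and \<kappa>0: "\<kappa> \<ge> 0"
begin

abbreviation K :: "'a \<Rightarrow> complex" where "K \<equiv> band_kernel W"

(* The functions cell (i, b) form an orthonormal system for the real inner product, and G is the
   matrix in this system of the integral operator with the sampled kernel K (p i - p j). Null cells
   are left out of the index set I. *)
definition m :: "nat \<Rightarrow> real" where "m i = measure lborel (D i)"
definition I :: "nat set" where "I = {i. i < N \<and> m i > 0}"
definition J :: "(nat \<times> bool) set" where "J = I \<times> UNIV"

lemma finite_IJ[simp]: "finite I" "finite J"
  by (auto simp: I_def J_def)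

lemma D_sub: "i < N \<Longrightarrow> D i \<subseteq> A" using D_union by auto

lemma D_finite: "i < N \<Longrightarrow> emeasure lborel (D i) < \<infinity>"
  using emeasure_mono[OF D_sub, of i lborel] borel_compact[OF A] emeasure_compact_finite[OF A]
  by (auto intro: le_less_trans)

lemma m_nonneg: "0 \<le> m i" by (simp add: m_def)

lemma sum_I_eq: "(\<Sum>i\<in>I. m i * f i) = (\<Sum>i<N. m i * f i)"
  by (intro sum.mono_neutral_left) (auto simp: I_def less_le m_nonneg)

lemma sum_m: "(\<Sum>i<N. m i) = measure lborel A"
proof -
  have "measure lborel (\<Union>i<N. D i) = (\<Sum>i<N. m i)"
    unfolding m_def using D_borel D_disj D_finite
    by (intro measure_finite_Union) (auto simp: disjoint_family_on_def less_top[symmetric])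
  then show ?thesis by (simp add: D_union)
qed

lemma indicator_sum: "(\<Sum>i<N. indicator (D i) x) = (indicator A x :: 'b::semiring_1)"
proof (cases "x \<in> A")
  case True
  then obtain i where i: "i < N" "x \<in> D i" using D_union by auto
  then have "indicator (D j) x = (if j = i then 1 else 0 :: 'b)" for j
    using D_disj[of j i] by (auto simp: indicator_def)
  then show ?thesis using i True by (simp add: sum.delta)
next
  case False
  then have "indicator (D i) x = (0 :: 'b)" if "i < N" for i using D_sub[OF that] by (auto simp: indicator_def)
  then show ?thesis using False by simp
qed

definition cell :: "nat \<times> bool \<Rightarrow> 'a \<Rightarrow> complex" where
  "cell j x = re_im_unit (snd j) * of_real (1 / sqrt (m (fst j))) * indicator (D (fst j)) x"

definition G :: "nat \<times> bool \<Rightarrow> nat \<times> bool \<Rightarrow> real" where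
  "G j j' = sqrt (m (fst j)) * sqrt (m (fst j')) *
     Re (re_im_unit (snd j') * cnj (re_im_unit (snd j)) * K (p (fst j) - p (fst j')))"

definition F :: "('a \<Rightarrow> complex) \<Rightarrow> nat \<Rightarrow> complex" where
  "F f i = (\<integral>y. indicator (D i) y * f y \<partial>lebesgue)"

lemma cell_L2: "j \<in> J \<Longrightarrow> cell j \<in> L2"
  unfolding cell_def[abs_def] using D_borel D_finite by (intro L2_cmult L2_indicator) (auto simp: J_def I_def)

lemma cell_orthonormal:
  assumes "j \<in> J" "j' \<in> J"
  shows "L2_inner (cell j) (cell j') = (if j = j' then 1 else 0)"
proof (cases "fst j = fst j'")
  case False
  then have "cell j x * cnj (cell j' x) = 0" for x
    using D_disj[OF False] by (auto simp: cell_def indicator_def)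
  then have "L2_inner (cell j) (cell j') = (\<integral>x. Re (0::complex) \<partial>(lebesgue :: 'a measure))" by (simp only: L2_inner_def)
  then show ?thesis using False by auto
next
  case True
  define i where "i = fst j"
  have i: "i < N" "m i > 0" using assms by (auto simp: J_def I_def i_def)
  have "L2_inner (cell j) (cell j') = (\<integral>x. (Re (re_im_unit (snd j) * cnj (re_im_unit (snd j'))) / m i) * indicator (D i) x \<partial>lebesgue)"
    unfolding L2_inner_def
  proof (intro Bochner_Integration.integral_cong refl)
    fix x
    have "cell j x * cnj (cell j' x) = of_real (1 / m i * indicator (D i) x) * (re_im_unit (snd j) * cnj (re_im_unit (snd j')))"
      using i True by (simp add: cell_def i_def[symmetric] indicator_def flip: of_real_mult)
    then show "Re (cell j x * cnj (cell j' x)) = (Re (re_im_unit (snd j) * cnj (re_im_unit (snd j'))) / m i) * indicator (D i) x"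
      by (simp only: Re_of_real_mult) simp
  qed
  also have "\<dots> = Re (re_im_unit (snd j) * cnj (re_im_unit (snd j')))"
    using i D_borel[of i] by (simp add: m_def[symmetric])
  also have "\<dots> = (if j = j' then 1 else 0)" unfolding re_im_unit_inner using True by (simp add: prod_eq_iff)
  finally show ?thesis .
qed

text \<open>The two real coefficients of f at a cell recombine to its complex integral over the
  cell, up to normalisation.\<close>

lemma inner_cell_sum:
  assumes f: "f \<in> L2" and i: "i \<in> I"
  shows "(\<Sum>b\<in>UNIV. re_im_unit b * of_real (L2_inner f (cell (i, b)))) = of_real (1 / sqrt (m i)) * F f i"
proof -
  have i': "i < N" "m i > 0" using i by (auto simp: I_def)
  have int: "integrable lebesgue (\<lambda>y. indicator (D i) y * f y)"
    using f D_borel D_finite[OF i'(1)] by (rule L2_indicator_integrable)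
  have "L2_inner f (cell (i, b)) = Re (cnj (re_im_unit b) * (of_real (1 / sqrt (m i)) * F f i))" for b
  proof -
    have "L2_inner f (cell (i, b)) = (\<integral>y. Re ((cnj (re_im_unit b) * of_real (1 / sqrt (m i))) * (indicator (D i) y * f y)) \<partial>lebesgue)"
      unfolding L2_inner_def cell_def by (intro Bochner_Integration.integral_cong refl) (simp add: indicator_def ac_simps)
    also have "\<dots> = Re (\<integral>y. (cnj (re_im_unit b) * of_real (1 / sqrt (m i))) * (indicator (D i) y * f y) \<partial>lebesgue)"
      using int by (intro integral_Re integrable_mult_right)
    also have "(\<integral>y. (cnj (re_im_unit b) * of_real (1 / sqrt (m i))) * (indicator (D i) y * f y) \<partial>lebesgue)
        = (cnj (re_im_unit b) * of_real (1 / sqrt (m i))) * F f i"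
      unfolding F_def by (rule Bochner_Integration.integral_mult_right_zero)
    finally show ?thesis by (simp only: mult.assoc)
  qed
  then show ?thesis by (simp only: re_im_unit_sum)
qed

lemma G_sym: "G j j' = G j' j"
proof -
  have "K (p (fst j') - p (fst j)) = cnj (K (p (fst j) - p (fst j')))"
    using band_kernel_minus[of W "p (fst j) - p (fst j')"] by simp
  then have "re_im_unit (snd j) * cnj (re_im_unit (snd j')) * K (p (fst j') - p (fst j)) =
      cnj (re_im_unit (snd j') * cnj (re_im_unit (snd j)) * K (p (fst j) - p (fst j')))"
    by (simp add: ac_simps)
  then have "Re (re_im_unit (snd j) * cnj (re_im_unit (snd j')) * K (p (fst j') - p (fst j))) =
      Re (re_im_unit (snd j') * cnj (re_im_unit (snd j)) * K (p (fst j) - p (fst j')))" by (simp only: cnj.sel)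
  then show ?thesis by (simp only: G_def mult.commute[of "sqrt (m (fst j))"])
qed

lemma G_apply:
  assumes f: "f \<in> L2"
  shows "(\<Sum>j\<in>J. G (i, b) j * L2_inner f (cell j)) =
    sqrt (m i) * Re (cnj (re_im_unit b) * (\<Sum>i'\<in>I. K (p i - p i') * F f i'))"
proof -
  have "(\<Sum>j\<in>J. G (i, b) j * L2_inner f (cell j)) =
      (\<Sum>i'\<in>I. \<Sum>b'\<in>UNIV. G (i, b) (i', b') * L2_inner f (cell (i', b')))"
    unfolding J_def by (simp add: sum.cartesian_product)
  also have "\<dots> = (\<Sum>i'\<in>I. sqrt (m i) * Re (cnj (re_im_unit b) * (K (p i - p i') * F f i')))"
  proof (intro sum.cong refl)
    fix i' assume i': "i' \<in> I"
    then have m': "m i' > 0" by (simp add: I_def)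
    let ?c = "cnj (re_im_unit b) * K (p i - p i')"
    have "(\<Sum>b'\<in>UNIV. G (i, b) (i', b') * L2_inner f (cell (i', b'))) =
        (\<Sum>b'\<in>UNIV. sqrt (m i) * sqrt (m i') * Re (?c * (re_im_unit b' * of_real (L2_inner f (cell (i', b'))))))"
      by (intro sum.cong refl) (simp add: G_def algebra_simps)
    also have "\<dots> = sqrt (m i) * sqrt (m i') * Re (?c * (\<Sum>b'\<in>UNIV. re_im_unit b' * of_real (L2_inner f (cell (i', b')))))"
      by (simp only: sum_distrib_left Re_sum)
    also have "\<dots> = sqrt (m i) * sqrt (m i') * Re (?c * (of_real (1 / sqrt (m i')) * F f i'))"
      by (simp only: inner_cell_sum[OF f i'])
    also have "?c * (of_real (1 / sqrt (m i')) * F f i') = of_real (1 / sqrt (m i')) * (cnj (re_im_unit b) * (K (p i - p i') * F f i'))"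
      by (simp only: ac_simps)
    also have "sqrt (m i) * sqrt (m i') * Re (of_real (1 / sqrt (m i')) * (cnj (re_im_unit b) * (K (p i - p i') * F f i'))) =
        sqrt (m i) * Re (cnj (re_im_unit b) * (K (p i - p i') * F f i'))"
      using m' by (simp only: Re_of_real_mult) simp
    finally show "(\<Sum>b'\<in>UNIV. G (i, b) (i', b') * L2_inner f (cell (i', b'))) =
        sqrt (m i) * Re (cnj (re_im_unit b) * (K (p i - p i') * F f i'))" .
  qed
  also have "\<dots> = sqrt (m i) * Re (cnj (re_im_unit b) * (\<Sum>i'\<in>I. K (p i - p i') * F f i'))"
    by (simp only: sum_distrib_left Re_sum)
  finally show ?thesis .
qed

text \<open>The real matrix G acts as the complex sampled kernel: the factor sqrt (m i) from G
  cancels against the normalisation of the cell, and the two real components recombine.\<close>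

lemma cell_expansion:
  assumes f: "f \<in> L2" and i: "i \<in> I" and x: "x \<in> D i"
  shows "(\<Sum>j\<in>J. cell j x * of_real (\<Sum>j'\<in>J. G j j' * L2_inner f (cell j'))) = (\<Sum>i'\<in>I. K (p i - p i') * F f i')"
proof -
  let ?S = "\<Sum>i'\<in>I. K (p i - p i') * F f i'"
  have m: "m i > 0" using i by (simp add: I_def)
  have "(\<Sum>j\<in>J. cell j x * of_real (\<Sum>j'\<in>J. G j j' * L2_inner f (cell j'))) =
      (\<Sum>i1\<in>I. \<Sum>b\<in>UNIV. cell (i1, b) x * of_real (\<Sum>j'\<in>J. G (i1, b) j' * L2_inner f (cell j')))"
    unfolding J_def by (simp add: sum.cartesian_product)
  also have "\<dots> = (\<Sum>i1\<in>I. if i1 = i then \<Sum>b\<in>UNIV. cell (i, b) x * of_real (\<Sum>j'\<in>J. G (i, b) j' * L2_inner f (cell j')) else 0)"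
  proof (intro sum.cong refl)
    fix i1 assume "i1 \<in> I"
    have "cell (i1, b) x = 0" if "i1 \<noteq> i" for b
      using D_disj[OF that] x by (auto simp: cell_def indicator_def)
    then show "(\<Sum>b\<in>UNIV. cell (i1, b) x * of_real (\<Sum>j'\<in>J. G (i1, b) j' * L2_inner f (cell j'))) =
        (if i1 = i then \<Sum>b\<in>UNIV. cell (i, b) x * of_real (\<Sum>j'\<in>J. G (i, b) j' * L2_inner f (cell j')) else 0)"
      by simp
  qed
  also have "\<dots> = (\<Sum>b\<in>UNIV. cell (i, b) x * of_real (\<Sum>j'\<in>J. G (i, b) j' * L2_inner f (cell j')))"
    using i by (simp add: sum.delta)
  also have "\<dots> = (\<Sum>b\<in>UNIV. re_im_unit b * of_real (Re (cnj (re_im_unit b) * ?S)))"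
  proof (intro sum.cong refl)
    fix b
    have "cell (i, b) x * of_real (sqrt (m i) * r) = re_im_unit b * of_real r" for r
      using m x by (simp add: cell_def)
    then show "cell (i, b) x * of_real (\<Sum>j'\<in>J. G (i, b) j' * L2_inner f (cell j')) = re_im_unit b * of_real (Re (cnj (re_im_unit b) * ?S))"
      by (simp only: G_apply[OF f])
  qed
  finally show ?thesis by (simp only: re_im_unit_sum)
qed

lemma kernel_sum_error:
  assumes f: "f \<in> L2" and i: "i < N" and x: "x \<in> D i"
  shows "cmod ((\<integral>y. K (x - y) * (indicator A y * f y) \<partial>lebesgue) - (\<Sum>i'\<in>I. K (p i - p i') * F f i'))
    \<le> \<kappa> * (sqrt (measure lborel A) * L2_norm f)"
proof -
  have int: "integrable lebesgue (\<lambda>y. indicator (D j) y * f y)" if "j < N" for j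
    using f D_borel D_finite[OF that] by (rule L2_indicator_integrable)
  have intA: "integrable lebesgue (\<lambda>y. indicator A y * f y)"
    using f borel_compact[OF A] emeasure_compact_finite[OF A] by (rule L2_indicator_integrable)
  \<comment> \<open>Null cells have integral 0, so the sum over I may be extended to the full
    partition of A.\<close>
  have F0: "F f j = 0" if "j < N" "j \<notin> I" for j
  proof -
    have "m j = 0" using that m_nonneg[of j] by (auto simp: I_def)
    then have "emeasure lborel (D j) = 0"
      using D_finite[OF that(1)] by (auto simp: m_def measure_def enn2real_eq_0_iff)
    then have "D j \<in> null_sets lebesgue" using D_borel[of j] by (auto simp: null_sets_def)
    then have "AE y in lebesgue. y \<notin> D j" by (rule AE_not_in)
    then have "AE y in lebesgue. indicator (D j) y * f y = 0" by eventually_elim simp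
    then show ?thesis unfolding F_def by (rule integral_eq_zero_AE)
  qed
  have "(\<Sum>i'\<in>I. K (p i - p i') * F f i') = (\<Sum>j<N. K (p i - p j) * F f j)"
    using F0 by (intro sum.mono_neutral_left) (auto simp: I_def)
  also have "\<dots> = (\<Sum>j<N. \<integral>y. K (p i - p j) * (indicator (D j) y * f y) \<partial>lebesgue)"
    unfolding F_def by (simp only: Bochner_Integration.integral_mult_right_zero)
  also have "\<dots> = (\<integral>y. (\<Sum>j<N. K (p i - p j) * (indicator (D j) y * f y)) \<partial>lebesgue)"
    using int by (subst Bochner_Integration.integral_sum) auto
  finally have S: "(\<Sum>i'\<in>I. K (p i - p i') * F f i') = (\<integral>y. (\<Sum>j<N. K (p i - p j) * (indicator (D j) y * f y)) \<partial>lebesgue)" .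
  have ints: "integrable lebesgue (\<lambda>y. \<Sum>j<N. K (p i - p j) * (indicator (D j) y * f y))"
    using int by (intro Bochner_Integration.integrable_sum integrable_mult_right) auto
  have intK: "integrable lebesgue (\<lambda>y. K (x - y) * (indicator A y * f y))"
    by (rule band_kernel_mult_integrable[OF W intA])
  have "cmod ((\<integral>y. K (x - y) * (indicator A y * f y) \<partial>lebesgue) - (\<Sum>i'\<in>I. K (p i - p i') * F f i')) =
      cmod (\<integral>y. K (x - y) * (indicator A y * f y) - (\<Sum>j<N. K (p i - p j) * (indicator (D j) y * f y)) \<partial>lebesgue)"
    unfolding S using intK ints by (subst Bochner_Integration.integral_diff) auto
  also have "\<dots> \<le> (\<integral>y. \<kappa> * cmod (indicator A y * f y) \<partial>lebesgue)"
  proof (rule Bochner_Integration.integral_norm_bound_integral)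
    show "integrable lebesgue (\<lambda>y. K (x - y) * (indicator A y * f y) - (\<Sum>j<N. K (p i - p j) * (indicator (D j) y * f y)))"
      using intK ints by (rule Bochner_Integration.integrable_diff)
    show "integrable lebesgue (\<lambda>y. \<kappa> * cmod (indicator A y * f y))" using intA by (intro integrable_mult_right integrable_norm)
    fix y
    have "K (x - y) * (indicator A y * f y) - (\<Sum>j<N. K (p i - p j) * (indicator (D j) y * f y)) =
        (\<Sum>j<N. ((K (x - y) - K (p i - p j)) * f y) * indicator (D j) y)"
      unfolding indicator_sum[symmetric, of y] sum_distrib_right sum_distrib_left sum_subtractf[symmetric]
      by (intro sum.cong refl) (simp add: algebra_simps)
    also have "cmod \<dots> \<le> (\<Sum>j<N. \<kappa> * cmod (f y) * indicator (D j) y)"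
    proof (rule sum_norm_le)
      fix j assume "j \<in> {..<N}"
      then show "cmod (((K (x - y) - K (p i - p j)) * f y) * indicator (D j) y) \<le> \<kappa> * cmod (f y) * indicator (D j) y"
        using close[OF i _ x, of j y] by (cases "y \<in> D j") (auto simp: norm_mult intro!: mult_right_mono)
    qed
    also have "\<dots> = \<kappa> * cmod (f y) * indicator A y" by (simp only: sum_distrib_left[symmetric] indicator_sum)
    also have "\<dots> = \<kappa> * cmod (indicator A y * f y)" by (simp add: norm_mult indicator_def)
    finally show "cmod (K (x - y) * (indicator A y * f y) - (\<Sum>j<N. K (p i - p j) * (indicator (D j) y * f y))) \<le> \<kappa> * cmod (indicator A y * f y)" .
  qed
  also have "\<dots> = \<kappa> * (\<integral>y. cmod (indicator A y * f y) \<partial>lebesgue)" by (rule Bochner_Integration.integral_mult_right_zero)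
  also have "\<dots> \<le> \<kappa> * (sqrt (measure lborel A) * L2_norm f)"
    using \<kappa>0 f borel_compact[OF A] emeasure_compact_finite[OF A] by (intro mult_left_mono L2_norm1_bound) auto
  finally show ?thesis .
qed

text \<open>Sampling costs \<kappa> times the integral of |f| over A at almost every point of A.
  Cauchy-Schwarz contributes sqrt |A| for that integral, and taking the norm over A contributes
  another.\<close>

lemma operator_error:
  assumes f: "f \<in> L2" and h: "h \<in> L2"
    and heq: "\<And>x. h x = (\<Sum>j\<in>J. cell j x * of_real (\<Sum>j'\<in>J. G j j' * L2_inner f (cell j')))"
  shows "L2_dist (time_limit A (band_limit W (time_limit A f))) h \<le> \<kappa> * measure lborel A * L2_norm f"
proof -
  let ?T = "time_limit A (band_limit W (time_limit A f))"
  let ?C = "\<kappa> * (sqrt (measure lborel A) * L2_norm f)"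
  have C: "?C \<ge> 0" using \<kappa>0 by simp
  have T: "?T \<in> L2" using A W f by (rule time_band_limit_L2)
  \<comment> \<open>On null cells h vanishes and the pointwise estimate may fail; they are removed
    as a null set.\<close>
  have null: "AE x in lebesgue. \<forall>i\<in>{..<N} - I. x \<notin> D i"
  proof (rule AE_finite_allI)
    fix i assume i: "i \<in> {..<N} - I"
    then have "m i = 0" using m_nonneg[of i] by (auto simp: I_def)
    then have "emeasure lborel (D i) = 0"
      using D_finite[of i] i by (auto simp: m_def measure_def enn2real_eq_0_iff)
    then have "D i \<in> null_sets lebesgue" using D_borel[of i] by (auto simp: null_sets_def)
    then show "AE x in lebesgue. x \<notin> D i" by (rule AE_not_in)
  qed simp
  have "AE x in lebesgue. cmod (?T x - h x) \<le> ?C * indicator A x"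
    using null
  proof eventually_elim
    case (elim x)
    show ?case
    proof (cases "x \<in> A")
      case False
      then have "x \<notin> D i" if "i < N" for i using D_sub[OF that] by auto
      then have "cell j x = 0" if "j \<in> J" for j using that by (auto simp: cell_def J_def I_def)
      then have "h x = 0" unfolding heq by simp
      then show ?thesis using False by (simp add: time_band_limit_kernel[OF A W f])
    next
      case True
      then obtain i where i: "i < N" "x \<in> D i" using D_union by auto
      then have "i \<in> I" using elim by auto
      then have "h x = (\<Sum>i'\<in>I. K (p i - p i') * F f i')" unfolding heq using f i by (intro cell_expansion)
      then show ?thesis using kernel_sum_error[OF f i] True by (simp add: time_band_limit_kernel[OF A W f])
    qed
  qed
  then have "L2_norm (\<lambda>x. ?T x - h x) \<le> ?C * sqrt (measure lborel A)"
    using T h C borel_compact[OF A] emeasure_compact_finite[OF A] by (intro L2_norm_bounded_support L2_diff) auto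
  also have "\<dots> = \<kappa> * measure lborel A * L2_norm f"
    using real_sqrt_mult_self[of "measure lborel A"] by (simp add: ac_simps)
  finally show ?thesis by (simp add: L2_dist_def)
qed

end

section \<open>Quadratic forms of sampled kernels\<close>

text \<open>Expanding the square gives the transform of w at differences of points. For w the
  indicator of W this is the band kernel, for w Gaussian the function \<open>gauss\<close>.\<close>

lemma integral_trig_square:
  fixes q :: "'i \<Rightarrow> 'a::euclidean_space" and w :: "'a \<Rightarrow> real"
  assumes S: "finite S" and w: "integrable lborel w"
  shows "integrable lborel (\<lambda>\<xi>. w \<xi> * (cmod (\<Sum>i\<in>S. a i * cis_inner (q i) \<xi>))\<^sup>2)"
    and "of_real (\<integral>\<xi>. w \<xi> * (cmod (\<Sum>i\<in>S. a i * cis_inner (q i) \<xi>))\<^sup>2 \<partial>lborel) =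
      (\<Sum>i\<in>S. \<Sum>j\<in>S. a i * cnj (a j) * (\<integral>\<xi>. of_real (w \<xi>) * cis_inner (q i - q j) \<xi> \<partial>lborel))"
proof -
  let ?T = "\<lambda>\<xi>. \<Sum>i\<in>S. a i * cis_inner (q i) \<xi>"
  let ?t = "\<lambda>i j \<xi>. a i * cnj (a j) * (of_real (w \<xi>) * cis_inner (q i - q j) \<xi>)"
  have e: "complex_of_real (w \<xi> * (cmod (?T \<xi>))\<^sup>2) = (\<Sum>i\<in>S. \<Sum>j\<in>S. ?t i j \<xi>)" for \<xi>
  proof -
    have "complex_of_real ((cmod (?T \<xi>))\<^sup>2) = ?T \<xi> * cnj (?T \<xi>)" by (rule complex_norm_square)
    also have "\<dots> = (\<Sum>i\<in>S. \<Sum>j\<in>S. (a i * cis_inner (q i) \<xi>) * cnj (a j * cis_inner (q j) \<xi>))"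
      by (simp only: cnj_sum sum_product)
    finally show ?thesis
      by (simp add: sum_distrib_left cis_inner_diff ac_simps)
  qed
  have i1: "integrable lborel (?t i j)" for i j
    using w by (intro integrable_mult_right integrable_mult_cis) auto
  have i2: "integrable lborel (\<lambda>\<xi>. \<Sum>j\<in>S. ?t i j \<xi>)" for i using i1 by (intro Bochner_Integration.integrable_sum)
  have i3: "integrable lborel (\<lambda>\<xi>. \<Sum>i\<in>S. \<Sum>j\<in>S. ?t i j \<xi>)" by (rule Bochner_Integration.integrable_sum) (rule i2)
  then have "integrable lborel (\<lambda>\<xi>. Re (complex_of_real (w \<xi> * (cmod (?T \<xi>))\<^sup>2)))" unfolding e by (rule integrable_Re)
  then show "integrable lborel (\<lambda>\<xi>. w \<xi> * (cmod (?T \<xi>))\<^sup>2)" by (simp only: Re_complex_of_real)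
  have "complex_of_real (\<integral>\<xi>. w \<xi> * (cmod (?T \<xi>))\<^sup>2 \<partial>lborel) = (\<integral>\<xi>. (\<Sum>i\<in>S. \<Sum>j\<in>S. ?t i j \<xi>) \<partial>lborel)"
    unfolding e[symmetric] by (rule integral_complex_of_real[symmetric])
  also have "\<dots> = (\<Sum>i\<in>S. \<integral>\<xi>. (\<Sum>j\<in>S. ?t i j \<xi>) \<partial>lborel)" using i2 by (intro Bochner_Integration.integral_sum)
  also have "\<dots> = (\<Sum>i\<in>S. \<Sum>j\<in>S. \<integral>\<xi>. ?t i j \<xi> \<partial>lborel)" using i1 by (intro sum.cong refl Bochner_Integration.integral_sum)
  also have "\<dots> = (\<Sum>i\<in>S. \<Sum>j\<in>S. a i * cnj (a j) * (\<integral>\<xi>. of_real (w \<xi>) * cis_inner (q i - q j) \<xi> \<partial>lborel))"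
    by (simp only: Bochner_Integration.integral_mult_right_zero)
  finally show "complex_of_real (\<integral>\<xi>. w \<xi> * (cmod (?T \<xi>))\<^sup>2 \<partial>lborel) =
      (\<Sum>i\<in>S. \<Sum>j\<in>S. a i * cnj (a j) * (\<integral>\<xi>. of_real (w \<xi>) * cis_inner (q i - q j) \<xi> \<partial>lborel))" .
qed

text \<open>The positive definiteness of a Fourier transform of a nonnegative function, in a form
  that exhibits the sign.\<close>

lemma band_kernel_form:
  fixes q :: "'i \<Rightarrow> 'a::euclidean_space" and W :: "'a set"
  assumes S: "finite S" and W: "compact W"
  shows "(\<Sum>i\<in>S. \<Sum>j\<in>S. a i * cnj (a j) * band_kernel W (q i - q j)) =
    of_real (1 / (2 * pi) ^ DIM('a) * (\<integral>\<xi>. indicator W \<xi> * (cmod (\<Sum>i\<in>S. a i * cis_inner (q i) \<xi>))\<^sup>2 \<partial>lborel))"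
proof -
  have ind: "complex_of_real (indicator W \<xi>) = indicator W \<xi>" for \<xi> :: 'a by (simp add: indicator_def)
  show ?thesis
    unfolding of_real_mult integral_trig_square(2)[OF S compact_integrable_indicator(1)[OF W]] ind
    by (simp add: band_kernel_def sum_distrib_left sum_divide_distrib)
qed

text \<open>On W the Gaussian exp (- s^2 |\<xi>|^2 / 2) times exp (s^2 R^2 / 2) is at least 1.
  Replacing the indicator by this product makes the integral over frequencies explicit, at the price
  of a factor that tends to 1 with s.\<close>

lemma gauss_form_bound:
  fixes q :: "'i \<Rightarrow> 'a::euclidean_space" and W :: "'a set"
  assumes S: "finite S" and W: "compact W" and s: "s > 0" and R: "\<And>\<xi>. \<xi> \<in> W \<Longrightarrow> norm \<xi> \<le> R"
  shows "1 / (2 * pi) ^ DIM('a) * (\<integral>\<xi>. indicator W \<xi> * (cmod (\<Sum>i\<in>S. a i * cis_inner (q i) \<xi>))\<^sup>2 \<partial>lborel)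
    \<le> exp (s\<^sup>2 * R\<^sup>2 / 2) * (\<Sum>i\<in>S. \<Sum>j\<in>S. cmod (a i) * cmod (a j) * gauss s (q i - q j))"
proof -
  let ?T = "\<lambda>\<xi>. (cmod (\<Sum>i\<in>S. a i * cis_inner (q i) \<xi>))\<^sup>2"
  let ?h = "\<lambda>\<xi>::'a. exp (- s\<^sup>2 * (norm \<xi>)\<^sup>2 / 2)"
  have hi: "integrable lborel ?h"
  proof -
    have "integrable lborel (\<lambda>z::'a. Re (of_real (exp (- s\<^sup>2 * (norm z)\<^sup>2 / 2)) * cis_inner 0 z))"
      using gaussian_fourier[OF s, of "0::'a"] by (intro integrable_Re) (simp add: has_bochner_integral_iff)
    then show ?thesis by simp
  qed
  have "(\<integral>\<xi>. indicator W \<xi> * ?T \<xi> \<partial>lborel) \<le> (\<integral>\<xi>. exp (s\<^sup>2 * R\<^sup>2 / 2) * (?h \<xi> * ?T \<xi>) \<partial>lborel)"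
  proof (rule integral_mono)
    show "integrable lborel (\<lambda>\<xi>. indicator W \<xi> * ?T \<xi>)"
      by (rule integral_trig_square(1)[OF S compact_integrable_indicator(1)[OF W]])
    show "integrable lborel (\<lambda>\<xi>. exp (s\<^sup>2 * R\<^sup>2 / 2) * (?h \<xi> * ?T \<xi>))"
      by (intro integrable_mult_right integral_trig_square(1)[OF S hi])
    fix \<xi> :: 'a
    have "1 \<le> exp (s\<^sup>2 * R\<^sup>2 / 2) * ?h \<xi>" if "\<xi> \<in> W"
    proof -
      have "(norm \<xi>)\<^sup>2 \<le> R\<^sup>2" using R[OF that] by (intro power_mono) auto
      then have "s\<^sup>2 * (norm \<xi>)\<^sup>2 \<le> s\<^sup>2 * R\<^sup>2" by (intro mult_left_mono) auto
      then show ?thesis by (simp flip: exp_add)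
    qed
    then have "indicator W \<xi> \<le> exp (s\<^sup>2 * R\<^sup>2 / 2) * ?h \<xi>" by (cases "\<xi> \<in> W") auto
    from mult_right_mono[OF this, of "?T \<xi>"]
    show "indicator W \<xi> * ?T \<xi> \<le> exp (s\<^sup>2 * R\<^sup>2 / 2) * (?h \<xi> * ?T \<xi>)" by (simp only: mult.assoc zero_le_power2 simp_thms)
  qed
  also have "\<dots> = exp (s\<^sup>2 * R\<^sup>2 / 2) * (\<integral>\<xi>. ?h \<xi> * ?T \<xi> \<partial>lborel)" by (rule Bochner_Integration.integral_mult_right_zero)
  also have "(\<integral>\<xi>. ?h \<xi> * ?T \<xi> \<partial>lborel) \<le> (2 * pi) ^ DIM('a) * (\<Sum>i\<in>S. \<Sum>j\<in>S. cmod (a i) * cmod (a j) * gauss s (q i - q j))"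
  proof -
    have v: "(\<integral>\<xi>. of_real (?h \<xi>) * cis_inner z \<xi> \<partial>lborel) = of_real ((2 * pi) ^ DIM('a) * gauss s z)" for z
      using gaussian_fourier[OF s] by (rule has_bochner_integral_integral_eq)
    have "(\<integral>\<xi>. ?h \<xi> * ?T \<xi> \<partial>lborel) \<le> cmod (of_real (\<integral>\<xi>. ?h \<xi> * ?T \<xi> \<partial>lborel))" by simp
    also have "of_real (\<integral>\<xi>. ?h \<xi> * ?T \<xi> \<partial>lborel) = (\<Sum>i\<in>S. \<Sum>j\<in>S. a i * cnj (a j) * of_real ((2 * pi) ^ DIM('a) * gauss s (q i - q j)))"
      unfolding integral_trig_square(2)[OF S hi] v ..
    also have "cmod \<dots> \<le> (\<Sum>i\<in>S. \<Sum>j\<in>S. cmod (a i) * cmod (a j) * ((2 * pi) ^ DIM('a) * gauss s (q i - q j)))"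
    proof (intro sum_norm_le)
      fix i j
      have "cmod (of_real ((2 * pi) ^ DIM('a) * gauss s (q i - q j))) = (2 * pi) ^ DIM('a) * gauss s (q i - q j)"
        unfolding norm_of_real using gauss_nonneg[OF s, of "q i - q j"] by (intro abs_of_nonneg) simp
      then show "cmod (a i * cnj (a j) * of_real ((2 * pi) ^ DIM('a) * gauss s (q i - q j))) \<le> cmod (a i) * cmod (a j) * ((2 * pi) ^ DIM('a) * gauss s (q i - q j))"
        by (simp only: norm_mult complex_mod_cnj)
    qed
    also have "\<dots> = (2 * pi) ^ DIM('a) * (\<Sum>i\<in>S. \<Sum>j\<in>S. cmod (a i) * cmod (a j) * gauss s (q i - q j))"
      by (simp only: sum_distrib_left ac_simps)
    finally show ?thesis .
  qed
  finally have "(\<integral>\<xi>. indicator W \<xi> * ?T \<xi> \<partial>lborel) \<le> exp (s\<^sup>2 * R\<^sup>2 / 2) * ((2 * pi) ^ DIM('a) *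
      (\<Sum>i\<in>S. \<Sum>j\<in>S. cmod (a i) * cmod (a j) * gauss s (q i - q j)))" by simp
  then have "1 / (2 * pi) ^ DIM('a) * (\<integral>\<xi>. indicator W \<xi> * ?T \<xi> \<partial>lborel) \<le> 1 / (2 * pi) ^ DIM('a) *
     (exp (s\<^sup>2 * R\<^sup>2 / 2) * ((2 * pi) ^ DIM('a) * (\<Sum>i\<in>S. \<Sum>j\<in>S. cmod (a i) * cmod (a j) * gauss s (q i - q j))))"
    by (intro mult_left_mono) auto
  then show ?thesis by simp
qed

text \<open>The Schur test: the arithmetic-geometric mean inequality, with weights chosen so that
  the row sums of m j g i j appear.\<close>

lemma weighted_schur_bound:
  fixes g :: "'i \<Rightarrow> 'i \<Rightarrow> real"
  assumes S: "finite S" and m: "\<And>i. i \<in> S \<Longrightarrow> 0 \<le> m i" and g: "\<And>i j. i \<in> S \<Longrightarrow> j \<in> S \<Longrightarrow> 0 \<le> g i j \<and> g i j = g j i"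
    and B: "\<And>i. i \<in> S \<Longrightarrow> (\<Sum>j\<in>S. m j * g i j) \<le> B"
  shows "(\<Sum>i\<in>S. \<Sum>j\<in>S. (sqrt (m i) * c i) * (sqrt (m j) * c j) * g i j) \<le> B * (\<Sum>i\<in>S. (c i)\<^sup>2)"
proof -
  have "(\<Sum>i\<in>S. \<Sum>j\<in>S. (sqrt (m i) * c i) * (sqrt (m j) * c j) * g i j) \<le>
      (\<Sum>i\<in>S. \<Sum>j\<in>S. (c i)\<^sup>2 / 2 * (m j * g i j) + (c j)\<^sup>2 / 2 * (m i * g j i))"
  proof (intro sum_mono)
    fix i j assume ij: "i \<in> S" "j \<in> S"
    have "2 * ((sqrt (m j) * c i) * (sqrt (m i) * c j)) \<le> (sqrt (m j) * c i)\<^sup>2 + (sqrt (m i) * c j)\<^sup>2"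
      using sum_squares_bound[of "sqrt (m j) * c i" "sqrt (m i) * c j"] by (simp only: mult.assoc)
    then have "(sqrt (m i) * c i) * (sqrt (m j) * c j) \<le> m j * (c i)\<^sup>2 / 2 + m i * (c j)\<^sup>2 / 2"
      using m[OF ij(1)] m[OF ij(2)] by (simp add: power_mult_distrib ac_simps)
    then have "(sqrt (m i) * c i) * (sqrt (m j) * c j) * g i j \<le> (m j * (c i)\<^sup>2 / 2 + m i * (c j)\<^sup>2 / 2) * g i j"
      using g[OF ij] by (intro mult_right_mono) auto
    also have "\<dots> = (c i)\<^sup>2 / 2 * (m j * g i j) + (c j)\<^sup>2 / 2 * (m i * g j i)"
      using g[OF ij] by (simp add: algebra_simps)
    finally show "(sqrt (m i) * c i) * (sqrt (m j) * c j) * g i j \<le> (c i)\<^sup>2 / 2 * (m j * g i j) + (c j)\<^sup>2 / 2 * (m i * g j i)" .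
  qed
  also have "\<dots> = (\<Sum>i\<in>S. (c i)\<^sup>2 / 2 * (\<Sum>j\<in>S. m j * g i j)) + (\<Sum>j\<in>S. (c j)\<^sup>2 / 2 * (\<Sum>i\<in>S. m i * g j i))"
  proof -
    have "(\<Sum>i\<in>S. \<Sum>j\<in>S. (c j)\<^sup>2 / 2 * (m i * g j i)) = (\<Sum>j\<in>S. (c j)\<^sup>2 / 2 * (\<Sum>i\<in>S. m i * g j i))"
      by (subst sum.swap) (simp only: sum_distrib_left)
    then show ?thesis by (simp only: sum.distrib sum_distrib_left)
  qed
  also have "\<dots> \<le> (\<Sum>i\<in>S. (c i)\<^sup>2 / 2 * B) + (\<Sum>j\<in>S. (c j)\<^sup>2 / 2 * B)"
    using B by (intro add_mono sum_mono mult_left_mono) auto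
  also have "\<dots> = B * (\<Sum>i\<in>S. (c i)\<^sup>2)"
    by (simp add: sum.distrib[symmetric] sum_distrib_left mult.commute)
  finally show ?thesis .
qed

section \<open>Spectrum of the discretised operator\<close>

context discretisation
begin

text \<open>The eigenvectors of G become functions through the orthonormal cells. The last
  conclusion presents each eigenvalue as a value of the quadratic form at a unit vector, ready for
  the bounds on that form.\<close>

lemma spectral:
  obtains u \<mu> where "L2_orthonormal (card J) u"
    "\<And>f x. f \<in> L2 \<Longrightarrow> L2_combination (card J) u (\<lambda>k. \<mu> k * L2_inner f (u k)) x =
       (\<Sum>j\<in>J. cell j x * of_real (\<Sum>j'\<in>J. G j j' * L2_inner f (cell j')))"
    "(\<Sum>k<card J. \<mu> k) = (\<Sum>j\<in>J. G j j)"
    "(\<Sum>k<card J. (\<mu> k)\<^sup>2) = (\<Sum>j\<in>J. \<Sum>j'\<in>J. (G j j')\<^sup>2)"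
    "\<And>k. k < card J \<Longrightarrow> \<exists>c. (\<Sum>j\<in>J. (c j)\<^sup>2) = 1 \<and> \<mu> k = (\<Sum>j\<in>J. \<Sum>j'\<in>J. G j j' * c j * c j')"
proof -
  let ?n = "card J"
  obtain v \<mu> where v: "fin_orthonormal J ?n v"
    and dec: "\<And>i j. i \<in> J \<Longrightarrow> j \<in> J \<Longrightarrow> G i j = (\<Sum>k<?n. \<mu> k * v k i * v k j)"
    and \<mu>: "\<And>k. k < ?n \<Longrightarrow> \<mu> k = (\<Sum>i\<in>J. \<Sum>j\<in>J. G i j * v k i * v k j)"
    using symmetric_spectral_decomposition[where g = G, OF finite_IJ(2) G_sym] by blast
  have vv: "(\<Sum>j\<in>J. v k j * v l j) = (if k = l then 1 else 0)" if "k < ?n" "l < ?n" for k l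
    using v that by (auto simp: fin_orthonormal_def)
  define u where "u = (\<lambda>k x. \<Sum>j\<in>J. of_real (v k j) * cell j x)"
  have uL: "u k \<in> L2" for k unfolding u_def by (intro L2_sum L2_cmult cell_L2)
  have uf: "L2_inner (u k) f = (\<Sum>j\<in>J. v k j * L2_inner f (cell j))" if "f \<in> L2" for k f
    unfolding u_def using that
    by (subst L2_inner_sum_left) (simp_all add: L2_cmult cell_L2 L2_inner_scale_left L2_inner_commute[of f])
  have cu: "L2_inner (u l) (cell j) = v l j" if "j \<in> J" for l j
  proof -
    have "L2_inner (u l) (cell j) = (\<Sum>j'\<in>J. v l j' * (if j = j' then 1 else 0))"
      using that by (subst uf[OF cell_L2]) (simp_all add: cell_orthonormal)
    also have "\<dots> = v l j" using that by (simp add: if_distrib[of "\<lambda>x. _ * x"] sum.delta' cong: if_cong)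
    finally show ?thesis .
  qed
  have o: "L2_orthonormal ?n u"
    unfolding L2_orthonormal_def using uL vv by (auto simp: uf[OF uL] cu)
  have comb: "L2_combination ?n u (\<lambda>k. \<mu> k * L2_inner f (u k)) x =
       (\<Sum>j\<in>J. cell j x * of_real (\<Sum>j'\<in>J. G j j' * L2_inner f (cell j')))" if f: "f \<in> L2" for f x
  proof -
    have "(\<Sum>j\<in>J. cell j x * of_real (\<Sum>j'\<in>J. G j j' * L2_inner f (cell j'))) =
        (\<Sum>j\<in>J. cell j x * of_real (\<Sum>j'\<in>J. (\<Sum>k<?n. \<mu> k * v k j * v k j') * L2_inner f (cell j')))"
      using dec by (intro sum.cong refl arg_cong2[of _ _ _ _ "(*)"] arg_cong[of _ _ of_real]) auto
    also have "\<dots> = (\<Sum>j\<in>J. \<Sum>k<?n. cell j x * of_real (\<mu> k * v k j * L2_inner f (u k)))"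
    proof (intro sum.cong refl)
      fix j
      have "(\<Sum>j'\<in>J. (\<Sum>k<?n. \<mu> k * v k j * v k j') * L2_inner f (cell j')) =
          (\<Sum>k<?n. \<Sum>j'\<in>J. \<mu> k * v k j * v k j' * L2_inner f (cell j'))"
        by (simp only: sum_distrib_right) (rule sum.swap)
      also have "\<dots> = (\<Sum>k<?n. \<mu> k * v k j * L2_inner f (u k))"
        by (simp only: L2_inner_commute[of f "u _"] uf[OF f] sum_distrib_left mult.assoc)
      finally show "cell j x * of_real (\<Sum>j'\<in>J. (\<Sum>k<?n. \<mu> k * v k j * v k j') * L2_inner f (cell j')) =
          (\<Sum>k<?n. cell j x * of_real (\<mu> k * v k j * L2_inner f (u k)))"
        by (simp only: of_real_sum sum_distrib_left)
    qed
    also have "\<dots> = (\<Sum>k<?n. \<Sum>j\<in>J. cell j x * of_real (\<mu> k * v k j * L2_inner f (u k)))"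
      by (rule sum.swap)
    also have "\<dots> = (\<Sum>k<?n. of_real (\<mu> k * L2_inner f (u k)) * u k x)"
      unfolding u_def sum_distrib_left by (intro sum.cong refl) (simp add: ac_simps)
    finally show ?thesis by (simp only: L2_combination_def)
  qed
  have trace: "(\<Sum>j\<in>J. G j j) = (\<Sum>k<?n. \<mu> k)"
  proof -
    have "(\<Sum>j\<in>J. G j j) = (\<Sum>j\<in>J. \<Sum>k<?n. \<mu> k * v k j * v k j)" using dec by (intro sum.cong refl)
    also have "\<dots> = (\<Sum>k<?n. \<mu> k * (\<Sum>j\<in>J. v k j * v k j))"
      by (subst sum.swap) (simp only: sum_distrib_left mult.assoc)
    also have "\<dots> = (\<Sum>k<?n. \<mu> k)" using vv by (intro sum.cong refl) simp
    finally show ?thesis .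
  qed
  have energy: "(\<Sum>j\<in>J. \<Sum>j'\<in>J. (G j j')\<^sup>2) = (\<Sum>k<?n. (\<mu> k)\<^sup>2)"
  proof -
    \<comment> \<open>The decomposition is inserted for one factor only; the other then produces the
      form at \<open>v k\<close>, which is again \<mu> k.\<close>
    have "(\<Sum>j\<in>J. \<Sum>j'\<in>J. (G j j')\<^sup>2) = (\<Sum>j\<in>J. \<Sum>j'\<in>J. \<Sum>k<?n. \<mu> k * (G j j' * v k j * v k j'))"
    proof (intro sum.cong refl)
      fix j j' assume jj: "j \<in> J" "j' \<in> J"
      have "(G j j')\<^sup>2 = G j j' * (\<Sum>k<?n. \<mu> k * v k j * v k j')" using dec[OF jj] by (simp only: power2_eq_square)
      then show "(G j j')\<^sup>2 = (\<Sum>k<?n. \<mu> k * (G j j' * v k j * v k j'))" by (simp only: sum_distrib_left ac_simps)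
    qed
    also have "\<dots> = (\<Sum>j\<in>J. \<Sum>k<?n. \<Sum>j'\<in>J. \<mu> k * (G j j' * v k j * v k j'))"
      by (intro sum.cong refl) (rule sum.swap)
    also have "\<dots> = (\<Sum>k<?n. \<Sum>j\<in>J. \<Sum>j'\<in>J. \<mu> k * (G j j' * v k j * v k j'))"
      by (rule sum.swap)
    also have "\<dots> = (\<Sum>k<?n. \<mu> k * \<mu> k)"
      using \<mu> by (intro sum.cong refl) (simp only: sum_distrib_left[symmetric] lessThan_iff)
    finally show ?thesis by (simp only: power2_eq_square)
  qed
  show ?thesis
  proof (rule that[OF o comb trace[symmetric] energy[symmetric]])
    show "\<exists>c. (\<Sum>j\<in>J. (c j)\<^sup>2) = 1 \<and> \<mu> k = (\<Sum>j\<in>J. \<Sum>j'\<in>J. G j j' * c j * c j')" if "k < ?n" for k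
      using vv[OF that that] \<mu>[OF that] by (intro exI[of _ "v k"]) (simp add: power2_eq_square)
  qed
qed

lemma sum_J: "(\<Sum>j\<in>J. f j) = (\<Sum>i\<in>I. \<Sum>b\<in>UNIV. f (i, b))"
  unfolding J_def by (simp add: sum.cartesian_product)

text \<open>The trace has no sampling error, since the diagonal involves only K(0) and the cells
  partition A. The factor 2 counts the real coordinates per cell.\<close>

lemma trace_G: "(\<Sum>j\<in>J. G j j) = 2 * measure lborel A * measure lborel W / (2 * pi) ^ DIM('a)"
proof -
  have "G (i, b) (i, b) = m i * (measure lborel W / (2 * pi) ^ DIM('a))" for i b
    using m_nonneg[of i] by (simp add: G_def band_kernel_zero[OF W] re_im_unit_def)
  then have "(\<Sum>j\<in>J. G j j) = (\<Sum>i\<in>I. m i * (2 * (measure lborel W / (2 * pi) ^ DIM('a))))"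
    unfolding sum_J by (intro sum.cong refl) (simp add: UNIV_bool ac_simps)
  also have "\<dots> = (\<Sum>i<N. m i) * (2 * (measure lborel W / (2 * pi) ^ DIM('a)))"
    unfolding sum_I_eq by (simp only: sum_distrib_right)
  finally show ?thesis by (simp add: sum_m)
qed

text \<open>The four real entries for a pair of cells have square sum 2 |K|^2 times the two
  measures. By the bound on K, an error \<kappa> in the kernel is an error of at most 2 \<kappa> |W|
  / (2 pi)^d in its square, which is doubled and integrated over A x A.\<close>

lemma energy_G: "2 * kernel_energy A W - 4 * \<kappa> * (measure lborel W / (2 * pi) ^ DIM('a)) * (measure lborel A)\<^sup>2
    \<le> (\<Sum>j\<in>J. \<Sum>j'\<in>J. (G j j')\<^sup>2)"
proof -
  let ?k = "measure lborel W / (2 * pi) ^ DIM('a)"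
  let ?q = "\<lambda>i j. (cmod (K (p i - p j)))\<^sup>2"
  have "(\<Sum>b\<in>UNIV. \<Sum>b'\<in>UNIV. (G (i, b) (j, b'))\<^sup>2) = 2 * (m i * (m j * ?q i j))" for i j
    using m_nonneg[of i] m_nonneg[of j]
    by (simp add: UNIV_bool G_def re_im_unit_def power_mult_distrib cmod_power2 algebra_simps)
  then have "(\<Sum>j\<in>J. \<Sum>j'\<in>J. (G j j')\<^sup>2) = (\<Sum>i\<in>I. \<Sum>j\<in>I. 2 * (m i * (m j * ?q i j)))"
    unfolding sum_J by (subst sum.swap[of _ I UNIV]) simp
  also have "\<dots> = 2 * (\<Sum>i\<in>I. m i * (\<Sum>j\<in>I. m j * ?q i j))" by (simp only: sum_distrib_left)
  also have "\<dots> = 2 * (\<Sum>i<N. m i * (\<Sum>j<N. m j * ?q i j))" by (simp only: sum_I_eq)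
  finally have GG: "(\<Sum>j\<in>J. \<Sum>j'\<in>J. (G j j')\<^sup>2) = 2 * (\<Sum>i<N. m i * (\<Sum>j<N. m j * ?q i j))" .
  define Q where "Q = (\<lambda>i j. ?q i j + 2 * \<kappa> * ?k)"
  have k0: "?k \<ge> 0" by simp
  have Q0: "0 \<le> Q i j" for i j using \<kappa>0 k0 by (simp add: Q_def)
  have close2: "(cmod (K (y - x)))\<^sup>2 \<le> Q i j" if "i < N" "j < N" "x \<in> D i" "y \<in> D j" for i j x y
  proof -
    have "K (y - x) = cnj (K (x - y))" using band_kernel_minus[of W "x - y"] by simp
    then have "cmod (K (y - x)) = cmod (K (x - y))" by (simp only: complex_mod_cnj)
    then have 1: "cmod (K (y - x)) \<le> cmod (K (p i - p j)) + \<kappa>"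
      using close[OF that] norm_triangle_sub[of "K (x - y)" "K (p i - p j)"] by linarith
    have 2: "cmod (K (y - x)) \<le> ?k" "cmod (K (p i - p j)) \<le> ?k" using band_kernel_bound[OF W] by auto
    have "(cmod (K (y - x)))\<^sup>2 - ?q i j = (cmod (K (y - x)) - cmod (K (p i - p j))) * (cmod (K (y - x)) + cmod (K (p i - p j)))"
      by (simp add: power2_eq_square algebra_simps)
    also have "\<dots> \<le> \<kappa> * (cmod (K (y - x)) + cmod (K (p i - p j)))"
      using 1 by (intro mult_right_mono) auto
    also have "\<dots> \<le> \<kappa> * (?k + ?k)" using 2 \<kappa>0 by (intro mult_left_mono add_mono)
    finally have "(cmod (K (y - x)))\<^sup>2 - ?q i j \<le> \<kappa> * (?k + ?k)" .
    moreover have "a \<le> b + 2 * \<kappa> * k" if "a - b \<le> \<kappa> * (k + k)" for a b k :: real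
      using that by (simp add: algebra_simps)
    ultimately show ?thesis unfolding Q_def by blast
  qed
  have Di: "integrable lborel (indicator (D i) :: 'a \<Rightarrow> real)" if "i < N" for i
    using D_finite[OF that] D_borel[of i] by (simp add: integrable_indicator_iff)
  have inner: "(\<integral>y. indicator A y * (cmod (K (y - x)))\<^sup>2 \<partial>lborel) \<le> (\<Sum>j<N. m j * Q i j)" if i: "i < N" "x \<in> D i" for i x
  proof -
    have "(\<integral>y. indicator A y * (cmod (K (y - x)))\<^sup>2 \<partial>lborel) \<le> (\<integral>y. (\<Sum>j<N. indicator (D j) y * Q i j) \<partial>lborel)"
    proof (rule integral_mono')
      show "integrable lborel (\<lambda>y. \<Sum>j<N. indicator (D j) y * Q i j)"
        using Di by (intro Bochner_Integration.integrable_sum integrable_mult_left) auto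
      fix y
      show "indicator A y * (cmod (K (y - x)))\<^sup>2 \<le> (\<Sum>j<N. indicator (D j) y * Q i j)"
        unfolding indicator_sum[symmetric, of y] sum_distrib_right
        using close2[OF i(1) _ i(2)] by (intro sum_mono) (auto split: split_indicator)
      show "0 \<le> (\<Sum>j<N. indicator (D j) y * Q i j)" using Q0 by (intro sum_nonneg) auto
    qed
    also have "\<dots> = (\<Sum>j<N. m j * Q i j)"
      using Di D_borel by (subst Bochner_Integration.integral_sum) (auto simp: m_def)
    finally show ?thesis .
  qed
  have "kernel_energy A W \<le> (\<integral>x. (\<Sum>i<N. indicator (D i) x * (\<Sum>j<N. m j * Q i j)) \<partial>lborel)"
    unfolding kernel_energy_def
  proof (rule integral_mono')
    show "integrable lborel (\<lambda>x. \<Sum>i<N. indicator (D i) x * (\<Sum>j<N. m j * Q i j))"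
      using Di by (intro Bochner_Integration.integrable_sum integrable_mult_left) auto
    fix x
    show "indicator A x * (\<integral>y. indicator A y * (cmod (K (y - x)))\<^sup>2 \<partial>lborel) \<le> (\<Sum>i<N. indicator (D i) x * (\<Sum>j<N. m j * Q i j))"
      unfolding indicator_sum[symmetric, of x] sum_distrib_right
      using inner by (intro sum_mono) (auto split: split_indicator)
    show "0 \<le> (\<Sum>i<N. indicator (D i) x * (\<Sum>j<N. m j * Q i j))"
      using Q0 m_nonneg by (intro sum_nonneg mult_nonneg_nonneg) auto
  qed
  also have "\<dots> = (\<Sum>i<N. m i * (\<Sum>j<N. m j * Q i j))"
    using Di D_borel by (subst Bochner_Integration.integral_sum) (auto simp: m_def)
  also have "\<dots> = (\<Sum>i<N. m i * (\<Sum>j<N. m j * ?q i j)) + 2 * \<kappa> * ?k * (\<Sum>i<N. m i) * (\<Sum>j<N. m j)"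
  proof -
    have l: "(\<Sum>i<N. m i * (a i + b)) = (\<Sum>i<N. m i * a i) + b * (\<Sum>i<N. m i)" for a b
      by (simp only: distrib_left sum.distrib sum_distrib_left mult.commute)
    show ?thesis unfolding Q_def l by (simp only: ac_simps)
  qed
  finally have "kernel_energy A W \<le> (\<Sum>i<N. m i * (\<Sum>j<N. m j * ?q i j)) + 2 * \<kappa> * ?k * measure lborel A * measure lborel A"
    unfolding sum_m .
  moreover have "2 * e - 4 * \<kappa> * k * a\<^sup>2 \<le> 2 * S" if "e \<le> S + 2 * \<kappa> * k * a * a" for e S k a
    using that by (simp add: power2_eq_square)
  ultimately show ?thesis unfolding GG by blast
qed

lemma form_G:
  "(\<Sum>j\<in>J. \<Sum>j'\<in>J. G j j' * c j * c j') = 1 / (2 * pi) ^ DIM('a) *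
    (\<integral>\<xi>. indicator W \<xi> * (cmod (\<Sum>i\<in>I. of_real (sqrt (m i)) * (\<Sum>b\<in>UNIV. cnj (re_im_unit b) * of_real (c (i, b))) * cis_inner (p i) \<xi>))\<^sup>2 \<partial>lborel)"
proof -
  define a where "a = (\<lambda>i. of_real (sqrt (m i)) * (\<Sum>b\<in>UNIV. cnj (re_im_unit b) * of_real (c (i, b))))"
  have "(\<Sum>j\<in>J. \<Sum>j'\<in>J. G j j' * c j * c j') = (\<Sum>i\<in>I. \<Sum>i'\<in>I. \<Sum>b\<in>UNIV. \<Sum>b'\<in>UNIV. G (i, b) (i', b') * c (i, b) * c (i', b'))"
    unfolding sum_J by (subst sum.swap[of _ I UNIV]) simp
  also have "\<dots> = (\<Sum>i\<in>I. \<Sum>i'\<in>I. Re (a i * cnj (a i') * K (p i - p i')))"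
    by (intro sum.cong refl) (simp add: UNIV_bool G_def a_def re_im_unit_def algebra_simps)
  also have "\<dots> = Re (\<Sum>i\<in>I. \<Sum>i'\<in>I. a i * cnj (a i') * K (p i - p i'))" by (simp only: Re_sum)
  also have "\<dots> = 1 / (2 * pi) ^ DIM('a) * (\<integral>\<xi>. indicator W \<xi> * (cmod (\<Sum>i\<in>I. a i * cis_inner (p i) \<xi>))\<^sup>2 \<partial>lborel)"
    unfolding band_kernel_form[OF finite_IJ(1) W] by (rule Re_complex_of_real)
  finally show ?thesis unfolding a_def .
qed

text \<open>The Gaussian bound of the form is combined with the Schur test: the row sums of m j
  gauss (p i - p j) are Riemann sums for the integral of a probability density, hence at most 1 up
  to the sampling error.\<close>

lemma form_G_bounds:
  assumes c: "(\<Sum>j\<in>J. (c j)\<^sup>2) = 1" and s: "s > 0" and R: "\<And>\<xi>. \<xi> \<in> W \<Longrightarrow> norm \<xi> \<le> R"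
    and gclose: "\<And>i j y. i < N \<Longrightarrow> j < N \<Longrightarrow> y \<in> D j \<Longrightarrow> gauss s (p i - p j) \<le> gauss s (p i - y) + \<kappa>'"
    and \<kappa>': "\<kappa>' \<ge> 0"
  shows "0 \<le> (\<Sum>j\<in>J. \<Sum>j'\<in>J. G j j' * c j * c j')"
    and "(\<Sum>j\<in>J. \<Sum>j'\<in>J. G j j' * c j * c j') \<le> exp (s\<^sup>2 * R\<^sup>2 / 2) * (1 + \<kappa>' * measure lborel A)"
proof -
  show "0 \<le> (\<Sum>j\<in>J. \<Sum>j'\<in>J. G j j' * c j * c j')"
    unfolding form_G by (intro mult_nonneg_nonneg Bochner_Integration.integral_nonneg) auto
  define C where "C = (\<lambda>i. \<Sum>b\<in>UNIV. cnj (re_im_unit b) * of_real (c (i, b)))"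
  have C2: "(cmod (C i))\<^sup>2 = (\<Sum>b\<in>UNIV. (c (i, b))\<^sup>2)" for i
    by (simp add: C_def UNIV_bool re_im_unit_def cmod_power2)
  have Di: "integrable lborel (indicator (D i) :: 'a \<Rightarrow> real)" if "i < N" for i
    using D_finite[OF that] D_borel[of i] by (simp add: integrable_indicator_iff)
  have gi: "has_bochner_integral lborel (\<lambda>y. gauss s (x - y)) 1" for x :: 'a
  proof -
    have sym: "gauss s (x - y) = gauss s (- x + y)" for y by (simp add: gauss_def norm_minus_commute)
    have "integrable (distr lborel borel ((+) (- x))) (gauss s :: 'a \<Rightarrow> real)"
      unfolding lborel_distr_plus using gauss_integral[OF s, where 'a = 'a] by (simp add: has_bochner_integral_iff)
    then have "integrable lborel (\<lambda>y. gauss s (- x + y))" by (subst (asm) integrable_distr_eq) auto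
    moreover have "(\<integral>y. gauss s (- x + y) \<partial>lborel) = 1"
      using lborel_integral_translate[OF gauss_measurable, of s "- x"] gauss_integral[OF s, where 'a = 'a]
      by (simp add: has_bochner_integral_iff)
    ultimately show ?thesis unfolding sym by (simp add: has_bochner_integral_iff)
  qed
  have B: "(\<Sum>j\<in>I. m j * gauss s (p i - p j)) \<le> 1 + \<kappa>' * measure lborel A" if i: "i \<in> I" for i
  proof -
    have i': "i < N" using i by (simp add: I_def)
    have Ai: "integrable lborel (indicator A :: 'a \<Rightarrow> real)" by (rule compact_integrable_indicator(1)[OF A])
    have "(\<Sum>j\<in>I. m j * gauss s (p i - p j)) = (\<Sum>j<N. m j * gauss s (p i - p j))" by (rule sum_I_eq)
    also have "\<dots> = (\<integral>y. (\<Sum>j<N. indicator (D j) y * gauss s (p i - p j)) \<partial>lborel)"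
      using Di D_borel by (subst Bochner_Integration.integral_sum) (auto simp: m_def)
    also have "\<dots> \<le> (\<integral>y. gauss s (p i - y) + \<kappa>' * indicator A y \<partial>lborel)"
    proof (rule integral_mono)
      show "integrable lborel (\<lambda>y. \<Sum>j<N. indicator (D j) y * gauss s (p i - p j))"
        using Di by (intro Bochner_Integration.integrable_sum integrable_mult_left) auto
      show "integrable lborel (\<lambda>y. gauss s (p i - y) + \<kappa>' * indicator A y)"
        using gi Ai by (intro Bochner_Integration.integrable_add integrable_mult_right) (auto simp: has_bochner_integral_iff)
      fix y
      have "(\<Sum>j<N. indicator (D j) y * gauss s (p i - p j)) \<le> (\<Sum>j<N. indicator (D j) y * (gauss s (p i - y) + \<kappa>'))"
        using gclose[OF i'] by (intro sum_mono) (auto split: split_indicator)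
      also have "\<dots> = indicator A y * (gauss s (p i - y) + \<kappa>')" by (simp only: sum_distrib_right[symmetric] indicator_sum)
      also have "\<dots> \<le> gauss s (p i - y) + \<kappa>' * indicator A y"
        using gauss_nonneg[OF s, of "p i - y"] by (simp split: split_indicator)
      finally show "(\<Sum>j<N. indicator (D j) y * gauss s (p i - p j)) \<le> gauss s (p i - y) + \<kappa>' * indicator A y" .
    qed
    also have "\<dots> = 1 + \<kappa>' * measure lborel A"
      using gi[of "p i"] Ai borel_compact[OF A] by (subst Bochner_Integration.integral_add) (auto simp: has_bochner_integral_iff)
    finally show ?thesis .
  qed
  have "(\<Sum>j\<in>J. \<Sum>j'\<in>J. G j j' * c j * c j') \<le> exp (s\<^sup>2 * R\<^sup>2 / 2) * (\<Sum>i\<in>I. \<Sum>j\<in>I.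
      cmod (of_real (sqrt (m i)) * C i) * cmod (of_real (sqrt (m j)) * C j) * gauss s (p i - p j))"
  proof -
    have "(\<Sum>b\<in>UNIV. cnj (re_im_unit b) * of_real (c (i, b))) = C i" for i by (simp only: C_def)
    then show ?thesis unfolding form_G by (simp only:) (rule gauss_form_bound[OF finite_IJ(1) W s R])
  qed
  also have "\<dots> = exp (s\<^sup>2 * R\<^sup>2 / 2) * (\<Sum>i\<in>I. \<Sum>j\<in>I.
      (sqrt (m i) * cmod (C i)) * (sqrt (m j) * cmod (C j)) * gauss s (p i - p j))"
    using m_nonneg by (simp add: norm_mult)
  also have "\<dots> \<le> exp (s\<^sup>2 * R\<^sup>2 / 2) * ((1 + \<kappa>' * measure lborel A) * (\<Sum>i\<in>I. (cmod (C i))\<^sup>2))"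
    using B m_nonneg gauss_nonneg[OF s]
    by (intro mult_left_mono weighted_schur_bound) (auto simp: gauss_def norm_minus_commute)
  also have "(\<Sum>i\<in>I. (cmod (C i))\<^sup>2) = 1" using c unfolding C2 sum_J .
  finally show "(\<Sum>j\<in>J. \<Sum>j'\<in>J. G j j' * c j * c j') \<le> exp (s\<^sup>2 * R\<^sup>2 / 2) * (1 + \<kappa>' * measure lborel A)"
    by simp
qed

end

section \<open>Eigenvalue distribution and entropy\<close>

lemma compact_partition:
  fixes A :: "'a::euclidean_space set"
  assumes A: "compact A" and h: "h > 0"
  obtains N :: nat and p D where "\<And>i. D i \<in> sets borel" "\<And>i j. i \<noteq> j \<Longrightarrow> D i \<inter> D j = {}" "(\<Union>i<N. D i) = A"
    "\<And>i. i < N \<Longrightarrow> p i \<in> A" "\<And>i x. i < N \<Longrightarrow> x \<in> D i \<Longrightarrow> norm (x - p i) < h"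
proof -
  obtain C where C: "finite C" "C \<subseteq> A" "A \<subseteq> (\<Union>c\<in>C. ball c h)"
    using compactE_image[OF A, of A "\<lambda>c. ball c h"] h by force
  obtain xs where xs: "set xs = C" using C(1) finite_list by blast
  define N where "N = length xs"
  define p where "p = (\<lambda>i. xs ! i)"
  \<comment> \<open>Each ball minus the earlier ones; cells beyond N are empty, so that disjointness
    holds for all indices.\<close>
  define D where "D = (\<lambda>i. if i < N then (A \<inter> ball (p i) h) - (\<Union>j<i. ball (p j) h) else {})"
  show ?thesis
  proof
    show "D i \<in> sets borel" for i using borel_compact[OF A] by (auto simp: D_def)
    show "D i \<inter> D j = {}" if "i \<noteq> j" for i j
      using that by (cases i j rule: linorder_cases) (auto simp: D_def split: if_splits)
    show "p i \<in> A" if "i < N" for i using that C(2) xs by (auto simp: p_def N_def)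
    show "norm (x - p i) < h" if "i < N" "x \<in> D i" for i x
      using that by (simp add: D_def dist_norm norm_minus_commute)
    show "(\<Union>i<N. D i) = A"
    proof
      show "(\<Union>i<N. D i) \<subseteq> A" by (auto simp: D_def)
      show "A \<subseteq> (\<Union>i<N. D i)"
      proof
        fix x assume x: "x \<in> A"
        then obtain c where c: "c \<in> set xs" "x \<in> ball c h" using C(3) xs by blast
        then have ex: "\<exists>i. i < N \<and> x \<in> ball (p i) h" by (auto simp: p_def N_def in_set_conv_nth)
        define i where "i = (LEAST i. i < N \<and> x \<in> ball (p i) h)"
        have i: "i < N \<and> x \<in> ball (p i) h" unfolding i_def using ex by (rule LeastI_ex)
        have "x \<notin> ball (p j) h" if "j < i" for j
          using not_less_Least[of j "\<lambda>i. i < N \<and> x \<in> ball (p i) h"] that i unfolding i_def[symmetric] by simp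
        then have "x \<in> D i" using i x by (auto simp: D_def)
        then show "x \<in> (\<Union>i<N. D i)" using i by blast
      qed
    qed
  qed
qed

text \<open>The accuracy \<kappa> is spread over three demands: eigenvalues at most 1 + \<kappa>,
  the operator error and the loss of energy. The mesh is chosen last.\<close>

lemma exists_finite_rank_approx:
  fixes A W :: "'a::euclidean_space set"
  assumes A: "compact A" and W: "compact W" and \<kappa>: "\<kappa> > 0"
  obtains n u \<mu> where "finite_rank_approx (\<lambda>f. time_limit A (band_limit W (time_limit A f))) \<kappa> n u \<mu>"
    "(\<Sum>k<n. \<mu> k) = 2 * measure lborel A * measure lborel W / (2 * pi) ^ DIM('a)"
    "2 * kernel_energy A W - \<kappa> \<le> (\<Sum>k<n. (\<mu> k)\<^sup>2)"
proof -
  define a where "a = measure lborel A"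
  define k where "k = measure lborel W / (2 * pi) ^ DIM('a)"
  have a: "a \<ge> 0" and k: "k \<ge> 0" by (auto simp: a_def k_def)
  obtain R where R: "R > 0" "\<And>\<xi>. \<xi> \<in> W \<Longrightarrow> norm \<xi> \<le> R"
    using compact_imp_bounded[OF W] by (auto simp: bounded_pos)
  \<comment> \<open>Solves exp (s^2 R^2 / 2) = 1 + \<kappa>/2, which leaves the other half of
    \<kappa> for the Riemann sums.\<close>
  define s where "s = sqrt (2 * ln (1 + \<kappa> / 2)) / R"
  have ln0: "ln (1 + \<kappa> / 2) > 0" using \<kappa> by simp
  have s: "s > 0" unfolding s_def using ln0 R by simp
  have "s\<^sup>2 * R\<^sup>2 / 2 = ln (1 + \<kappa> / 2)" unfolding s_def using ln0 R by (simp add: power_divide)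
  then have es: "exp (s\<^sup>2 * R\<^sup>2 / 2) = 1 + \<kappa> / 2" using \<kappa> by simp
  define \<kappa>' where "\<kappa>' = (\<kappa> / 2) / ((1 + \<kappa> / 2) * (1 + a))"
  have \<kappa>': "\<kappa>' > 0" unfolding \<kappa>'_def using \<kappa> a by (intro divide_pos_pos mult_pos_pos) auto
  have bound: "(1 + \<kappa> / 2) * (1 + \<kappa>' * a) \<le> 1 + \<kappa>"
  proof -
    have "(1 + \<kappa> / 2) * (\<kappa>' * a) = (\<kappa> / 2) * (a / (1 + a))"
      unfolding \<kappa>'_def using \<kappa> a by (simp add: divide_simps)
    also have "\<dots> \<le> (\<kappa> / 2) * 1" using \<kappa> a by (intro mult_left_mono) auto
    finally have "(1 + \<kappa> / 2) * (\<kappa>' * a) \<le> \<kappa> / 2" by simp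
    moreover have "(1 + \<kappa> / 2) * (1 + \<kappa>' * a) = 1 + \<kappa> / 2 + (1 + \<kappa> / 2) * (\<kappa>' * a)"
      by (simp add: algebra_simps)
    ultimately show ?thesis by simp
  qed
  \<comment> \<open>The denominator serves both \<kappa>1 a <= \<kappa> (operator error) and 4
    \<kappa>1 k a^2 <= \<kappa> (energy), and its summand 1 keeps it positive.\<close>
  define \<kappa>1 where "\<kappa>1 = \<kappa> / (1 + a + 4 * k * a\<^sup>2)"
  have den: "1 + a + 4 * k * a\<^sup>2 > 0" using a k by (intro add_pos_nonneg) auto
  have \<kappa>1: "\<kappa>1 > 0" unfolding \<kappa>1_def using \<kappa> den by simp
  have \<kappa>1a: "\<kappa>1 * a \<le> \<kappa>" "4 * \<kappa>1 * k * a\<^sup>2 \<le> \<kappa>"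
  proof -
    have "\<kappa>1 * (1 + a + 4 * k * a\<^sup>2) = \<kappa>" unfolding \<kappa>1_def using den by simp
    then have e: "\<kappa>1 + \<kappa>1 * a + 4 * \<kappa>1 * k * a\<^sup>2 = \<kappa>" by (simp add: algebra_simps)
    have "\<kappa>1 * a \<ge> 0" "4 * \<kappa>1 * k * a\<^sup>2 \<ge> 0" using \<kappa>1 a k by auto
    then show "\<kappa>1 * a \<le> \<kappa>" "4 * \<kappa>1 * k * a\<^sup>2 \<le> \<kappa>" using e \<kappa>1 by linarith+
  qed
  obtain L where L: "L \<ge> 0" "\<And>y z. cmod (band_kernel W y - band_kernel W z) \<le> L * norm (y - z)"
    using band_kernel_lipschitz[OF W] by metis
  define S where "S = {x - y | x y. x \<in> A \<and> y \<in> A}"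
  have "compact S" unfolding S_def by (rule compact_differences[OF A A])
  then have "uniformly_continuous_on S (gauss s)"
    by (intro compact_uniformly_continuous continuous_on_subset[OF gauss_continuous[OF s]]) auto
  then obtain h2 where h2: "h2 > 0" and h2': "\<forall>x\<in>S. \<forall>y\<in>S. dist y x < h2 \<longrightarrow> dist (gauss s y) (gauss s x) < \<kappa>'"
    unfolding uniformly_continuous_on_def using \<kappa>' by blast
  \<comment> \<open>The first bound controls the Gaussian at differences of points, the second the
    kernel, whose argument moves by at most 2 h. The denominator is 2 L + 1 to allow L = 0.\<close>
  define h where "h = min h2 (\<kappa>1 / (2 * L + 1))"
  have h: "h > 0" unfolding h_def using h2 \<kappa>1 L by simp
  have Lh: "L * (2 * h) \<le> \<kappa>1"
  proof -
    have "h * (2 * L + 1) \<le> \<kappa>1" using L h_def by (simp add: min_def pos_le_divide_eq split: if_splits)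
    then show ?thesis using h by (simp add: algebra_simps)
  qed
  obtain N :: nat and p D where D: "\<And>i. D i \<in> sets borel" "\<And>i j. i \<noteq> j \<Longrightarrow> D i \<inter> D j = {}" "(\<Union>i<N. D i) = A"
    and p: "\<And>i. i < N \<Longrightarrow> p i \<in> A" "\<And>i x. i < N \<Longrightarrow> x \<in> D i \<Longrightarrow> norm (x - p i) < h"
    by (rule compact_partition[OF A h]) (rule that)
  interpret discretisation A W D p N \<kappa>1
  proof
    fix i j x y assume ij: "i < N" "j < N" "x \<in> D i" "y \<in> D j"
    have "norm ((x - y) - (p i - p j)) \<le> norm (x - p i) + norm (y - p j)"
      using norm_triangle_ineq4[of "x - p i" "y - p j"] by (simp add: algebra_simps)
    also have "\<dots> \<le> 2 * h" using p(2)[OF ij(1,3)] p(2)[OF ij(2,4)] by simp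
    finally have "L * norm ((x - y) - (p i - p j)) \<le> L * (2 * h)" using L by (intro mult_left_mono)
    then show "cmod (band_kernel W (x - y) - band_kernel W (p i - p j)) \<le> \<kappa>1"
      using L(2)[of "x - y" "p i - p j"] Lh by linarith
  qed (use A W D \<kappa>1 in auto)
  obtain u \<mu> where u: "L2_orthonormal (card J) u"
    and comb: "\<And>f x. f \<in> L2 \<Longrightarrow> L2_combination (card J) u (\<lambda>k. \<mu> k * L2_inner f (u k)) x =
       (\<Sum>j\<in>J. cell j x * of_real (\<Sum>j'\<in>J. G j j' * L2_inner f (cell j')))"
    and tr: "(\<Sum>k<card J. \<mu> k) = (\<Sum>j\<in>J. G j j)"
    and en: "(\<Sum>k<card J. (\<mu> k)\<^sup>2) = (\<Sum>j\<in>J. \<Sum>j'\<in>J. (G j j')\<^sup>2)"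
    and form: "\<And>k. k < card J \<Longrightarrow> \<exists>c. (\<Sum>j\<in>J. (c j)\<^sup>2) = 1 \<and> \<mu> k = (\<Sum>j\<in>J. \<Sum>j'\<in>J. G j j' * c j * c j')"
    by (rule spectral) (rule that)
  have gclose: "gauss s (p i - p j) \<le> gauss s (p i - y) + \<kappa>'" if "i < N" "j < N" "y \<in> D j" for i j y
  proof -
    have "y \<in> A" using D_sub that by blast
    moreover have "dist (p i - p j) (p i - y) < h2"
      using p(2)[OF that(2,3)] by (simp add: dist_norm h_def)
    moreover have "p i \<in> A" "p j \<in> A" using p(1) that by auto
    ultimately have "p i - p j \<in> S" "p i - y \<in> S" "dist (p i - p j) (p i - y) < h2" by (auto simp: S_def)
    then have "dist (gauss s (p i - p j)) (gauss s (p i - y)) < \<kappa>'" using h2' by blast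
    then show ?thesis by (simp add: dist_real_def abs_less_iff)
  qed
  have \<mu>: "0 \<le> \<mu> k \<and> \<mu> k \<le> 1 + \<kappa>" if k: "k < card J" for k
  proof -
    obtain c where c: "(\<Sum>j\<in>J. (c j)\<^sup>2) = 1" "\<mu> k = (\<Sum>j\<in>J. \<Sum>j'\<in>J. G j j' * c j * c j')"
      using form[OF k] by blast
    have "0 \<le> \<mu> k" "\<mu> k \<le> exp (s\<^sup>2 * R\<^sup>2 / 2) * (1 + \<kappa>' * measure lborel A)"
      unfolding c(2) using form_G_bounds[OF c(1) s R(2) gclose] \<kappa>' by auto
    then show ?thesis using bound unfolding es a_def by simp
  qed
  have "finite_rank_approx (\<lambda>f. time_limit A (band_limit W (time_limit A f))) \<kappa> (card J) u \<mu>"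
    unfolding finite_rank_approx_def
  proof (intro conjI allI impI ballI)
    fix f :: "'a \<Rightarrow> complex" assume f: "f \<in> L2_unit_ball"
    then have fL: "f \<in> L2" "L2_norm f \<le> 1" by (auto simp: L2_unit_ball_def)
    show "time_limit A (band_limit W (time_limit A f)) \<in> L2" using A W fL(1) by (rule time_band_limit_L2)
    have "L2_dist (time_limit A (band_limit W (time_limit A f))) (L2_combination (card J) u (\<lambda>k. \<mu> k * L2_inner f (u k)))
        \<le> \<kappa>1 * measure lborel A * L2_norm f"
      by (rule operator_error[OF fL(1) L2_combination_L2[OF u] comb[OF fL(1)]])
    also have "\<dots> \<le> \<kappa>1 * measure lborel A * 1" using fL \<kappa>1 by (intro mult_left_mono) auto
    also have "\<dots> \<le> \<kappa>" using \<kappa>1a by (simp add: a_def)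
    finally show "L2_dist (time_limit A (band_limit W (time_limit A f))) (L2_combination (card J) u (\<lambda>k. \<mu> k * L2_inner f (u k))) \<le> \<kappa>" .
  qed (use u \<mu> in auto)
  moreover have "(\<Sum>k<card J. \<mu> k) = 2 * measure lborel A * measure lborel W / (2 * pi) ^ DIM('a)"
    unfolding tr by (rule trace_G)
  moreover have "2 * kernel_energy A W - \<kappa> \<le> (\<Sum>k<card J. (\<mu> k)\<^sup>2)"
    unfolding en using energy_G \<kappa>1a(2) unfolding a_def k_def by linarith
  ultimately show ?thesis by (rule that)
qed

text \<open>q weighs the eigenvalues away from 0 and 1 + \<kappa>. An eigenvalue above \<delta>
  satisfies 1 - \<mu> <= \<mu> (1 + \<kappa> - \<mu>) / \<delta>, one below \<alpha> satisfies \<mu>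
  <= \<mu> (1 + \<kappa> - \<mu>) / (1 - \<alpha>); summation compares both counts with the
  trace.\<close>

lemma eigenvalue_count_bounds:
  fixes \<mu> :: "nat \<Rightarrow> real"
  assumes \<mu>: "\<And>k. k < n \<Longrightarrow> 0 \<le> \<mu> k \<and> \<mu> k \<le> 1 + \<kappa>"
  defines "t \<equiv> \<Sum>k<n. \<mu> k" and "q \<equiv> \<Sum>k<n. \<mu> k * (1 + \<kappa> - \<mu> k)"
  assumes \<kappa>: "\<kappa> \<ge> 0"
  shows "\<delta> > 0 \<Longrightarrow> real (card {k\<in>{..<n}. \<delta> < \<mu> k}) \<le> t + q / \<delta>"
    and "\<alpha> < 1 \<Longrightarrow> t - q / (1 - \<alpha>) \<le> (1 + \<kappa>) * real (card {k\<in>{..<n}. \<alpha> \<le> \<mu> k})"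
proof -
  have cardsum: "real (card {k\<in>{..<n}. P k}) = (\<Sum>k<n. if P k then 1 else 0)" for P
    by (simp add: sum.If_cases Int_def)
  have nn: "0 \<le> \<mu> k * (1 + \<kappa> - \<mu> k)" if "k < n" for k using \<mu>[OF that] by simp
  {
    assume \<delta>: "\<delta> > 0"
    have "real (card {k\<in>{..<n}. \<delta> < \<mu> k}) \<le> (\<Sum>k<n. \<mu> k + \<mu> k * (1 + \<kappa> - \<mu> k) / \<delta>)"
      unfolding cardsum
    proof (rule sum_mono)
      fix k assume "k \<in> {..<n}"
      then have k: "0 \<le> \<mu> k" "\<mu> k \<le> 1 + \<kappa>" "0 \<le> \<mu> k * (1 + \<kappa> - \<mu> k)" using \<mu>[of k] nn[of k] by auto
      have "1 - \<mu> k \<le> \<mu> k * (1 + \<kappa> - \<mu> k) / \<delta>" if "\<delta> < \<mu> k"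
      proof -
        have "\<delta> * (1 + \<kappa> - \<mu> k) \<le> \<mu> k * (1 + \<kappa> - \<mu> k)" using that k by (intro mult_right_mono) auto
        then have "1 + \<kappa> - \<mu> k \<le> \<mu> k * (1 + \<kappa> - \<mu> k) / \<delta>" using \<delta> by (simp add: pos_le_divide_eq mult.commute)
        then show ?thesis using \<kappa> by simp
      qed
      then show "(if \<delta> < \<mu> k then 1 else 0) \<le> \<mu> k + \<mu> k * (1 + \<kappa> - \<mu> k) / \<delta>"
        using k \<delta> by (auto simp: add_nonneg_nonneg)
    qed
    also have "\<dots> = t + q / \<delta>" by (simp only: sum.distrib t_def q_def sum_divide_distrib)
    finally show "real (card {k\<in>{..<n}. \<delta> < \<mu> k}) \<le> t + q / \<delta>" .
  }
  {
    assume \<alpha>: "\<alpha> < 1"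
    have "t \<le> (\<Sum>k<n. (1 + \<kappa>) * (if \<alpha> \<le> \<mu> k then 1 else 0) + \<mu> k * (1 + \<kappa> - \<mu> k) / (1 - \<alpha>))"
      unfolding t_def
    proof (rule sum_mono)
      fix k assume "k \<in> {..<n}"
      then have k: "0 \<le> \<mu> k" "\<mu> k \<le> 1 + \<kappa>" "0 \<le> \<mu> k * (1 + \<kappa> - \<mu> k)" using \<mu>[of k] nn[of k] by auto
      show "\<mu> k \<le> (1 + \<kappa>) * (if \<alpha> \<le> \<mu> k then 1 else 0) + \<mu> k * (1 + \<kappa> - \<mu> k) / (1 - \<alpha>)"
      proof (cases "\<alpha> \<le> \<mu> k")
        case True
        have "0 \<le> \<mu> k * (1 + \<kappa> - \<mu> k) / (1 - \<alpha>)" using k \<alpha> by (intro divide_nonneg_pos) auto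
        then show ?thesis using True k by simp
      next
        case False
        then have "\<mu> k * (1 - \<alpha>) \<le> \<mu> k * (1 + \<kappa> - \<mu> k)" using k \<kappa> by (intro mult_left_mono) auto
        then show ?thesis using False \<alpha> by (simp add: pos_le_divide_eq)
      qed
    qed
    also have "\<dots> = (1 + \<kappa>) * real (card {k\<in>{..<n}. \<alpha> \<le> \<mu> k}) + q / (1 - \<alpha>)"
      unfolding cardsum by (simp only: sum.distrib q_def sum_divide_distrib sum_distrib_left)
    finally show "t - q / (1 - \<alpha>) \<le> (1 + \<kappa>) * real (card {k\<in>{..<n}. \<alpha> \<le> \<mu> k})" by simp
  }
qed

section \<open>Two-sided entropy bounds and the limit\<close>

lemma measure_scale:
  fixes A :: "'a::euclidean_space set"
  assumes A: "compact A" and r: "r > 0"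
  shows "measure lborel ((*\<^sub>R) r ` A) = r ^ DIM('a) * measure lborel A"
proof -
  have "autocorr B 0 = measure lborel B" if "compact B" for B :: "'a set"
    using borel_compact[OF that] by (simp add: autocorr_def flip: indicator_inter_arith)
  then show ?thesis using autocorr_scale[OF A r, of 0] compact_scaling[OF A, of r] A by simp
qed

text \<open>A single x plays all small roles: threshold x for negligible eigenvalues, 1 - x for
  large ones, and a bound for \<kappa>. The \<open>max 0\<close> keeps the lower bound valid when
  the logarithm is negative, as it is for \<epsilon> = 1. C comes from the covering of balls and is
  independent of r.\<close>

lemma operator_entropy_eventually_bounds:
  fixes \<Omega> W :: "'a::euclidean_space set"
  assumes \<Omega>: "compact \<Omega>" and W: "compact W" and \<epsilon>: "0 < \<epsilon>" "\<epsilon> \<le> 1" and x: "0 < x" "6 * x < \<epsilon>"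
  defines "\<tau> \<equiv> measure lborel \<Omega> * measure lborel W / (2 * pi) ^ DIM('a)"
  shows "\<exists>C. \<forall>\<^sub>F r in at_top.
    (2 * \<tau> - x) / (1 + x) * max 0 (log 2 ((1 - x) / (\<epsilon> + x))) * r ^ DIM('a) \<le> operator_entropy \<epsilon> (P_LPS r \<Omega> W) \<and>
    operator_entropy \<epsilon> (P_LPS r \<Omega> W) \<le> (2 * \<tau> + x) * (log 2 (1 / (\<epsilon> - 6 * x)) + 3 * x) * r ^ DIM('a) + C"
proof -
  have \<tau>0: "\<tau> \<ge> 0" by (simp add: \<tau>_def)
  define \<rho> where "\<rho> = \<epsilon> - 6 * x"
  have \<rho>: "0 < \<rho>" "\<rho> < 1" using x \<epsilon> by (auto simp: \<rho>_def)
  have x1: "x < 1" using x \<epsilon> by simp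
  obtain C where C: "\<And>J :: nat set. finite J \<Longrightarrow> \<exists>Z. finite Z \<and> Z \<noteq> {} \<and>
    (\<forall>y. L2_set y J \<le> 1 \<longrightarrow> (\<exists>z\<in>Z. L2_set (\<lambda>i. y i - z i) J \<le> \<rho> + 2 * x)) \<and>
    log 2 (real (card Z)) \<le> real (card J) * (log 2 (1 / \<rho>) + 3 * x) + C"
    using unit_ball_covering[OF \<rho> x(1)] by blast
  \<comment> \<open>Half of the target q <= x^2 r^d is left for the terms with \<kappa>, and half
    for the energy defect x^2/4, which is doubled.\<close>
  define \<kappa> where "\<kappa> = min x (x\<^sup>2 / (2 * (2 * \<tau> + 1)))"
  have \<kappa>: "\<kappa> > 0" "\<kappa> \<le> x" "(2 * \<tau> + 1) * \<kappa> \<le> x\<^sup>2 / 2"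
  proof -
    show "\<kappa> > 0" "\<kappa> \<le> x" using x \<tau>0 by (auto simp: \<kappa>_def intro!: divide_pos_pos)
    have "\<kappa> \<le> x\<^sup>2 / (2 * (2 * \<tau> + 1))" by (simp add: \<kappa>_def)
    then have "\<kappa> * (2 * (2 * \<tau> + 1)) \<le> x\<^sup>2" using \<tau>0 by (subst (asm) pos_le_divide_eq) auto
    then show "(2 * \<tau> + 1) * \<kappa> \<le> x\<^sup>2 / 2" by (simp add: algebra_simps)
  qed
  have "x\<^sup>2 / 4 > 0" using x by simp
  from kernel_energy_lower[OF \<Omega> W this] eventually_ge_at_top[of 1]
  have "\<forall>\<^sub>F r in at_top.
    (2 * \<tau> - x) / (1 + x) * max 0 (log 2 ((1 - x) / (\<epsilon> + x))) * r ^ DIM('a) \<le> operator_entropy \<epsilon> (P_LPS r \<Omega> W) \<and>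
    operator_entropy \<epsilon> (P_LPS r \<Omega> W) \<le> (2 * \<tau> + x) * (log 2 (1 / (\<epsilon> - 6 * x)) + 3 * x) * r ^ DIM('a) + C"
  proof eventually_elim
    case (elim r)
    define A where "A = (*\<^sub>R) r ` \<Omega>"
    define d where "d = r ^ DIM('a)"
    have d: "d \<ge> 1" unfolding d_def using elim by (intro one_le_power)
    have A: "compact A" unfolding A_def using \<Omega> by (rule compact_scaling)
    have mA: "measure lborel A = d * measure lborel \<Omega>" unfolding A_def d_def using \<Omega> elim by (intro measure_scale) auto
    have T: "P_LPS r \<Omega> W = (\<lambda>f. time_limit A (band_limit W (time_limit A f)))"
      by (auto simp: P_LPS_def A_def)
    obtain n u \<mu> where fra': "finite_rank_approx (\<lambda>f. time_limit A (band_limit W (time_limit A f))) \<kappa> n u \<mu>"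
      and tr: "(\<Sum>k<n. \<mu> k) = 2 * measure lborel A * measure lborel W / (2 * pi) ^ DIM('a)"
      and en: "2 * kernel_energy A W - \<kappa> \<le> (\<Sum>k<n. (\<mu> k)\<^sup>2)"
      by (rule exists_finite_rank_approx[OF A W \<kappa>(1)]) (rule that)
    have fra: "finite_rank_approx (P_LPS r \<Omega> W) \<kappa> n u \<mu>" using fra' unfolding T .
    have \<mu>: "\<And>k. k < n \<Longrightarrow> 0 \<le> \<mu> k \<and> \<mu> k \<le> 1 + \<kappa>" using fra by (auto simp: finite_rank_approx_def)
    have t: "(\<Sum>k<n. \<mu> k) = 2 * \<tau> * d" unfolding tr mA \<tau>_def by simp
    define q where "q = (\<Sum>k<n. \<mu> k * (1 + \<kappa> - \<mu> k))"
    have "q = (1 + \<kappa>) * (\<Sum>k<n. \<mu> k) - (\<Sum>k<n. (\<mu> k)\<^sup>2)"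
      by (simp add: q_def algebra_simps sum.distrib sum_subtractf sum_distrib_left power2_eq_square)
    also have "\<dots> \<le> (1 + \<kappa>) * (2 * \<tau> * d) - (2 * ((\<tau> - x\<^sup>2 / 4) * d) - \<kappa>)"
      using en elim unfolding t A_def[symmetric] d_def[symmetric] \<tau>_def[symmetric] by linarith
    also have "\<dots> = 2 * \<tau> * \<kappa> * d + x\<^sup>2 / 2 * d + \<kappa>" by (simp add: algebra_simps)
    \<comment> \<open>The additive \<kappa> is absorbed because r >= 1.\<close>
    also have "\<dots> \<le> 2 * \<tau> * \<kappa> * d + x\<^sup>2 / 2 * d + \<kappa> * d" using d \<kappa> by simp
    also have "\<dots> = ((2 * \<tau> + 1) * \<kappa> + x\<^sup>2 / 2) * d" by (simp add: algebra_simps)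
    also have "\<dots> \<le> (x\<^sup>2 / 2 + x\<^sup>2 / 2) * d" using \<kappa> d by (intro mult_right_mono add_mono) auto
    finally have q: "q \<le> x\<^sup>2 * d" by simp
    then have qx: "q / x \<le> x * d" using x by (simp add: pos_divide_le_eq power2_eq_square ac_simps)
    let ?J = "{k\<in>{..<n}. x < \<mu> k}"
    have cJ: "real (card ?J) \<le> (2 * \<tau> + x) * d"
    proof -
      have "real (card ?J) \<le> 2 * \<tau> * d + q / x"
        unfolding t[symmetric] q_def by (rule eigenvalue_count_bounds(1)) (use \<mu> \<kappa> x in auto)
      then show ?thesis using qx by (simp add: distrib_right)
    qed
    have cL: "(2 * \<tau> - x) * d \<le> (1 + \<kappa>) * real (card {k\<in>{..<n}. 1 - x \<le> \<mu> k})"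
    proof -
      have "2 * \<tau> * d - q / (1 - (1 - x)) \<le> (1 + \<kappa>) * real (card {k\<in>{..<n}. 1 - x \<le> \<mu> k})"
        unfolding t[symmetric] q_def by (rule eigenvalue_count_bounds(2)) (use \<mu> \<kappa> x in auto)
      then show ?thesis using qx by (simp add: left_diff_distrib)
    qed
    obtain Z where Z: "finite Z" "Z \<noteq> {}" and cov: "\<And>y. L2_set y ?J \<le> 1 \<Longrightarrow> \<exists>z\<in>Z. L2_set (\<lambda>i. y i - z i) ?J \<le> \<rho> + 2 * x"
      and lZ: "log 2 (real (card Z)) \<le> real (card ?J) * (log 2 (1 / \<rho>) + 3 * x) + C"
      using C[of ?J] by auto
    \<comment> \<open>The budget 6 x: 2 x for the cover, at most x for the factor 1 + \<kappa>, x
      for the neglected eigenvalues, at most x for \<kappa>, and a remaining x for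
      strictness.\<close>
    have eps: "(1 + \<kappa>) * (\<rho> + 2 * x) + x + \<kappa> < \<epsilon>"
    proof -
      have "\<rho> + 2 * x \<le> 1" using x \<epsilon> by (simp add: \<rho>_def)
      then have "\<kappa> * (\<rho> + 2 * x) \<le> x * 1" using \<kappa> x \<rho> by (intro mult_mono) auto
      then show ?thesis using \<kappa> x by (simp add: \<rho>_def algebra_simps)
    qed
    have \<kappa>0: "\<kappa> \<ge> 0" and x0: "x \<ge> 0" using \<kappa> x by auto
    note eb = operator_entropy_bounds[OF fra \<kappa>0 x0 Z cov eps \<epsilon>(1)]
    have lr: "log 2 (1 / \<rho>) + 3 * x \<ge> 0" using \<rho> x by (simp add: zero_le_log_cancel_iff)
    have up: "operator_entropy \<epsilon> (P_LPS r \<Omega> W) \<le> (2 * \<tau> + x) * (log 2 (1 / \<rho>) + 3 * x) * d + C"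
    proof -
      have "operator_entropy \<epsilon> (P_LPS r \<Omega> W) \<le> real (card ?J) * (log 2 (1 / \<rho>) + 3 * x) + C" using eb(2) lZ by linarith
      also have "\<dots> \<le> ((2 * \<tau> + x) * d) * (log 2 (1 / \<rho>) + 3 * x) + C"
        using cJ lr by (intro add_right_mono mult_right_mono)
      finally show ?thesis by (simp only: ac_simps)
    qed
    have low: "(2 * \<tau> - x) / (1 + x) * max 0 (log 2 ((1 - x) / (\<epsilon> + x))) * d \<le> operator_entropy \<epsilon> (P_LPS r \<Omega> W)"
    proof (cases "log 2 ((1 - x) / (\<epsilon> + x)) \<le> 0")
      case True
      then show ?thesis using eb(1) by (simp add: max_def)
    next
      case False
      let ?c = "real (card {k\<in>{..<n}. 1 - x \<le> \<mu> k})" and ?l = "log 2 ((1 - x) / (\<epsilon> + x))"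
      have "(1 + \<kappa>) * ?c \<le> (1 + x) * ?c" using \<kappa> by (intro mult_right_mono) auto
      then have "(2 * \<tau> - x) * d \<le> (1 + x) * ?c" using cL by linarith
      then have c: "(2 * \<tau> - x) / (1 + x) * d \<le> ?c" using x by (simp add: pos_divide_le_eq mult.commute)
      have "?l \<le> log 2 ((1 - x) / (\<epsilon> + \<kappa>))"
        using \<kappa> \<epsilon> x x1 by (intro log_mono divide_left_mono divide_pos_pos mult_pos_pos) auto
      then have "?c * ?l \<le> operator_entropy \<epsilon> (P_LPS r \<Omega> W)"
        using eb(3)[of "1 - x"] x1 mult_left_mono[of ?l "log 2 ((1 - x) / (\<epsilon> + \<kappa>))" ?c] by linarith
      moreover have "(2 * \<tau> - x) / (1 + x) * d * ?l \<le> ?c * ?l" using c False by (intro mult_right_mono) auto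
      ultimately show ?thesis using False by (simp add: max_def ac_simps)
    qed
    show ?case using up low unfolding d_def \<rho>_def by blast
  qed
  then show ?thesis by blast
qed

theorem theorem2:
  fixes \<Omega> W :: "'a::euclidean_space set" and \<epsilon> :: real
  assumes "compact \<Omega>" and "compact W" and "0 < \<epsilon>" and "\<epsilon> \<le> 1"
  shows "((\<lambda>r. operator_entropy \<epsilon> (P_LPS r \<Omega> W) / r ^ DIM('a)) \<longlongrightarrow>
            2 * measure lebesgue \<Omega> * measure lebesgue W / (2 * pi) ^ DIM('a) * log 2 (1 / \<epsilon>))
         at_top"
proof -
  define \<tau> where "\<tau> = measure lborel \<Omega> * measure lborel W / (2 * pi) ^ DIM('a)"
  define H where "H = (\<lambda>r. operator_entropy \<epsilon> (P_LPS r \<Omega> W))"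
  define lo where "lo = (\<lambda>x. (2 * \<tau> - x) / (1 + x) * max 0 (log 2 ((1 - x) / (\<epsilon> + x))))"
  define up where "up = (\<lambda>x. (2 * \<tau> + x) * (log 2 (1 / (\<epsilon> - 6 * x)) + 3 * x))"
  have lim: "2 * measure lebesgue \<Omega> * measure lebesgue W / (2 * pi) ^ DIM('a) * log 2 (1 / \<epsilon>) = 2 * \<tau> * log 2 (1 / \<epsilon>)"
    using borel_compact[OF assms(1)] borel_compact[OF assms(2)] by (simp add: \<tau>_def)
  have small: "\<forall>\<^sub>F x in at_right 0. 0 < x \<and> 6 * x < \<epsilon>"
    using assms(3) by (auto simp: eventually_at_right_field intro!: exI[of _ "\<epsilon> / 6"])
  have bounds: "\<exists>C. \<forall>\<^sub>F r in at_top. lo x \<le> H r / r ^ DIM('a) \<and> H r / r ^ DIM('a) \<le> up x + C / r ^ DIM('a)"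
    if x: "0 < x" "6 * x < \<epsilon>" for x
  proof -
    obtain C where C: "\<forall>\<^sub>F r in at_top. lo x * r ^ DIM('a) \<le> H r \<and> H r \<le> up x * r ^ DIM('a) + C"
      using operator_entropy_eventually_bounds[OF assms x] unfolding lo_def up_def H_def \<tau>_def by blast
    from this eventually_gt_at_top[of 0]
    have "\<forall>\<^sub>F r in at_top. lo x \<le> H r / r ^ DIM('a) \<and> H r / r ^ DIM('a) \<le> up x + C / r ^ DIM('a)"
    proof eventually_elim
      case (elim r)
      then have d: "r ^ DIM('a) > 0" by simp
      have "H r / r ^ DIM('a) \<le> (up x * r ^ DIM('a) + C) / r ^ DIM('a)" using elim d by (intro divide_right_mono) auto
      then show ?case using elim d by (simp add: pos_le_divide_eq add_divide_distrib)
    qed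
    then show ?thesis by blast
  qed
  have lo_lim: "(lo \<longlongrightarrow> 2 * \<tau> * log 2 (1 / \<epsilon>)) (at_right 0)"
  proof -
    have "(lo \<longlongrightarrow> (2 * \<tau> - 0) / (1 + 0) * max 0 (log 2 ((1 - 0) / (\<epsilon> + 0)))) (at_right 0)"
      unfolding lo_def using assms(3) by (intro tendsto_intros) auto
    \<comment> \<open>Here \<epsilon> <= 1 enters: it removes the \<open>max 0\<close> from the
      limit.\<close>
    moreover have "0 \<le> log 2 (1 / \<epsilon>)" using assms by simp
    ultimately show ?thesis by (simp add: max_def)
  qed
  have up_lim: "(up \<longlongrightarrow> 2 * \<tau> * log 2 (1 / \<epsilon>)) (at_right 0)"
  proof -
    have "(up \<longlongrightarrow> (2 * \<tau> + 0) * (log 2 (1 / (\<epsilon> - 6 * 0)) + 3 * 0)) (at_right 0)"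
      unfolding up_def using assms(3) by (intro tendsto_intros) auto
    then show ?thesis by simp
  qed
  have "((\<lambda>r. H r / r ^ DIM('a)) \<longlongrightarrow> 2 * \<tau> * log 2 (1 / \<epsilon>)) at_top"
  proof (rule order_tendstoI)
    fix a assume "a < 2 * \<tau> * log 2 (1 / \<epsilon>)"
    \<comment> \<open>x is fixed before r: once \<open>lo x\<close> exceeds a, the bound holds for
      all large r.\<close>
    then have "\<forall>\<^sub>F x in at_right 0. a < lo x \<and> 0 < x \<and> 6 * x < \<epsilon>"
      by (intro eventually_conj[OF order_tendstoD(1)[OF lo_lim] small])
    then obtain x where x: "a < lo x" "0 < x" "6 * x < \<epsilon>"
      using eventually_happens[of _ "at_right (0::real)"] by fastforce
    then obtain C where "\<forall>\<^sub>F r in at_top. lo x \<le> H r / r ^ DIM('a) \<and> H r / r ^ DIM('a) \<le> up x + C / r ^ DIM('a)"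
      using bounds by blast
    then show "\<forall>\<^sub>F r in at_top. a < H r / r ^ DIM('a)" using x(1) by (auto elim: eventually_mono)
  next
    fix b assume "2 * \<tau> * log 2 (1 / \<epsilon>) < b"
    then have "\<forall>\<^sub>F x in at_right 0. up x < b \<and> 0 < x \<and> 6 * x < \<epsilon>"
      by (intro eventually_conj[OF order_tendstoD(2)[OF up_lim] small])
    then obtain x where x: "up x < b" "0 < x" "6 * x < \<epsilon>"
      using eventually_happens[of _ "at_right (0::real)"] by fastforce
    then obtain C where C: "\<forall>\<^sub>F r in at_top. lo x \<le> H r / r ^ DIM('a) \<and> H r / r ^ DIM('a) \<le> up x + C / r ^ DIM('a)"
      using bounds by blast
    \<comment> \<open>The dimension is positive, so the constant C divided by r^d vanishes in the
      limit.\<close>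
    have "filterlim (\<lambda>r::real. r ^ DIM('a)) at_top at_top"
      by (intro filterlim_pow_at_top filterlim_ident) auto
    then have "((\<lambda>r::real. C / r ^ DIM('a)) \<longlongrightarrow> 0) at_top" by (rule tendsto_divide_0[OF tendsto_const filterlim_at_top_imp_at_infinity])
    then have "\<forall>\<^sub>F r in at_top. C / r ^ DIM('a) < b - up x" using x(1) by (intro order_tendstoD(2)) auto
    with C show "\<forall>\<^sub>F r in at_top. H r / r ^ DIM('a) < b" by eventually_elim auto
  qed
  then show ?thesis unfolding lim H_def .
qed

end
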